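(* Let $k$ be an algebraically closed field (of arbitrary characteristic), let $V$ be a finite-dimensional $k$-vector space with dual $V'$, and let $(\theta_i)_{i\in I}$ be a family of objects each of which is of one of the following eight types: an element of $V$; an element of $V'$; an element of $V\otimes V$; an element of $V'\otimes V'$; an element of $V\otimes V'=\mathrm{End}(V)$; a quadratic form on $V$; a quadratic form on $V'$; a vector subspace $W$ of $V$. Let $G\subset\mathbf{GL}_V$ be the fixer of the family $(\theta_i)_{i\in I}$. Then the maximal tori of $G$ are of type PL.
   Context: $\mathbf{GL}_V$ is the algebraic group of automorphisms of $V$. The fixer $G$ is the closed subgroup scheme of $\mathbf{GL}_V$ whose points in a commutative $k$-algebra $k'$ are the automorphisms of $k'\otimes_kV$ which fix all the objects obtained from the $\theta_i$ by extension of scalars to $k'$; when $\theta_i$ is a subspace $W$, this means leaving $k'\otimes_kW$ stable. A finite subset $\Omega$ of a free $\mathbf{Z}$-module of finite rank is called almost free (of type PL) if there is a $\mathbf{Z}$-linearly independent subset $\omega\subset\Omega$ such that $\Omega\subset\{0\}\cup\omega\cup-\omega$, where $-\omega=\{-\alpha:\alpha\in\omega\}$. If a torus $T$ acts linearly on a finite-dimensional space $V$, with character group $X(T)=\mathrm{Hom}(T,\mathbf{G}_m)$ written additively, the action is of type PL if the set $\Omega\subset X(T)$ of weights of $T$ in $V$ is almost free. A subtorus of $\mathbf{GL}_V$ is of type PL if its natural action on $V$ is. *)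

theory Defs
  imports
    "HOL-Algebra.Algebra"
    "HOL-Algebra.Algebraic_Closure_Type"
    "HOL-Algebra.Product_Groups"
    "HOL-Algebra.Bij"
    "HOL-Library.Poly_Mapping"
begin

text \<open>
  The ground field is a type of class \<^class>\<open>alg_closed_field\<close>, and \<open>V\<close> is a type with a
  scalar multiplication \<open>scale\<close> and a finite basis \<open>B\<close> (locale
  \<open>finite_dimensional_vector_space\<close>). Commutative \<open>k\<close>-algebras are records satisfying the locale
  \<^locale>\<open>algebra\<close>; group schemes are treated as functors on them. The carriers of the algebras
  lie in a type \<open>'u\<close>, which plays the role of a universe and stays arbitrary throughout. As soon
  as \<open>'u\<close> admits an injection from \<open>'k\<close>, it contains copies of all nonzero \<open>k\<close>-algebras of
  finite type, and those determine closed subschemes of \<open>GL(V)\<close> and the morphisms between them.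
\<close>

type_synonym ('k, 'v, 'u) subfunctor =
  "('k, 'u) module \<Rightarrow> (('v \<Rightarrow> 'u) \<Rightarrow> ('v \<Rightarrow> 'u)) set"

abbreviation ground_ring :: "'k::field ring"
  where "ground_ring \<equiv> ring_of_type_algebra"

definition k_algebras :: "('k::field, 'u) module set"
  where "k_algebras = {A. algebra ground_ring A}"

definition structure_map :: "('k, 'u) module \<Rightarrow> 'k \<Rightarrow> 'u"
  where "structure_map A c = c \<odot>\<^bsub>A\<^esub> \<one>\<^bsub>A\<^esub>"

definition algebra_hom :: "('k, 'u) module \<Rightarrow> ('k, 'u) module \<Rightarrow> ('u \<Rightarrow> 'u) set"
  where "algebra_hom A A' =
    {h \<in> ring_hom A A'. \<forall>c. \<forall>a \<in> carrier A. h (c \<odot>\<^bsub>A\<^esub> a) = c \<odot>\<^bsub>A'\<^esub> h a}"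


section \<open>Forms\<close>

definition bilinear_form :: "('a, 'm) ring_scheme \<Rightarrow> ('a, 'x, 'n) module_scheme \<Rightarrow> ('x \<Rightarrow> 'x \<Rightarrow> 'a) \<Rightarrow> bool"
  where "bilinear_form R M \<beta> \<longleftrightarrow>
    (\<forall>x \<in> carrier M. \<forall>y \<in> carrier M. \<beta> x y \<in> carrier R) \<and>
    (\<forall>x \<in> carrier M. \<forall>x' \<in> carrier M. \<forall>y \<in> carrier M.
       \<beta> (x \<oplus>\<^bsub>M\<^esub> x') y = \<beta> x y \<oplus>\<^bsub>R\<^esub> \<beta> x' y \<and>
       \<beta> y (x \<oplus>\<^bsub>M\<^esub> x') = \<beta> y x \<oplus>\<^bsub>R\<^esub> \<beta> y x') \<and>
    (\<forall>a \<in> carrier R. \<forall>x \<in> carrier M. \<forall>y \<in> carrier M.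
       \<beta> (a \<odot>\<^bsub>M\<^esub> x) y = a \<otimes>\<^bsub>R\<^esub> \<beta> x y \<and>
       \<beta> x (a \<odot>\<^bsub>M\<^esub> y) = a \<otimes>\<^bsub>R\<^esub> \<beta> x y)"

definition quadratic_form :: "('a, 'm) ring_scheme \<Rightarrow> ('a, 'x, 'n) module_scheme \<Rightarrow> ('x \<Rightarrow> 'a) \<Rightarrow> bool"
  where "quadratic_form R M q \<longleftrightarrow>
    (\<forall>x \<in> carrier M. q x \<in> carrier R) \<and>
    (\<forall>a \<in> carrier R. \<forall>x \<in> carrier M. q (a \<odot>\<^bsub>M\<^esub> x) = a \<otimes>\<^bsub>R\<^esub> a \<otimes>\<^bsub>R\<^esub> q x) \<and>
    bilinear_form R M (\<lambda>x y. q (x \<oplus>\<^bsub>M\<^esub> y) \<ominus>\<^bsub>R\<^esub> q x \<ominus>\<^bsub>R\<^esub> q y)"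


section \<open>The space, its dual, and extension of scalars\<close>

definition vec_module :: "('k::field \<Rightarrow> 'v::ab_group_add \<Rightarrow> 'v) \<Rightarrow> ('k, 'v) module"
  where "vec_module scale =
    \<lparr>carrier = UNIV, monoid.mult = undefined, one = undefined, ring.zero = 0, add = (+), module.smult = scale\<rparr>"

definition dual_module :: "('k::field \<Rightarrow> 'v::ab_group_add \<Rightarrow> 'v) \<Rightarrow> ('k, 'v \<Rightarrow> 'k) module"
  where "dual_module scale =
    \<lparr>carrier = {f. Vector_Spaces.linear scale (*) f}, monoid.mult = undefined, one = undefined,
     ring.zero = (\<lambda>v. 0), add = (\<lambda>f g v. f v + g v), module.smult = (\<lambda>c f v. c * f v)\<rparr>"

abbreviation coord :: "('k::field \<Rightarrow> 'v::ab_group_add \<Rightarrow> 'v) \<Rightarrow> 'v set \<Rightarrow> 'v \<Rightarrow> 'v \<Rightarrow> 'k"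
  where "coord scale B b v \<equiv> module.representation scale B v b"

text \<open>
  \<open>A \<otimes> V\<close> is free over \<open>A\<close> on the elements \<open>1 \<otimes> b\<close> with \<open>b \<in> B\<close>, and \<open>A \<otimes> V'\<close> is free on
  the dual basis. Both are represented by the module of coordinate families indexed by \<open>B\<close>;
  \<open>ext_vec\<close> and \<open>ext_covec\<close> are the maps \<open>v \<mapsto> 1 \<otimes> v\<close> and \<open>f \<mapsto> 1 \<otimes> f\<close>.
\<close>

definition ext_module :: "('k, 'u) module \<Rightarrow> 'v set \<Rightarrow> ('u, 'v \<Rightarrow> 'u) module"
  where "ext_module A B =
    \<lparr>carrier = B \<rightarrow>\<^sub>E carrier A, monoid.mult = undefined, one = undefined,
     ring.zero = (\<lambda>b\<in>B. \<zero>\<^bsub>A\<^esub>), add = (\<lambda>x y. \<lambda>b\<in>B. x b \<oplus>\<^bsub>A\<^esub> y b),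
     module.smult = (\<lambda>a x. \<lambda>b\<in>B. a \<otimes>\<^bsub>A\<^esub> x b)\<rparr>"

definition unit_vec :: "('k, 'u) module \<Rightarrow> 'v set \<Rightarrow> 'v \<Rightarrow> ('v \<Rightarrow> 'u)"
  where "unit_vec A B c = (\<lambda>b\<in>B. if b = c then \<one>\<^bsub>A\<^esub> else \<zero>\<^bsub>A\<^esub>)"

definition ext_vec :: "('k::field \<Rightarrow> 'v::ab_group_add \<Rightarrow> 'v) \<Rightarrow> 'v set \<Rightarrow> ('k, 'u) module \<Rightarrow> 'v \<Rightarrow> ('v \<Rightarrow> 'u)"
  where "ext_vec scale B A v = (\<lambda>b\<in>B. structure_map A (coord scale B b v))"

definition ext_covec :: "'v set \<Rightarrow> ('k, 'u) module \<Rightarrow> ('v \<Rightarrow> 'k) \<Rightarrow> ('v \<Rightarrow> 'u)"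
  where "ext_covec B A f = (\<lambda>b\<in>B. structure_map A (f b))"

text \<open>The submodule \<open>A \<otimes> W\<close> of \<open>A \<otimes> V\<close>.\<close>

definition ext_subspace :: "('k::field \<Rightarrow> 'v::ab_group_add \<Rightarrow> 'v) \<Rightarrow> 'v set \<Rightarrow> ('k, 'u) module \<Rightarrow> 'v set \<Rightarrow> ('v \<Rightarrow> 'u) set"
  where "ext_subspace scale B A W =
    \<Inter>{N. submodule N A (ext_module A B) \<and> ext_vec scale B A ` W \<subseteq> N}"


section \<open>The group scheme \<open>GL(V)\<close>\<close>

definition GL :: "'v set \<Rightarrow> ('k, 'u) module \<Rightarrow> (('v \<Rightarrow> 'u) \<Rightarrow> ('v \<Rightarrow> 'u)) monoid"
  where "GL B A = (BijGroup (carrier (ext_module A B)))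
    \<lparr>carrier := {g \<in> Bij (carrier (ext_module A B)).
      (\<forall>x \<in> carrier (ext_module A B). \<forall>y \<in> carrier (ext_module A B).
         g (x \<oplus>\<^bsub>ext_module A B\<^esub> y) = g x \<oplus>\<^bsub>ext_module A B\<^esub> g y) \<and>
      (\<forall>a \<in> carrier A. \<forall>x \<in> carrier (ext_module A B).
         g (a \<odot>\<^bsub>ext_module A B\<^esub> x) = a \<odot>\<^bsub>ext_module A B\<^esub> g x)}\<rparr>"

definition entry :: "('k, 'u) module \<Rightarrow> 'v set \<Rightarrow> (('v \<Rightarrow> 'u) \<Rightarrow> ('v \<Rightarrow> 'u)) \<Rightarrow> 'v \<times> 'v \<Rightarrow> 'u"
  where "entry A B g = (\<lambda>(b, c). g (unit_vec A B c) b)"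

text \<open>The map \<open>GL(V)(A) \<rightarrow> GL(V)(A')\<close> induced by an algebra homomorphism \<open>h\<close> from \<open>A\<close> to \<open>A'\<close>.\<close>

definition base_change ::
    "'v set \<Rightarrow> ('k, 'u) module \<Rightarrow> ('k, 'u) module \<Rightarrow> ('u \<Rightarrow> 'u) \<Rightarrow>
     (('v \<Rightarrow> 'u) \<Rightarrow> ('v \<Rightarrow> 'u)) \<Rightarrow> (('v \<Rightarrow> 'u) \<Rightarrow> ('v \<Rightarrow> 'u))"
  where "base_change B A A' h g =
    (\<lambda>x \<in> carrier (ext_module A' B). \<lambda>b\<in>B. \<Oplus>\<^bsub>A'\<^esub>c\<in>B. h (entry A B g (b, c)) \<otimes>\<^bsub>A'\<^esub> x c)"

text \<open>
  The contragredient action on \<open>A \<otimes> V'\<close>, that is, \<open>f \<mapsto> f \<circ> g\<inverse>\<close>: the coordinate at \<open>b\<close>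
  of the transformed linear form is its value on \<open>1 \<otimes> b\<close>.
\<close>

definition contragredient :: "'v set \<Rightarrow> ('k, 'u) module \<Rightarrow> (('v \<Rightarrow> 'u) \<Rightarrow> ('v \<Rightarrow> 'u)) \<Rightarrow> (('v \<Rightarrow> 'u) \<Rightarrow> ('v \<Rightarrow> 'u))"
  where "contragredient B A g =
    (\<lambda>y \<in> carrier (ext_module A B). \<lambda>b\<in>B.
       \<Oplus>\<^bsub>A\<^esub>c\<in>B. y c \<otimes>\<^bsub>A\<^esub> (inv\<^bsub>GL B A\<^esub> g) (unit_vec A B b) c)"

text \<open>The action of \<open>m \<otimes> m'\<close> on a tensor with coordinates \<open>t (b, c)\<close>.\<close>

definition tensor_action ::
    "'v set \<Rightarrow> ('k, 'u) module \<Rightarrow> (('v \<Rightarrow> 'u) \<Rightarrow> ('v \<Rightarrow> 'u)) \<Rightarrow> (('v \<Rightarrow> 'u) \<Rightarrow> ('v \<Rightarrow> 'u)) \<Rightarrow>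
     ('v \<times> 'v \<Rightarrow> 'u) \<Rightarrow> ('v \<times> 'v \<Rightarrow> 'u)"
  where "tensor_action B A m m' t =
    (\<lambda>(b, c) \<in> B \<times> B. \<Oplus>\<^bsub>A\<^esub>p\<in>B \<times> B.
       entry A B m (b, fst p) \<otimes>\<^bsub>A\<^esub> entry A B m' (c, snd p) \<otimes>\<^bsub>A\<^esub> t p)"


section \<open>The fixer\<close>

text \<open>
  \<open>V' \<otimes> V'\<close> is the space of bilinear forms on \<open>V\<close> and \<open>V \<otimes> V\<close> the space of bilinear forms on
  \<open>V'\<close>. As \<open>V \<otimes> V'\<close> is \<open>End(V)\<close>, the coordinate at \<open>(b, c)\<close> of an endomorphism \<open>u\<close> is
  the coordinate at \<open>b\<close> of \<open>u c\<close>.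
\<close>

datatype ('k, 'v) fixed_object =
    Vector 'v
  | Covector "'v \<Rightarrow> 'k"
  | Tensor "('v \<Rightarrow> 'k) \<Rightarrow> ('v \<Rightarrow> 'k) \<Rightarrow> 'k"
  | Cotensor "'v \<Rightarrow> 'v \<Rightarrow> 'k"
  | Endomorphism "'v \<Rightarrow> 'v"
  | Quadratic "'v \<Rightarrow> 'k"
  | Dual_Quadratic "('v \<Rightarrow> 'k) \<Rightarrow> 'k"
  | Subspace "'v set"

fun wf_object :: "('k::field \<Rightarrow> 'v::ab_group_add \<Rightarrow> 'v) \<Rightarrow> ('k, 'v) fixed_object \<Rightarrow> bool"
  where
    "wf_object scale (Vector v) \<longleftrightarrow> True"
  | "wf_object scale (Covector f) \<longleftrightarrow> Vector_Spaces.linear scale (*) f"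
  | "wf_object scale (Tensor \<tau>) \<longleftrightarrow> bilinear_form ground_ring (dual_module scale) \<tau>"
  | "wf_object scale (Cotensor \<beta>) \<longleftrightarrow> bilinear_form ground_ring (vec_module scale) \<beta>"
  | "wf_object scale (Endomorphism u) \<longleftrightarrow> Vector_Spaces.linear scale scale u"
  | "wf_object scale (Quadratic q) \<longleftrightarrow> quadratic_form ground_ring (vec_module scale) q"
  | "wf_object scale (Dual_Quadratic q) \<longleftrightarrow> quadratic_form ground_ring (dual_module scale) q"
  | "wf_object scale (Subspace W) \<longleftrightarrow> module.subspace scale W"

text \<open>
  The form obtained from a quadratic form \<open>q\<close> by extension of scalars is the unique quadratic form
  \<open>Q\<close> over \<open>A\<close> with \<open>Q (1 \<otimes> x) = q x\<close>.
\<close>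

fun fixes_object ::
    "('k::field \<Rightarrow> 'v::ab_group_add \<Rightarrow> 'v) \<Rightarrow> 'v set \<Rightarrow> ('k, 'u) module \<Rightarrow>
     (('v \<Rightarrow> 'u) \<Rightarrow> ('v \<Rightarrow> 'u)) \<Rightarrow> ('k, 'v) fixed_object \<Rightarrow> bool"
  where
    "fixes_object scale B A g (Vector v) \<longleftrightarrow> g (ext_vec scale B A v) = ext_vec scale B A v"
  | "fixes_object scale B A g (Covector f) \<longleftrightarrow>
       contragredient B A g (ext_covec B A f) = ext_covec B A f"
  | "fixes_object scale B A g (Tensor \<tau>) \<longleftrightarrow>
       (let t = (\<lambda>(b, c) \<in> B \<times> B. structure_map A (\<tau> (coord scale B b) (coord scale B c)))
        in tensor_action B A g g t = t)"
  | "fixes_object scale B A g (Cotensor \<beta>) \<longleftrightarrow>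
       (let t = (\<lambda>(b, c) \<in> B \<times> B. structure_map A (\<beta> b c))
        in tensor_action B A (contragredient B A g) (contragredient B A g) t = t)"
  | "fixes_object scale B A g (Endomorphism u) \<longleftrightarrow>
       (let t = (\<lambda>(b, c) \<in> B \<times> B. structure_map A (coord scale B b (u c)))
        in tensor_action B A g (contragredient B A g) t = t)"
  | "fixes_object scale B A g (Quadratic q) \<longleftrightarrow>
       (\<exists>Q. quadratic_form A (ext_module A B) Q \<and>
            (\<forall>v. Q (ext_vec scale B A v) = structure_map A (q v)) \<and>
            (\<forall>x \<in> carrier (ext_module A B). Q (g x) = Q x))"
  | "fixes_object scale B A g (Dual_Quadratic q) \<longleftrightarrow>
       (\<exists>Q. quadratic_form A (ext_module A B) Q \<and>
            (\<forall>f \<in> carrier (dual_module scale). Q (ext_covec B A f) = structure_map A (q f)) \<and>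
            (\<forall>y \<in> carrier (ext_module A B). Q (contragredient B A g y) = Q y))"
  | "fixes_object scale B A g (Subspace W) \<longleftrightarrow>
       g ` ext_subspace scale B A W \<subseteq> ext_subspace scale B A W"

definition fixer ::
    "('k::field \<Rightarrow> 'v::ab_group_add \<Rightarrow> 'v) \<Rightarrow> 'v set \<Rightarrow> 'i set \<Rightarrow> ('i \<Rightarrow> ('k, 'v) fixed_object) \<Rightarrow>
     ('k, 'v, 'u) subfunctor"
  where "fixer scale B I \<theta> A =
    {g \<in> carrier (GL B A). \<forall>i\<in>I. fixes_object scale B A g (\<theta> i)}"


section \<open>Subtori of \<open>GL(V)\<close>\<close>

text \<open>Polynomials over \<open>k\<close> in the matrix entries; the indeterminates are indexed by \<open>B \<times> B\<close>.\<close>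

definition entry_polys :: "'v set \<Rightarrow> (('v \<times> 'v \<Rightarrow>\<^sub>0 nat) \<Rightarrow>\<^sub>0 'k::field) set"
  where "entry_polys B = {F. \<forall>m \<in> Poly_Mapping.keys F. Poly_Mapping.keys m \<subseteq> B \<times> B}"

definition eval_entries ::
    "'v set \<Rightarrow> ('k, 'u) module \<Rightarrow> (('v \<Rightarrow> 'u) \<Rightarrow> ('v \<Rightarrow> 'u)) \<Rightarrow> (('v \<times> 'v \<Rightarrow>\<^sub>0 nat) \<Rightarrow>\<^sub>0 'k::field) \<Rightarrow> 'u"
  where "eval_entries B A g F =
    (\<Oplus>\<^bsub>A\<^esub>m\<in>Poly_Mapping.keys F. Poly_Mapping.lookup F m \<odot>\<^bsub>A\<^esub>
       (\<Otimes>\<^bsub>A\<^esub>p\<in>Poly_Mapping.keys m. entry A B g p [^]\<^bsub>A\<^esub> Poly_Mapping.lookup m p))"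

text \<open>
  A closed subscheme of \<open>GL(V)\<close> is the zero locus of a set of elements of the coordinate ring
  \<open>k[x\<^sub>b\<^sub>c, 1/det]\<close>; since the determinant is a unit there, polynomials in the \<open>x\<^sub>b\<^sub>c\<close> suffice.
\<close>

definition closed_subgroup_scheme :: "'v set \<Rightarrow> ('k::field, 'v, 'u) subfunctor \<Rightarrow> bool"
  where "closed_subgroup_scheme B H \<longleftrightarrow>
    (\<forall>A \<in> k_algebras. subgroup (H A) (GL B A)) \<and>
    (\<exists>\<F> \<subseteq> entry_polys B. \<forall>A \<in> k_algebras.
       H A = {g \<in> carrier (GL B A). \<forall>F\<in>\<F>. eval_entries B A g F = \<zero>\<^bsub>A\<^esub>})"

definition points :: "'v set \<Rightarrow> ('k, 'v, 'u) subfunctor \<Rightarrow> ('k, 'u) module \<Rightarrow> (('v \<Rightarrow> 'u) \<Rightarrow> ('v \<Rightarrow> 'u)) monoid"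
  where "points B H A = (GL B A)\<lparr>carrier := H A\<rparr>"

text \<open>The points of the \<open>r\<close>-th power of the multiplicative group.\<close>

definition Gm_power :: "nat \<Rightarrow> ('k, 'u) module \<Rightarrow> (nat \<Rightarrow> 'u) monoid"
  where "Gm_power r A = product_group {..<r} (\<lambda>_. units_of A)"

text \<open>As \<open>k\<close> is algebraically closed, a torus is an algebraic group isomorphic to some \<open>Gm_power r\<close>.\<close>

definition subtorus :: "'v set \<Rightarrow> ('k::field, 'v, 'u) subfunctor \<Rightarrow> bool"
  where "subtorus B T \<longleftrightarrow> closed_subgroup_scheme B T \<and>
    (\<exists>r \<psi>. (\<forall>A \<in> k_algebras. \<psi> A \<in> iso (Gm_power r A) (points B T A)) \<and>
      (\<forall>A \<in> k_algebras. \<forall>A' \<in> k_algebras. \<forall>h \<in> algebra_hom A A'.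
         \<forall>x \<in> carrier (Gm_power r A).
           \<psi> A' (\<lambda>i\<in>{..<r}. h (x i)) = base_change B A A' h (\<psi> A x)))"

definition sub_le :: "('k::field, 'v, 'u) subfunctor \<Rightarrow> ('k, 'v, 'u) subfunctor \<Rightarrow> bool"
  where "sub_le H H' \<longleftrightarrow> (\<forall>A \<in> k_algebras. H A \<subseteq> H' A)"

definition maximal_torus :: "'v set \<Rightarrow> ('k::field, 'v, 'u) subfunctor \<Rightarrow> ('k, 'v, 'u) subfunctor \<Rightarrow> bool"
  where "maximal_torus B G T \<longleftrightarrow> subtorus B T \<and> sub_le T G \<and>
    (\<forall>T'. subtorus B T' \<and> sub_le T' G \<and> sub_le T T' \<longrightarrow> sub_le T' T)"


section \<open>Characters, weights, and type PL\<close>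

type_synonym ('k, 'v, 'u) character =
  "('k, 'u) module \<Rightarrow> (('v \<Rightarrow> 'u) \<Rightarrow> ('v \<Rightarrow> 'u)) \<Rightarrow> 'u"

text \<open>
  The character group, written multiplicatively. Natural transformations are made extensional, so
  that equality of characters is equality of functions.
\<close>

definition character_group :: "'v set \<Rightarrow> ('k::field, 'v, 'u) subfunctor \<Rightarrow> ('k, 'v, 'u) character monoid"
  where "character_group B T =
    \<lparr>carrier = {\<chi> \<in> extensional k_algebras.
       (\<forall>A \<in> k_algebras. \<chi> A \<in> hom (points B T A) (units_of A) \<inter> extensional (T A)) \<and>
       (\<forall>A \<in> k_algebras. \<forall>A' \<in> k_algebras. \<forall>h \<in> algebra_hom A A'. \<forall>g \<in> T A.
          \<chi> A' (base_change B A A' h g) = h (\<chi> A g))},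
     monoid.mult = (\<lambda>\<chi> \<chi>'. \<lambda>A\<in>k_algebras. \<lambda>g\<in>T A. \<chi> A g \<otimes>\<^bsub>A\<^esub> \<chi>' A g),
     one = (\<lambda>A\<in>k_algebras. \<lambda>g\<in>T A. \<one>\<^bsub>A\<^esub>)\<rparr>"

definition weights ::
    "('k::field \<Rightarrow> 'v::ab_group_add \<Rightarrow> 'v) \<Rightarrow> 'v set \<Rightarrow> ('k, 'v, 'u) subfunctor \<Rightarrow> ('k, 'v, 'u) character set"
  where "weights scale B T =
    {\<chi> \<in> carrier (character_group B T). \<exists>v. v \<noteq> 0 \<and>
       (\<forall>A \<in> k_algebras. \<forall>g \<in> T A.
          g (ext_vec scale B A v) = \<chi> A g \<odot>\<^bsub>ext_module A B\<^esub> ext_vec scale B A v)}"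

text \<open>Linear independence over the integers in a multiplicatively written abelian group.\<close>

definition int_independent :: "('x, 'm) monoid_scheme \<Rightarrow> 'x set \<Rightarrow> bool"
  where "int_independent M \<omega> \<longleftrightarrow>
    (\<forall>c :: 'x \<Rightarrow> int. finprod M (\<lambda>\<alpha>. \<alpha> [^]\<^bsub>M\<^esub> c \<alpha>) \<omega> = \<one>\<^bsub>M\<^esub> \<longrightarrow> (\<forall>\<alpha>\<in>\<omega>. c \<alpha> = 0))"

definition almost_free :: "('x, 'm) monoid_scheme \<Rightarrow> 'x set \<Rightarrow> bool"
  where "almost_free M \<Omega> \<longleftrightarrow> \<Omega> \<subseteq> carrier M \<and> finite \<Omega> \<and>
    (\<exists>\<omega> \<subseteq> \<Omega>. int_independent M \<omega> \<and> \<Omega> \<subseteq> {\<one>\<^bsub>M\<^esub>} \<union> \<omega> \<union> m_inv M ` \<omega>)"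

definition type_PL ::
    "('k::field \<Rightarrow> 'v::ab_group_add \<Rightarrow> 'v) \<Rightarrow> 'v set \<Rightarrow> ('k, 'v, 'u) subfunctor \<Rightarrow> bool"
  where "type_PL scale B T \<longleftrightarrow> almost_free (character_group B T) (weights scale B T)"

end

theory Submission
  imports Defs "HOL-Library.Product_Plus"
begin

text \<open>
  A subtorus of \<open>GL(V)\<close> splits \<open>V\<close> into weight spaces \<open>V\<^sub>m\<close>: the image of the generic point of the
  torus is a matrix of Laurent polynomials, whose coefficients are orthogonal idempotents because
  the torus acts by a homomorphism. A tensor or quadratic form fixed by the
  torus only involves the products \<open>V\<^sub>m \<otimes> V\<^sub>n\<close> with \<open>m + n = 0\<close>, a fixed vector or linear form only involves
  \<open>V\<^sub>0\<close>, and a stable subspace is the sum of its intersections with the \<open>V\<^sub>m\<close>. Hence such an object is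
  also fixed by the possibly larger torus that acts on \<open>V\<^sub>m\<close> and \<open>V\<^bsub>-m\<^esub>\<close> by independent coordinates
  \<open>t\<^sub>m\<close> and \<open>t\<^sub>m\<inverse>\<close>, one for each pair of opposite nonzero weights, and trivially on \<open>V\<^sub>0\<close>. A maximal torus therefore
  equals this larger torus, whose weights are almost free by construction.

  If the universe \<open>'u\<close> does not contain a nonzero algebra, every character is trivial. Otherwise the
  field, which is infinite, embeds in \<open>'u\<close>, and so does the ring of Laurent polynomials.
\<close>

text \<open>Everything is tested at the generic point. By functoriality its image determines a
  homomorphism from the torus on all points, and an object fixed there gives an identity of Laurent
  polynomials whose coefficients can be compared. The Laurent ring has infinitely many
  indeterminates, so that two independent generic points, from which orthogonality is read off, live
  in one algebra. Two obstacles shape the rest. In characteristic 2 a quadratic form is not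
  determined by its polar form; it is therefore written as \<open>bil B G x x\<close> with
  \<open>G\<close> not necessarily symmetric, and \<open>G\<close> must be made compatible with the
  weights. Moreover, maximality compares only closed subgroup schemes, so the enlarged torus needs
  explicit equations. They come from linear polynomials in the matrix entries that extract the
  scalar by which a matrix acts on each weight space. The same polynomials define the weights of the
  given torus as characters; evaluated on the enlarged torus, whose coordinates are independent,
  they show that the chosen weights are independent.\<close>

abbreviation "single \<equiv> Poly_Mapping.single"
abbreviation "lookup \<equiv> Poly_Mapping.lookup"
abbreviation "keys \<equiv> Poly_Mapping.keys"


section \<open>Algebras and evaluation of polynomials\<close>

lemma (in abelian_monoid) finsum_swap:
  assumes "finite I" "finite J" "\<And>i j. i \<in> I \<Longrightarrow> j \<in> J \<Longrightarrow> f i j \<in> carrier G"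
  shows "(\<Oplus>i\<in>I. \<Oplus>j\<in>J. f i j) = (\<Oplus>j\<in>J. \<Oplus>i\<in>I. f i j)"
  using assms(1,3)
proof (induction I rule: finite_induct)
  case empty
  then show ?case by (simp add: add.finprod_one_eqI)
next
  case (insert i I)
  have "(\<Oplus>k\<in>insert i I. \<Oplus>j\<in>J. f k j) = (\<Oplus>j\<in>J. f i j) \<oplus> (\<Oplus>j\<in>J. \<Oplus>k\<in>I. f k j)"
    using insert by (subst add.finprod_insert) (auto intro!: finsum_closed)
  also have "\<dots> = (\<Oplus>j\<in>J. f i j \<oplus> (\<Oplus>k\<in>I. f k j))"
    using insert by (subst finsum_addf) (auto intro!: finsum_closed)
  also have "\<dots> = (\<Oplus>j\<in>J. \<Oplus>k\<in>insert i I. f k j)"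
    using insert by (intro add.finprod_cong') (auto intro!: finsum_closed)
  finally show ?case .
qed

lemma (in abelian_monoid) finsum_delta:
  assumes "finite I" "i \<in> I" "f i \<in> carrier G"
  shows "(\<Oplus>j\<in>I. if j = i then f j else \<zero>) = f i"
proof -
  have "(\<Oplus>j\<in>I. if j = i then f j else \<zero>) = (\<Oplus>j\<in>I. if j = i then f i else \<zero>)"
    using assms by (intro add.finprod_cong') auto
  also have "\<dots> = f i"
    using assms add.finprod_singleton_swap[of i I "\<lambda>_. f i"] by simp
  finally show ?thesis .
qed

lemma (in abelian_monoid) finsum_cartesian:
  assumes "finite I" "finite J" "\<And>i j. i \<in> I \<Longrightarrow> j \<in> J \<Longrightarrow> f (i, j) \<in> carrier G"
  shows "(\<Oplus>p\<in>I \<times> J. f p) = (\<Oplus>i\<in>I. \<Oplus>j\<in>J. f (i, j))"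
  using assms(1,3)
proof (induction I rule: finite_induct)
  case (insert i I)
  have eq: "insert i I \<times> J = Pair i ` J \<union> I \<times> J"
    by auto
  have "(\<Oplus>p\<in>insert i I \<times> J. f p) = (\<Oplus>p\<in>Pair i ` J. f p) \<oplus> (\<Oplus>p\<in>I \<times> J. f p)"
    unfolding eq using insert \<open>finite J\<close> by (intro finsum_Un_disjoint) auto
  also have "(\<Oplus>p\<in>Pair i ` J. f p) = (\<Oplus>j\<in>J. f (i, j))"
    using insert by (intro finsum_reindex) (auto simp: inj_on_def)
  finally show ?case
    using insert by (subst add.finprod_insert) (auto intro!: finsum_closed)
qed simp

locale k_algebra = cring A for A :: "('k::field, 'u) module" (structure) +
  assumes is_k_algebra: "A \<in> k_algebras"
begin

sublocale alg: algebra "ground_ring :: 'k ring" A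
  using is_k_algebra by (simp add: k_algebras_def)

lemma smult_eq: "a \<in> carrier A \<Longrightarrow> c \<odot> a = structure_map A c \<otimes> a"
  using alg.smult_assoc2[of c \<one> a] by (simp add: structure_map_def ring_of_type_algebra_def)

lemma sm_closed [simp, intro]: "structure_map A c \<in> carrier A"
  unfolding structure_map_def by (rule alg.smult_closed) (auto simp: ring_of_type_algebra_def)

lemma sm_add: "structure_map A (c + d) = structure_map A c \<oplus> structure_map A d"
  using alg.smult_l_distr[of c d \<one>] by (simp add: structure_map_def ring_of_type_algebra_def)

lemma sm_one [simp]: "structure_map A 1 = \<one>"
  using alg.smult_one[of \<one>] by (simp add: structure_map_def ring_of_type_algebra_def)

lemma sm_mult: "structure_map A (c * d) = structure_map A c \<otimes> structure_map A d"
proof -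
  have "structure_map A (c * d) = c \<odot> structure_map A d"
    using alg.smult_assoc1[of c d \<one>] by (simp add: structure_map_def ring_of_type_algebra_def)
  then show ?thesis
    by (simp add: smult_eq)
qed

lemma sm_zero [simp]: "structure_map A 0 = \<zero>"
  using alg.smult_l_null[of \<one>] by (simp add: structure_map_def ring_of_type_algebra_def)

lemma sm_unit: "c \<noteq> 0 \<Longrightarrow> structure_map A c \<in> Units A"
  by (rule unit_factor[of _ "structure_map A (inverse c)"]) (auto simp: sm_mult[symmetric])

lemma sm_inverse:
  assumes "c \<noteq> 0" "a \<in> carrier A"
  shows "structure_map A (inverse c) \<otimes> (structure_map A c \<otimes> a) = a"
  using assms by (simp add: m_assoc[symmetric] sm_mult[symmetric])

lemma sm_sum: "finite I \<Longrightarrow> structure_map A (\<Sum>i\<in>I. f i) = (\<Oplus>i\<in>I. structure_map A (f i))"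
  by (induction I rule: finite_induct) (auto simp: sm_add)

lemma sm_uminus: "structure_map A (- c) = \<ominus> structure_map A c"
  by (rule sum_zero_eq_neg) (auto simp: sm_add[symmetric])

lemma sm_inj: "\<one> \<noteq> \<zero> \<Longrightarrow> structure_map A c = structure_map A d \<longleftrightarrow> c = d"
proof
  assume ne: "\<one> \<noteq> \<zero>" and eq: "structure_map A c = structure_map A d"
  show "c = d"
  proof (rule ccontr)
    assume "c \<noteq> d"
    then have "\<one> = structure_map A (inverse (c - d) * (c - d))" by simp
    also have "\<dots> = structure_map A (inverse (c - d)) \<otimes> (structure_map A c \<oplus> \<ominus> structure_map A d)"
      unfolding sm_mult by (simp only: diff_conv_add_uminus sm_add sm_uminus)
    also have "\<dots> = \<zero>" by (simp add: eq r_neg)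
    finally show False using ne by simp
  qed
qed simp

end

lemma k_algebra_iff: "k_algebra A \<longleftrightarrow> A \<in> k_algebras"
  by (auto simp: k_algebra_def k_algebra_axioms_def k_algebras_def algebra_def intro: algebra.M_cring)

lemma algebra_homD:
  assumes "A \<in> k_algebras" "A' \<in> k_algebras" "h \<in> algebra_hom A A'"
  shows "ring_hom_cring A A' h" "h (structure_map A c) = structure_map A' c"
proof -
  interpret A: k_algebra A using assms by (simp add: k_algebra_iff)
  interpret A': k_algebra A' using assms by (simp add: k_algebra_iff)
  show "ring_hom_cring A A' h"
    using assms by unfold_locales (auto simp: algebra_hom_def)
  have "h (c \<odot>\<^bsub>A\<^esub> \<one>\<^bsub>A\<^esub>) = c \<odot>\<^bsub>A'\<^esub> h \<one>\<^bsub>A\<^esub>"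
    using assms(3) by (auto simp: algebra_hom_def)
  then show "h (structure_map A c) = structure_map A' c"
    using assms(3) by (auto simp: algebra_hom_def structure_map_def ring_hom_def)
qed

section \<open>Monoid algebras and their evaluations\<close>

lemma poly_mapping_induct [case_names zero single add]:
  fixes F :: "'m \<Rightarrow>\<^sub>0 'c::comm_monoid_add"
  assumes "P 0" "\<And>m c. P (single m c)" "\<And>F G. P F \<Longrightarrow> P G \<Longrightarrow> P (F + G)"
  shows "P F"
proof (induction F rule: Poly_Mapping.update_induct)
  case const
  show ?case by fact
next
  case (update F m c)
  have "Poly_Mapping.update m c F = F + single m c"
    using update(1) by (intro poly_mapping_eqI)
      (auto simp: lookup_update lookup_add lookup_single in_keys_iff when_def)
  then show ?case using update assms by simp
qed

lemma poly_mapping_expand: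
  fixes F :: "'m \<Rightarrow>\<^sub>0 'c::comm_monoid_add"
  assumes "finite K" "keys F \<subseteq> K"
  shows "F = (\<Sum>m\<in>K. single m (lookup F m))"
proof (rule poly_mapping_eqI)
  fix k
  have "lookup (\<Sum>m\<in>K. single m (lookup F m)) k =
      (\<Sum>m\<in>K. if m = k then lookup F m else 0)"
    by (simp add: lookup_sum lookup_single when_def)
  also have "\<dots> = lookup F k"
    using assms by (auto simp: sum.delta in_keys_iff)
  finally show "lookup F k =
    lookup (\<Sum>m\<in>K. single m (lookup F m)) k" by simp
qed

definition ev :: "('k::field, 'u) module \<Rightarrow> ('m \<Rightarrow> 'u) \<Rightarrow> ('m \<Rightarrow>\<^sub>0 'k) \<Rightarrow> 'u"
  where "ev A \<mu> F = (\<Oplus>\<^bsub>A\<^esub>m\<in>keys F. structure_map A (lookup F m) \<otimes>\<^bsub>A\<^esub> \<mu> m)"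

text \<open>\<open>\<mu>\<close> is a homomorphism from the monoid of exponents to the
  multiplicative monoid of \<open>A\<close>, and \<open>ev A \<mu>\<close> is the induced
  homomorphism from the monoid algebra. The exponents stay general because three kinds occur:
  integer exponents at a point of a torus, natural exponents at the entries of a matrix, and pairs
  of integer exponents at two points.\<close>

locale monomial_evaluation = k_algebra A for A :: "('k::field, 'u) module" (structure) +
  fixes \<mu> :: "'m::comm_monoid_add \<Rightarrow> 'u"
  assumes mu_closed [simp, intro]: "\<mu> m \<in> carrier A"
    and mu_zero [simp]: "\<mu> 0 = \<one>"
    and mu_add: "\<mu> (m + n) = \<mu> m \<otimes> \<mu> n"
begin

lemma ev_superset:
  assumes "finite K" "keys F \<subseteq> K"
  shows "ev A \<mu> F = (\<Oplus>m\<in>K. structure_map A (lookup F m) \<otimes> \<mu> m)"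
  unfolding ev_def using assms
  by (intro add.finprod_mono_neutral_cong_left) (auto simp: in_keys_iff)

lemma ev_closed [simp, intro]: "ev A \<mu> F \<in> carrier A"
  unfolding ev_def by auto

lemma ev_zero [simp]: "ev A \<mu> 0 = \<zero>"
  by (simp add: ev_def)

lemma ev_single [simp]: "ev A \<mu> (single m c) = structure_map A c \<otimes> \<mu> m"
  by (subst ev_superset[of "{m}"]) auto

lemma ev_const: "ev A \<mu> (single 0 c) = structure_map A c"
  by simp

lemma ev_one [simp]: "ev A \<mu> 1 = \<one>"
  using ev_const[of 1] by simp

lemma ev_add [simp]: "ev A \<mu> (F + G) = ev A \<mu> F \<oplus> ev A \<mu> G"
proof -
  let ?K = "keys F \<union> keys G"
  have *: "ev A \<mu> H = (\<Oplus>m\<in>?K. structure_map A (lookup H m) \<otimes> \<mu> m)"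
    if "keys H \<subseteq> ?K" for H
    using that by (intro ev_superset) auto
  have "ev A \<mu> F \<oplus> ev A \<mu> G = (\<Oplus>m\<in>?K. structure_map A (lookup F m) \<otimes> \<mu> m \<oplus>
      structure_map A (lookup G m) \<otimes> \<mu> m)"
    unfolding *[of F, OF Un_upper1] *[of G, OF Un_upper2] by (rule finsum_addf[symmetric]) auto
  also have "\<dots> = ev A \<mu> (F + G)"
    unfolding *[OF Poly_Mapping.keys_add[of F G]]
    by (intro add.finprod_cong') (auto simp: lookup_add sm_add l_distr)
  finally show ?thesis by simp
qed

lemma ev_mult [simp]: "ev A \<mu> (F * G) = ev A \<mu> F \<otimes> ev A \<mu> G"
proof (induction F rule: poly_mapping_induct)
  case (single m c)
  show ?case
    by (induction G rule: poly_mapping_induct)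
      (auto simp: mult_single sm_mult mu_add m_ac distrib_left r_distr)
qed (auto simp: distrib_right l_distr)

lemma ev_uminus [simp]: "ev A \<mu> (- F) = \<ominus> ev A \<mu> F"
  by (rule sum_zero_eq_neg) (auto simp: ev_add[symmetric] simp del: ev_add)

lemma ev_sum: "finite I \<Longrightarrow> ev A \<mu> (\<Sum>i\<in>I. f i) = (\<Oplus>i\<in>I. ev A \<mu> (f i))"
  by (induction I rule: finite_induct) auto

end

lemma algebra_hom_ev:
  assumes "monomial_evaluation A \<mu>" "A' \<in> k_algebras" "h \<in> algebra_hom A A'"
  shows "h (ev A \<mu> F) = ev A' (\<lambda>m. h (\<mu> m)) F"
proof -
  interpret A: monomial_evaluation A \<mu> by fact
  interpret A': k_algebra A' using assms by (simp add: k_algebra_iff)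
  interpret h: ring_hom_cring A A' h
    using algebra_homD(1)[OF A.is_k_algebra assms(2,3)] .
  note h_sm = algebra_homD(2)[OF A.is_k_algebra assms(2,3)]
  interpret E: monomial_evaluation A' "\<lambda>m. h (\<mu> m)"
    by unfold_locales (auto simp: A.mu_add)
  show ?thesis
    by (induction F rule: poly_mapping_induct) (auto simp: h_sm)
qed


section \<open>Matrices and the group scheme GL(V)\<close>

text \<open>Restricted to the carrier because elements of \<open>GL B A\<close> are extensional;
  matrices that agree on \<open>B\<close> then give equal functions.\<close>

definition mact :: "'v set \<Rightarrow> ('k, 'u) module \<Rightarrow> ('v \<times> 'v \<Rightarrow> 'u) \<Rightarrow> ('v \<Rightarrow> 'u) \<Rightarrow> ('v \<Rightarrow> 'u)"
  where "mact B A N = (\<lambda>x\<in>carrier (ext_module A B). \<lambda>b\<in>B. \<Oplus>\<^bsub>A\<^esub>c\<in>B. N (b, c) \<otimes>\<^bsub>A\<^esub> x c)"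

lemma base_change_eq_mact: "base_change B A A' h g = mact B A' (\<lambda>p. h (entry A B g p))"
  by (simp add: base_change_def mact_def)

lemma carrier_ext_module: "carrier (ext_module A B) = B \<rightarrow>\<^sub>E carrier A"
  by (simp add: ext_module_def)

lemma add_ext_module: "x \<oplus>\<^bsub>ext_module A B\<^esub> y = (\<lambda>b\<in>B. x b \<oplus>\<^bsub>A\<^esub> y b)"
  by (simp add: ext_module_def)

lemma smult_ext_module: "a \<odot>\<^bsub>ext_module A B\<^esub> y = (\<lambda>b\<in>B. a \<otimes>\<^bsub>A\<^esub> y b)"
  by (simp add: ext_module_def)

lemma zero_ext_module: "\<zero>\<^bsub>ext_module A B\<^esub> = (\<lambda>b\<in>B. \<zero>\<^bsub>A\<^esub>)"
  by (simp add: ext_module_def)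

lemma ext_moduleI [intro]:
  "(\<And>b. b \<in> B \<Longrightarrow> f b \<in> carrier A) \<Longrightarrow> (\<lambda>b\<in>B. f b) \<in> carrier (ext_module A B)"
  by (auto simp: carrier_ext_module)

lemma ext_module_apply: "x \<in> carrier (ext_module A B) \<Longrightarrow> b \<in> B \<Longrightarrow> x b \<in> carrier A"
  by (auto simp: carrier_ext_module)

lemma ext_module_eqI:
  assumes "x \<in> carrier (ext_module A B)" "y \<in> carrier (ext_module A B)" "\<And>b. b \<in> B \<Longrightarrow> x b = y b"
  shows "x = y"
  using assms unfolding carrier_ext_module by (metis PiE_ext)

locale matrices = k_algebra A for A :: "('k::field, 'u) module" (structure) +
  fixes B :: "'v set"
  assumes finite_B [simp, intro]: "finite B"
begin

abbreviation E where "E \<equiv> ext_module A B"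

lemma ext_apply [simp, intro]: "x \<in> carrier E \<Longrightarrow> b \<in> B \<Longrightarrow> x b \<in> carrier A"
  by (rule ext_module_apply)

definition matrix :: "('v \<times> 'v \<Rightarrow> 'u) \<Rightarrow> bool"
  where "matrix N \<longleftrightarrow> (\<forall>b\<in>B. \<forall>c\<in>B. N (b, c) \<in> carrier A)"

lemma matrixI [intro]: "(\<And>b c. b \<in> B \<Longrightarrow> c \<in> B \<Longrightarrow> N (b, c) \<in> carrier A) \<Longrightarrow> matrix N"
  by (simp add: matrix_def)

lemma matrixD [intro, simp]: "matrix N \<Longrightarrow> b \<in> B \<Longrightarrow> c \<in> B \<Longrightarrow> N (b, c) \<in> carrier A"
  by (simp add: matrix_def)

lemma mact_apply: "x \<in> carrier E \<Longrightarrow> b \<in> B \<Longrightarrow> mact B A N x b = (\<Oplus>c\<in>B. N (b, c) \<otimes> x c)"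
  by (simp add: mact_def)

lemma mact_closed [intro, simp]: "matrix N \<Longrightarrow> x \<in> carrier E \<Longrightarrow> mact B A N x \<in> carrier E"
  unfolding mact_def by (auto intro!: finsum_closed)

lemma mact_cong: "(\<And>b c. b \<in> B \<Longrightarrow> c \<in> B \<Longrightarrow> N (b, c) = N' (b, c)) \<Longrightarrow> matrix N' \<Longrightarrow> mact B A N = mact B A N'"
  unfolding mact_def by (intro restrict_ext add.finprod_cong') auto

lemma unit_vec_closed [simp, intro]: "unit_vec A B c \<in> carrier E"
  by (auto simp: unit_vec_def)

lemma mact_unit_vec: "matrix N \<Longrightarrow> b \<in> B \<Longrightarrow> c \<in> B \<Longrightarrow> mact B A N (unit_vec A B c) b = N (b, c)"
proof -
  assume *: "matrix N" "b \<in> B" "c \<in> B"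
  have "mact B A N (unit_vec A B c) b = (\<Oplus>d\<in>B. if d = c then N (b, d) else \<zero>)"
    using * by (subst mact_apply) (auto simp: unit_vec_def intro!: add.finprod_cong')
  also have "\<dots> = N (b, c)"
    using * by (intro finsum_delta) auto
  finally show ?thesis .
qed

lemma entry_mact: "matrix N \<Longrightarrow> b \<in> B \<Longrightarrow> c \<in> B \<Longrightarrow> entry A B (mact B A N) (b, c) = N (b, c)"
  by (simp add: entry_def mact_unit_vec)

lemma matrix_mult [intro]: "matrix N \<Longrightarrow> matrix N' \<Longrightarrow> matrix (\<lambda>(b, c). \<Oplus>d\<in>B. N (b, d) \<otimes> N' (d, c))"
  by (auto intro!: finsum_closed)

lemma mact_compose:
  assumes N: "matrix N" "matrix N'" and x: "x \<in> carrier E"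
  shows "mact B A N (mact B A N' x) = mact B A (\<lambda>(b, c). \<Oplus>d\<in>B. N (b, d) \<otimes> N' (d, c)) x"
proof (rule ext_module_eqI)
  fix b assume b: "b \<in> B"
  have "mact B A N (mact B A N' x) b = (\<Oplus>d\<in>B. N (b, d) \<otimes> (\<Oplus>c\<in>B. N' (d, c) \<otimes> x c))"
    using assms b by (subst mact_apply) (auto simp: mact_apply intro!: add.finprod_cong')
  also have "\<dots> = (\<Oplus>d\<in>B. \<Oplus>c\<in>B. N (b, d) \<otimes> N' (d, c) \<otimes> x c)"
    using b assms
    by (intro add.finprod_cong') (auto simp: finsum_rdistr m_assoc intro!: add.finprod_cong' finsum_closed)
  also have "\<dots> = (\<Oplus>c\<in>B. \<Oplus>d\<in>B. N (b, d) \<otimes> N' (d, c) \<otimes> x c)"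
    using b assms by (intro finsum_swap) auto
  also have "\<dots> = (\<Oplus>c\<in>B. (\<Oplus>d\<in>B. N (b, d) \<otimes> N' (d, c)) \<otimes> x c)"
    using b assms by (intro add.finprod_cong') (auto simp: finsum_ldistr intro!: finsum_closed)
  finally show "mact B A N (mact B A N' x) b = mact B A (\<lambda>(b, c). \<Oplus>d\<in>B. N (b, d) \<otimes> N' (d, c)) x b"
    using b assms by (subst mact_apply) auto
qed (use assms matrix_mult[OF N] in auto)

lemma mact_id:
  assumes N: "\<And>b c. b \<in> B \<Longrightarrow> c \<in> B \<Longrightarrow> N (b, c) = (if b = c then \<one> else \<zero>)" and x: "x \<in> carrier E"
  shows "mact B A N x = x"
proof (rule ext_module_eqI)
  have "matrix N" using N by auto
  then show "mact B A N x \<in> carrier E" using x by auto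
  fix b assume b: "b \<in> B"
  have "mact B A N x b = (\<Oplus>c\<in>B. if c = b then x c else \<zero>)"
    using assms b by (subst mact_apply) (auto intro!: add.finprod_cong')
  also have "\<dots> = x b"
    using assms b by (intro finsum_delta) auto
  finally show "mact B A N x b = x b" .
qed fact

lemma add_closed_E [simp, intro]: "x \<in> carrier E \<Longrightarrow> y \<in> carrier E \<Longrightarrow> x \<oplus>\<^bsub>E\<^esub> y \<in> carrier E"
  by (auto simp: add_ext_module)

lemma smult_closed_E [simp, intro]: "a \<in> carrier A \<Longrightarrow> y \<in> carrier E \<Longrightarrow> a \<odot>\<^bsub>E\<^esub> y \<in> carrier E"
  by (auto simp: smult_ext_module)

lemma add_E_apply [simp]: "b \<in> B \<Longrightarrow> (x \<oplus>\<^bsub>E\<^esub> y) b = x b \<oplus> y b"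
  by (simp add: add_ext_module)

lemma smult_E_apply [simp]: "b \<in> B \<Longrightarrow> (a \<odot>\<^bsub>E\<^esub> y) b = a \<otimes> y b"
  by (simp add: smult_ext_module)

lemma mact_add:
  assumes "matrix N" "x \<in> carrier E" "y \<in> carrier E"
  shows "mact B A N (x \<oplus>\<^bsub>E\<^esub> y) = mact B A N x \<oplus>\<^bsub>E\<^esub> mact B A N y"
proof (rule ext_module_eqI)
  fix b assume b: "b \<in> B"
  have "mact B A N (x \<oplus>\<^bsub>E\<^esub> y) b = (\<Oplus>c\<in>B. N (b, c) \<otimes> x c \<oplus> N (b, c) \<otimes> y c)"
    unfolding mact_apply[OF add_closed_E[OF assms(2,3)] b]
    by (rule add.finprod_cong'[OF refl]) (use assms b in \<open>auto simp: r_distr\<close>)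
  also have "\<dots> = (\<Oplus>c\<in>B. N (b, c) \<otimes> x c) \<oplus> (\<Oplus>c\<in>B. N (b, c) \<otimes> y c)"
    using assms b by (intro finsum_addf) auto
  finally show "mact B A N (x \<oplus>\<^bsub>E\<^esub> y) b = (mact B A N x \<oplus>\<^bsub>E\<^esub> mact B A N y) b"
    using b assms(2,3) by (simp only: add_E_apply mact_apply)
qed (use assms in auto)

lemma mact_smult:
  assumes "matrix N" "a \<in> carrier A" "x \<in> carrier E"
  shows "mact B A N (a \<odot>\<^bsub>E\<^esub> x) = a \<odot>\<^bsub>E\<^esub> mact B A N x"
proof (rule ext_module_eqI)
  fix b assume b: "b \<in> B"
  have "mact B A N (a \<odot>\<^bsub>E\<^esub> x) b = (\<Oplus>c\<in>B. a \<otimes> (N (b, c) \<otimes> x c))"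
    using assms b by (subst mact_apply) (auto simp: m_lcomm intro!: add.finprod_cong')
  also have "\<dots> = a \<otimes> mact B A N x b"
    using assms b by (subst finsum_rdistr[symmetric]) (auto simp: mact_apply)
  finally show "mact B A N (a \<odot>\<^bsub>E\<^esub> x) b = (a \<odot>\<^bsub>E\<^esub> mact B A N x) b"
    using b by simp
qed (use assms in auto)

text \<open>A two-sided inverse matrix takes the place of the determinant. For a diagonal torus it
  is available at once, by negating the weights.\<close>

lemma mact_in_GL:
  assumes N: "matrix N" "matrix N'"
    and "\<And>b c. b \<in> B \<Longrightarrow> c \<in> B \<Longrightarrow> (\<Oplus>d\<in>B. N (b, d) \<otimes> N' (d, c)) = (if b = c then \<one> else \<zero>)"
    and "\<And>b c. b \<in> B \<Longrightarrow> c \<in> B \<Longrightarrow> (\<Oplus>d\<in>B. N' (b, d) \<otimes> N (d, c)) = (if b = c then \<one> else \<zero>)"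
  shows "mact B A N \<in> carrier (GL B A)"
proof -
  have l: "mact B A N (mact B A N' x) = x" and r: "mact B A N' (mact B A N x) = x" if "x \<in> carrier E" for x
    using assms that by (auto simp: mact_compose intro!: mact_id)
  have "bij_betw (mact B A N) (carrier E) (carrier E)"
    using N l r by (intro bij_betw_byWitness[where f' = "mact B A N'"]) auto
  moreover have "mact B A N \<in> extensional (carrier E)"
    unfolding mact_def by (rule restrict_extensional)
  ultimately show ?thesis
    using N by (auto simp: GL_def Bij_def mact_add mact_smult)
qed

lemma GL_carrierD:
  assumes "g \<in> carrier (GL B A)"
  shows "g \<in> Bij (carrier E)"
    and "x \<in> carrier E \<Longrightarrow> y \<in> carrier E \<Longrightarrow> g (x \<oplus>\<^bsub>E\<^esub> y) = g x \<oplus>\<^bsub>E\<^esub> g y"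
    and "a \<in> carrier A \<Longrightarrow> x \<in> carrier E \<Longrightarrow> g (a \<odot>\<^bsub>E\<^esub> x) = a \<odot>\<^bsub>E\<^esub> g x"
    and "x \<in> carrier E \<Longrightarrow> g x \<in> carrier E"
  using assms Bij_imp_funcset[of g "carrier E"] by (auto simp: GL_def)

lemma GL_carrierI:
  assumes "g \<in> Bij (carrier E)"
    and "\<And>x y. x \<in> carrier E \<Longrightarrow> y \<in> carrier E \<Longrightarrow> g (x \<oplus>\<^bsub>E\<^esub> y) = g x \<oplus>\<^bsub>E\<^esub> g y"
    and "\<And>a x. a \<in> carrier A \<Longrightarrow> x \<in> carrier E \<Longrightarrow> g (a \<odot>\<^bsub>E\<^esub> x) = a \<odot>\<^bsub>E\<^esub> g x"
  shows "g \<in> carrier (GL B A)"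
  using assms by (simp add: GL_def)

lemma GL_mult: "g \<in> carrier (GL B A) \<Longrightarrow> h \<in> carrier (GL B A) \<Longrightarrow> g \<otimes>\<^bsub>GL B A\<^esub> h = compose (carrier E) g h"
  by (simp add: GL_def BijGroup_def)

lemma GL_one: "\<one>\<^bsub>GL B A\<^esub> = (\<lambda>x\<in>carrier E. x)"
  by (simp add: GL_def BijGroup_def)

text \<open>The operations are those of the group of bijections of the carrier, so the content is
  that composites and inverses of linear bijections are linear.\<close>

lemma GL_group: "group (GL B A)"
proof -
  interpret BG: group "BijGroup (carrier E)" by (rule group_BijGroup)
  have "subgroup (carrier (GL B A)) (BijGroup (carrier E))"
  proof (rule BG.subgroupI)
    show "carrier (GL B A) \<subseteq> carrier (BijGroup (carrier E))"
      by (auto simp: GL_def BijGroup_def)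
    have "(\<lambda>x\<in>carrier E. x) \<in> carrier (GL B A)"
      by (rule GL_carrierI[OF id_Bij]) simp_all
    then show "carrier (GL B A) \<noteq> {}" by blast
  next
    fix g assume g: "g \<in> carrier (GL B A)"
    have gB: "g \<in> Bij (carrier E)" using g by (rule GL_carrierD)
    let ?i = "inv_into (carrier E) g"
    have *: "inv\<^bsub>BijGroup (carrier E)\<^esub> g = (\<lambda>x\<in>carrier E. ?i x)"
      using gB by (rule inv_BijGroup)
    have r: "g (?i x) = x" if "x \<in> carrier E" for x
      using gB that by (auto simp: Bij_def bij_betw_def f_inv_into_f)
    have l: "?i (g x) = x" if "x \<in> carrier E" for x
      using gB that by (auto simp: Bij_def bij_betw_def inv_into_f_f)
    have m: "?i x \<in> carrier E" if "x \<in> carrier E" for x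
      using gB that by (rule Bij_inv_into_mem)
    have "?i (x \<oplus>\<^bsub>E\<^esub> y) = ?i x \<oplus>\<^bsub>E\<^esub> ?i y" if "x \<in> carrier E" "y \<in> carrier E" for x y
      using l[OF add_closed_E[OF m m], OF that] GL_carrierD(2)[OF g] m r that by simp
    moreover have "?i (a \<odot>\<^bsub>E\<^esub> y) = a \<odot>\<^bsub>E\<^esub> ?i y" if "a \<in> carrier A" "y \<in> carrier E" for a y
      using l[OF smult_closed_E[OF _ m], OF that] GL_carrierD(3)[OF g] m r that by simp
    ultimately show "inv\<^bsub>BijGroup (carrier E)\<^esub> g \<in> carrier (GL B A)"
      unfolding * by (intro GL_carrierI restrict_inv_into_Bij[OF gB]) simp_all
  next
    fix g h assume gh: "g \<in> carrier (GL B A)" "h \<in> carrier (GL B A)"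
    have B: "g \<in> Bij (carrier E)" "h \<in> Bij (carrier E)" using gh by (auto dest: GL_carrierD(1))
    note gl = gh[THEN GL_carrierD(2)] gh[THEN GL_carrierD(3)] gh[THEN GL_carrierD(4)]
    have "compose (carrier E) g h \<in> carrier (GL B A)"
      by (rule GL_carrierI[OF compose_Bij[OF B]]) (simp_all add: compose_def gl)
    then show "g \<otimes>\<^bsub>BijGroup (carrier E)\<^esub> h \<in> carrier (GL B A)"
      using B by (simp add: BijGroup_def)
  qed
  from BG.subgroup_imp_group[OF this] show ?thesis
    by (simp add: GL_def)
qed

lemma entry_closed: "g \<in> carrier (GL B A) \<Longrightarrow> matrix (entry A B g)"
  using GL_carrierD(4)[of g, OF _ unit_vec_closed] by (intro matrixI) (simp add: entry_def)

lemma GL_zero: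
  assumes g: "g \<in> carrier (GL B A)"
  shows "g (\<lambda>b\<in>B. \<zero>) = (\<lambda>b\<in>B. \<zero>)"
proof -
  have z: "(\<lambda>b\<in>B. \<zero>) \<in> carrier E" by auto
  have "(\<lambda>b\<in>B. \<zero>) = \<zero> \<odot>\<^bsub>E\<^esub> (\<lambda>b\<in>B. \<zero>)"
    by (auto simp add: smult_ext_module intro!: restrict_ext)
  then have "g (\<lambda>b\<in>B. \<zero>) = \<zero> \<odot>\<^bsub>E\<^esub> g (\<lambda>b\<in>B. \<zero>)"
    using GL_carrierD(3)[OF g zero_closed z] by metis
  also have "\<dots> = (\<lambda>b\<in>B. \<zero>)"
    unfolding smult_ext_module using GL_carrierD(4)[OF g z] by (auto intro!: restrict_ext)
  finally show ?thesis .
qed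

text \<open>A linear map on a free module is determined by its values on the unit vectors.\<close>

lemma GL_eq_mact:
  assumes g: "g \<in> carrier (GL B A)"
  shows "g = mact B A (entry A B g)"
proof -
  \<comment> \<open>Induction on the support: \<open>x\<close> is cut down to the coordinates in
    \<open>F\<close>, and each new index adds one multiple of a unit vector.\<close>
  have *: "g (\<lambda>b\<in>B. if b \<in> F then x b else \<zero>) = (\<lambda>b\<in>B. \<Oplus>c\<in>F. entry A B g (b, c) \<otimes> x c)"
    if "F \<subseteq> B" and x: "x \<in> carrier E" for F x
  proof -
    have "finite F" using that finite_B finite_subset by blast
    then show ?thesis using that(1)
    proof (induction F rule: finite_induct)
      case empty
      show ?case using GL_zero[OF g] by (simp cong: restrict_cong del: restrict_apply)
    next
      case (insert c F)
      let ?y = "\<lambda>b\<in>B. if b \<in> F then x b else \<zero>"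
      have c: "c \<in> B" "F \<subseteq> B" using insert by auto
      have xc: "x c \<in> carrier A" using c x by auto
      have y: "?y \<in> carrier E" using x by auto
      have u: "x c \<odot>\<^bsub>E\<^esub> unit_vec A B c \<in> carrier E"
        using xc by auto
      have "(\<lambda>b\<in>B. if b \<in> insert c F then x b else \<zero>) = x c \<odot>\<^bsub>E\<^esub> unit_vec A B c \<oplus>\<^bsub>E\<^esub> ?y"
        using insert.hyps x xc by (auto simp: smult_ext_module add_ext_module unit_vec_def intro!: restrict_ext)
      then have "g (\<lambda>b\<in>B. if b \<in> insert c F then x b else \<zero>) = x c \<odot>\<^bsub>E\<^esub> g (unit_vec A B c) \<oplus>\<^bsub>E\<^esub> g ?y"
        using GL_carrierD(2)[OF g u y] GL_carrierD(3)[OF g xc unit_vec_closed] by simp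
      also have "\<dots> = (\<lambda>b\<in>B. \<Oplus>c\<in>insert c F. entry A B g (b, c) \<otimes> x c)"
        unfolding insert.IH[OF c(2)] smult_ext_module add_ext_module
      proof (rule restrict_ext)
        fix b assume b: "b \<in> B"
        have cl: "entry A B g (b, d) \<otimes> x d \<in> carrier A" if "d \<in> B" for d
          using that b entry_closed[OF g] x by auto
        have "(\<Oplus>c\<in>insert c F. entry A B g (b, c) \<otimes> x c) =
            entry A B g (b, c) \<otimes> x c \<oplus> (\<Oplus>c\<in>F. entry A B g (b, c) \<otimes> x c)"
          using insert.hyps c cl by (intro add.finprod_insert) auto
        then show "(\<lambda>b\<in>B. x c \<otimes> g (unit_vec A B c) b) b \<oplus> (\<lambda>b\<in>B. \<Oplus>c\<in>F. entry A B g (b, c) \<otimes> x c) b =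
          (\<Oplus>c\<in>insert c F. entry A B g (b, c) \<otimes> x c)"
          using b xc GL_carrierD(4)[OF g unit_vec_closed] by (simp add: entry_def m_comm)
      qed
      finally show ?case .
    qed
  qed
  show ?thesis
  proof
    fix x
    show "g x = mact B A (entry A B g) x"
    proof (cases "x \<in> carrier E")
      case True
      then have "(\<lambda>b\<in>B. if b \<in> B then x b else \<zero>) = x"
        by (intro ext_module_eqI[of _ A B]) auto
      then show ?thesis using *[OF subset_refl True] True by (simp add: mact_def)
    next
      case False
      then show ?thesis
        using GL_carrierD(1)[OF g] by (simp add: mact_def Bij_def extensional_def)
    qed
  qed
qed

lemma GL_mult_mact:
  assumes "matrix N" "matrix N'" "mact B A N \<in> carrier (GL B A)" "mact B A N' \<in> carrier (GL B A)"
  shows "mact B A N \<otimes>\<^bsub>GL B A\<^esub> mact B A N' = mact B A (\<lambda>(b, c). \<Oplus>d\<in>B. N (b, d) \<otimes> N' (d, c))"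
proof -
  have "compose (carrier E) (mact B A N) (mact B A N') x = mact B A (\<lambda>(b, c). \<Oplus>d\<in>B. N (b, d) \<otimes> N' (d, c)) x" for x
    by (cases "x \<in> carrier E") (simp_all add: compose_def mact_compose[OF assms(1,2)], simp add: mact_def)
  then show ?thesis
    unfolding GL_mult[OF assms(3,4)] by blast
qed

end

section \<open>Complete families of idempotents\<close>

type_synonym 'k laurent = "(nat \<Rightarrow>\<^sub>0 int) \<Rightarrow>\<^sub>0 'k"

text \<open>Each \<open>e l\<close> is a square matrix over \<open>P\<close>; together they are the
  projections of a direct sum decomposition indexed by \<open>L\<close>. Summands may be zero, which
  leaves room to enlarge the index set.\<close>

locale idempotents =
  fixes P :: "'p set" and L :: "'l set" and e :: "'l \<Rightarrow> 'p \<times> 'p \<Rightarrow> 'k::field"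
  assumes finite_P [simp, intro]: "finite P" and finite_L [simp, intro]: "finite L"
    and orthogonal: "\<And>l l' p q. l \<in> L \<Longrightarrow> l' \<in> L \<Longrightarrow> p \<in> P \<Longrightarrow> q \<in> P \<Longrightarrow>
      (\<Sum>r\<in>P. e l (p, r) * e l' (r, q)) = (if l = l' then e l (p, q) else 0)"
    and complete: "\<And>p q. p \<in> P \<Longrightarrow> q \<in> P \<Longrightarrow> (\<Sum>l\<in>L. e l (p, q)) = (if p = q then 1 else 0)"

text \<open>The element of the torus with weights \<open>w\<close> whose coordinates are the indeterminates.\<close>

definition lmat :: "'l set \<Rightarrow> ('l \<Rightarrow> 'm) \<Rightarrow> ('l \<Rightarrow> 'p \<times> 'p \<Rightarrow> 'k::field) \<Rightarrow> 'p \<times> 'p \<Rightarrow> ('m::comm_monoid_add \<Rightarrow>\<^sub>0 'k)"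
  where "lmat L w e p = (\<Sum>l\<in>L. single (w l) (e l p))"

lemma single_sum: "single m (\<Sum>i\<in>I. f i) = (\<Sum>i\<in>I. single m (f i))"
  by (induction I rule: infinite_finite_induct) (auto simp: single_add)

lemma sum_swap4:
  "(\<Sum>b\<in>B. \<Sum>c\<in>C. \<Sum>m\<in>M. \<Sum>n\<in>N. f b c m n) = (\<Sum>m\<in>M. \<Sum>n\<in>N. \<Sum>b\<in>B. \<Sum>c\<in>C. f b c m n)"
proof -
  have "(\<Sum>b\<in>B. \<Sum>c\<in>C. \<Sum>m\<in>M. \<Sum>n\<in>N. f b c m n) = (\<Sum>b\<in>B. \<Sum>m\<in>M. \<Sum>n\<in>N. \<Sum>c\<in>C. f b c m n)"
    by (intro sum.cong refl, subst sum.swap, intro sum.cong refl, rule sum.swap)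
  also have "\<dots> = (\<Sum>m\<in>M. \<Sum>n\<in>N. \<Sum>b\<in>B. \<Sum>c\<in>C. f b c m n)"
    by (subst sum.swap, intro sum.cong refl, rule sum.swap)
  finally show ?thesis .
qed

lemma single_eq_iff: "single m c = single m d \<longleftrightarrow> c = d"
  using inj_single[of m] by (auto simp: inj_def)

context idempotents
begin

text \<open>Orthogonality removes the cross terms, so exponents add within each summand. This is the
  multiplication of the diagonal torus, and \<open>w + w' = 0\<close> yields inverses.\<close>

lemma lmat_mult:
  assumes pq: "p \<in> P" "q \<in> P"
  shows "(\<Sum>r\<in>P. lmat L w e (p, r) * lmat L w' e (r, q)) = lmat L (\<lambda>l. w l + w' l) e (p, q)"
proof -
  have "(\<Sum>r\<in>P. lmat L w e (p, r) * lmat L w' e (r, q)) =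
    (\<Sum>r\<in>P. \<Sum>l\<in>L. \<Sum>l'\<in>L. single (w l + w' l') (e l (p, r) * e l' (r, q)))"
    by (simp add: lmat_def sum_product mult_single)
  also have "\<dots> = (\<Sum>l\<in>L. \<Sum>l'\<in>L. \<Sum>r\<in>P. single (w l + w' l') (e l (p, r) * e l' (r, q)))"
    by (subst sum.swap) (auto intro!: sum.cong sum.swap)
  also have "\<dots> = (\<Sum>l\<in>L. \<Sum>l'\<in>L. if l' = l then single (w l + w' l') (e l (p, q)) else 0)"
    using pq by (intro sum.cong refl) (auto simp: single_sum[symmetric] orthogonal)
  also have "\<dots> = lmat L (\<lambda>l. w l + w' l) e (p, q)"
    by (auto simp: lmat_def intro!: sum.cong)
  finally show ?thesis .
qed

lemma lmat_one:
  assumes "p \<in> P" "q \<in> P" "\<And>l. l \<in> L \<Longrightarrow> w l = 0"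
  shows "lmat L w e (p, q) = (if p = q then 1 else 0)"
  using assms by (simp add: lmat_def single_sum[symmetric] complete)

text \<open>A family fixed by the generic element with weights \<open>w\<close> has components only
  in summands of weight zero, and any weights \<open>w'\<close> that vanish there act trivially on
  those components.\<close>

lemma lmat_fix:
  assumes fixed: "\<And>p. p \<in> P \<Longrightarrow>
      (\<Sum>q\<in>P. lmat L w e (p, q) * single 0 (\<tau> q)) = single 0 (\<tau> p)"
    and w: "\<And>l. l \<in> L \<Longrightarrow> w l = 0 \<Longrightarrow> w' l = 0" and p: "p \<in> P"
  shows "(\<Sum>q\<in>P. lmat L w' e (p, q) * single 0 (\<tau> q)) = single 0 (\<tau> p)"
proof -
  define C where "C l p = (\<Sum>q\<in>P. e l (p, q) * \<tau> q)" for l p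
  have *: "(\<Sum>q\<in>P. lmat L v e (p, q) * single 0 (\<tau> q)) = (\<Sum>l\<in>L. single (v l) (C l p))"
    for v :: "_ \<Rightarrow> 'n::comm_monoid_add" and p
    unfolding lmat_def C_def
    by (simp add: sum_distrib_right mult_single single_sum) (rule sum.swap)
  \<comment> \<open>Applying \<open>e l\<close> to the fixed-point identity gives the component with
    exponent 0 on one side and, by orthogonality, with exponent \<open>w l\<close> on the other. The
    coefficient of exponent 0 then forces the component to vanish.\<close>
  have C0: "C l p = 0" if l: "l \<in> L" "w l \<noteq> 0" and p: "p \<in> P" for l p
  proof -
    have "single 0 (C l p) = (\<Sum>q\<in>P. single 0 (e l (p, q)) * single 0 (\<tau> q))"
      by (simp add: C_def single_sum mult_single)
    also have "\<dots> = (\<Sum>q\<in>P. single 0 (e l (p, q)) * (\<Sum>l'\<in>L. single (w l') (C l' q)))"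
      by (intro sum.cong refl) (simp add: fixed *[symmetric])
    also have "\<dots> = (\<Sum>l'\<in>L. single (w l') (\<Sum>q\<in>P. e l (p, q) * C l' q))"
      by (simp add: sum_distrib_left mult_single single_sum) (rule sum.swap)
    also have "\<dots> = (\<Sum>l'\<in>L. if l' = l then single (w l) (C l p) else 0)"
    proof (intro sum.cong refl)
      fix l' assume l': "l' \<in> L"
      have "(\<Sum>q\<in>P. e l (p, q) * C l' q) = (\<Sum>q\<in>P. \<Sum>r\<in>P. e l (p, q) * e l' (q, r) * \<tau> r)"
        by (simp add: C_def sum_distrib_left mult.assoc)
      also have "\<dots> = (\<Sum>r\<in>P. (\<Sum>q\<in>P. e l (p, q) * e l' (q, r)) * \<tau> r)"
        by (subst sum.swap) (simp add: sum_distrib_right)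
      also have "\<dots> = (if l' = l then C l p else 0)"
        using l l' p by (auto simp: orthogonal C_def)
      finally show "single (w l') (\<Sum>q\<in>P. e l (p, q) * C l' q) =
          (if l' = l then single (w l) (C l p) else 0)" by simp
    qed
    also have "\<dots> = single (w l) (C l p)"
      using l by simp
    finally have "single 0 (C l p) = single (w l) (C l p)" .
    from arg_cong[OF this, of "\<lambda>F. lookup F 0"] show ?thesis
      by (simp only: lookup_single_eq lookup_single_not_eq[OF l(2)])
  qed
  have "(\<Sum>l\<in>L. single (w' l) (C l p)) = (\<Sum>l\<in>L. single 0 (C l p))"
  proof (intro sum.cong refl)
    fix l assume "l \<in> L"
    then show "single (w' l) (C l p) = single 0 (C l p)"
      using w C0 p by (cases "w l = 0") auto
  qed
  also have "\<dots> = single 0 (\<Sum>q\<in>P. (\<Sum>l\<in>L. e l (p, q)) * \<tau> q)"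
    unfolding single_sum[symmetric] C_def
    by (subst sum.swap) (simp add: sum_distrib_right)
  also have "\<dots> = single 0 (\<tau> p)"
    using p by (simp add: complete if_distrib[of "\<lambda>x. x * _"] sum.delta' cong: if_cong)
  finally show ?thesis unfolding * .
qed

end

text \<open>Kronecker products of the two families: the projections of the tensor product onto its
  summands. The weight of a summand is the sum of the two weights.\<close>

definition tensor_family :: "('l \<Rightarrow> 'p \<times> 'p \<Rightarrow> 'k) \<Rightarrow> ('n \<Rightarrow> 'q \<times> 'q \<Rightarrow> 'k) \<Rightarrow> 'l \<times> 'n \<Rightarrow> ('p \<times> 'q) \<times> ('p \<times> 'q) \<Rightarrow> 'k::field"
  where "tensor_family e f l p = e (fst l) (fst (fst p), fst (snd p)) * f (snd l) (snd (fst p), snd (snd p))"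

lemma idempotents_tensor:
  assumes "idempotents P L e" "idempotents Q N f"
  shows "idempotents (P \<times> Q) (L \<times> N) (tensor_family e f)"
proof -
  interpret e: idempotents P L e by fact
  interpret f: idempotents Q N f by fact
  show ?thesis
  proof
    fix l l' p q assume "l \<in> L \<times> N" "l' \<in> L \<times> N" "p \<in> P \<times> Q" "q \<in> P \<times> Q"
    then have l: "fst l \<in> L" "fst l' \<in> L" "fst p \<in> P" "fst q \<in> P"
        "snd l \<in> N" "snd l' \<in> N" "snd p \<in> Q" "snd q \<in> Q" by auto
    have "(\<Sum>r\<in>P \<times> Q. tensor_family e f l (p, r) * tensor_family e f l' (r, q)) =
        (\<Sum>a\<in>P. e (fst l) (fst p, a) * e (fst l') (a, fst q)) * (\<Sum>b\<in>Q. f (snd l) (snd p, b) * f (snd l') (b, snd q))"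
      unfolding sum_product by (simp add: sum.cartesian_product' tensor_family_def mult_ac)
    also have "\<dots> = (if l = l' then tensor_family e f l (p, q) else 0)"
      using e.orthogonal[OF l(1-4)] f.orthogonal[OF l(5-8)] by (auto simp: tensor_family_def prod_eq_iff)
    finally show "(\<Sum>r\<in>P \<times> Q. tensor_family e f l (p, r) * tensor_family e f l' (r, q)) =
       (if l = l' then tensor_family e f l (p, q) else 0)" .
  next
    fix p q assume "p \<in> P \<times> Q" "q \<in> P \<times> Q"
    moreover have "(\<Sum>l\<in>L \<times> N. tensor_family e f l (p, q)) =
        (\<Sum>l\<in>L. e l (fst p, fst q)) * (\<Sum>n\<in>N. f n (snd p, snd q))"
      unfolding sum_product by (simp add: sum.cartesian_product' tensor_family_def)
    ultimately show "(\<Sum>l\<in>L \<times> N. tensor_family e f l (p, q)) = (if p = q then 1 else 0)"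
      using e.complete[of "fst p" "fst q"] f.complete[of "snd p" "snd q"] by (auto simp: prod_eq_iff)
  qed auto
qed

lemma lmat_tensor:
  "lmat (L \<times> N) (\<lambda>l. w (fst l) + w' (snd l)) (tensor_family e f) (p, q) =
    lmat L w e (fst p, fst q) * lmat N w' f (snd p, snd q)"
  by (simp add: lmat_def tensor_family_def sum.cartesian_product' sum_product mult_single case_prod_unfold)

text \<open>The contragredient action is the transposed inverse, so the transpose of the projection
  for weight \<open>- m\<close> projects the dual onto weight \<open>m\<close>. With this sign one
  index set serves both spaces, provided that it is symmetric.\<close>

definition dual_family :: "('m::group_add \<Rightarrow> 'p \<times> 'p \<Rightarrow> 'k) \<Rightarrow> 'm \<Rightarrow> 'p \<times> 'p \<Rightarrow> 'k::field"
  where "dual_family e m p = e (- m) (snd p, fst p)"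

lemma bij_betw_uminus:
  fixes S :: "'m::group_add set"
  assumes "\<And>m. m \<in> S \<Longrightarrow> - m \<in> S"
  shows "bij_betw uminus S S"
  by (rule bij_betw_byWitness[where f' = uminus]) (use assms in auto)

lemma idempotents_dual:
  fixes S :: "'m::group_add set"
  assumes "idempotents P S e" and sym: "\<And>m. m \<in> S \<Longrightarrow> - m \<in> S"
  shows "idempotents P S (dual_family e)"
proof -
  interpret e: idempotents P S e by fact
  show ?thesis
  proof
    fix l l' p q assume "l \<in> S" "l' \<in> S" "p \<in> P" "q \<in> P"
    then show "(\<Sum>r\<in>P. dual_family e l (p, r) * dual_family e l' (r, q)) =
       (if l = l' then dual_family e l (p, q) else 0)"
      using e.orthogonal[of "- l'" "- l" q p] sym by (auto simp: dual_family_def mult.commute)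
  next
    fix p q assume pq: "p \<in> P" "q \<in> P"
    have "(\<Sum>l\<in>S. dual_family e l (p, q)) = (\<Sum>l\<in>S. e l (q, p))"
      unfolding dual_family_def fst_conv snd_conv
      by (rule sum.reindex_bij_betw[OF bij_betw_uminus[OF sym]])
    then show "(\<Sum>l\<in>S. dual_family e l (p, q)) = (if p = q then 1 else 0)"
      using e.complete pq by auto
  qed auto
qed

lemma lmat_dual:
  fixes S :: "'m::group_add set" and w :: "'m \<Rightarrow> 'n::ab_group_add"
  assumes sym: "\<And>m. m \<in> S \<Longrightarrow> - m \<in> S" and w: "\<And>m. m \<in> S \<Longrightarrow> w (- m) = - w m"
  shows "lmat S w (dual_family e) (p, q) = lmat S (\<lambda>m. - w m) e (q, p)"
proof -
  have "lmat S w (dual_family e) (p, q) = (\<Sum>m\<in>S. single (- w (- m)) (e (- m) (q, p)))"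
    unfolding lmat_def dual_family_def using w by (intro sum.cong) auto
  also have "\<dots> = lmat S (\<lambda>m. - w m) e (q, p)"
    unfolding lmat_def by (rule sum.reindex_bij_betw[OF bij_betw_uminus[OF sym]])
  finally show ?thesis .
qed


section \<open>Quadratic forms on coordinate spaces\<close>

definition polar :: "(('v \<Rightarrow> 'k) \<Rightarrow> 'k) \<Rightarrow> ('v \<Rightarrow> 'k) \<Rightarrow> ('v \<Rightarrow> 'k) \<Rightarrow> 'k::field"
  where "polar q x y = q (\<lambda>b. x b + y b) - q x - q y"

text \<open>Arguments are arbitrary functions of which only the values on \<open>B\<close> count.
  This avoids restrictions in sums of vectors, and one theory serves both \<open>V\<close> and its
  dual.\<close>

locale coordinate_quadratic_form =
  fixes B :: "'v set" and q :: "('v \<Rightarrow> 'k::field) \<Rightarrow> 'k"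
  assumes cong: "\<And>x y. (\<And>b. b \<in> B \<Longrightarrow> x b = y b) \<Longrightarrow> q x = q y"
    and scale: "\<And>c x. q (\<lambda>b. c * x b) = c * c * q x"
    and polar_add: "\<And>x x' y. polar q (\<lambda>b. x b + x' b) y = polar q x y + polar q x' y"
    and polar_scale: "\<And>c x y. polar q (\<lambda>b. c * x b) y = c * polar q x y"
begin

lemma polar_commute: "polar q x y = polar q y x"
  by (simp add: polar_def add.commute)

lemma polar_cong:
  "(\<And>b. b \<in> B \<Longrightarrow> x b = x' b) \<Longrightarrow> (\<And>b. b \<in> B \<Longrightarrow> y b = y' b) \<Longrightarrow> polar q x y = polar q x' y'"
  unfolding polar_def by (intro arg_cong2[of _ _ _ _ "(-)"] cong) auto

lemma polar_zero: "polar q (\<lambda>b. 0) y = 0"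
  using polar_scale[of 0 "\<lambda>b. 0" y] by simp

lemma zero: "q (\<lambda>b. 0) = 0"
  using scale[of 0 "\<lambda>b. 0"] by simp

lemma polar_sum: "polar q (\<lambda>b. \<Sum>i\<in>I. x i b) y = (\<Sum>i\<in>I. polar q (x i) y)"
  by (induction I rule: infinite_finite_induct) (auto simp: polar_zero polar_add)

lemma polar_sum2: "polar q (\<lambda>b. \<Sum>i\<in>I. x i b) (\<lambda>b. \<Sum>j\<in>J. y j b) = (\<Sum>i\<in>I. \<Sum>j\<in>J. polar q (x i) (y j))"
  unfolding polar_sum by (subst polar_commute) (simp add: polar_sum polar_commute)

lemma eq_zero_of_sum:
  assumes "\<And>i. i \<in> I \<Longrightarrow> q (x i) = 0" "\<And>x y. polar q x y = 0"
  shows "q (\<lambda>b. \<Sum>i\<in>I. x i b) = 0"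
  using assms(1)
proof (induction I rule: infinite_finite_induct)
  case (insert i I)
  then show ?case
    using assms(2)[of "x i" "\<lambda>b. \<Sum>i\<in>I. x i b"] by (simp add: polar_def)
qed (auto simp: zero)

end

definition bil :: "'v set \<Rightarrow> ('v \<times> 'v \<Rightarrow> 'k::field) \<Rightarrow> ('v \<Rightarrow> 'k) \<Rightarrow> ('v \<Rightarrow> 'k) \<Rightarrow> 'k"
  where "bil B G x y = (\<Sum>b\<in>B. \<Sum>c\<in>B. G (b, c) * x b * y c)"

lemma bil_add: "bil B G (\<lambda>b. x b + x' b) y = bil B G x y + bil B G x' y"
    "bil B G x (\<lambda>b. y b + y' b) = bil B G x y + bil B G x y'"
  by (simp_all add: bil_def algebra_simps sum.distrib)

lemma bil_scale: "bil B G (\<lambda>b. c * x b) y = c * bil B G x y"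
    "bil B G x (\<lambda>b. c * y b) = c * bil B G x y"
  by (simp_all add: bil_def sum_distrib_left mult_ac)

lemma bil_cong:
  "(\<And>b. b \<in> B \<Longrightarrow> x b = x' b) \<Longrightarrow> (\<And>b. b \<in> B \<Longrightarrow> y b = y' b) \<Longrightarrow> bil B G x y = bil B G x' y'"
  unfolding bil_def by (intro sum.cong refl) simp

lemma bil_zero [simp]: "bil B G (\<lambda>b. 0) y = 0" "bil B G x (\<lambda>b. 0) = 0"
  by (simp_all add: bil_def)

lemma bil_sum:
  shows "bil B G (\<lambda>b. \<Sum>i\<in>I. f i b) y = (\<Sum>i\<in>I. bil B G (f i) y)"
    and "bil B G x (\<lambda>b. \<Sum>i\<in>I. f i b) = (\<Sum>i\<in>I. bil B G x (f i))"
  by (induction I rule: infinite_finite_induct) (simp_all add: bil_add)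

lemma bil_delta:
  assumes "finite B" "p \<in> B" "q \<in> B"
  shows "bil B G (\<lambda>b. if b = p then 1 else 0) (\<lambda>b. if b = q then 1 else 0) = G (p, q)"
  using assms by (simp add: bil_def if_distrib[of "\<lambda>x. _ * x"] sum.delta cong: if_cong)

text \<open>Subtracting a Gram form turns the search for \<open>q x = bil B G x x\<close> into the
  proof that some quadratic form is zero.\<close>

lemma (in coordinate_quadratic_form) diff_bil:
  "coordinate_quadratic_form B (\<lambda>x. q x - bil B G x x)"
  and polar_diff_bil: "polar (\<lambda>x. q x - bil B G x x) x y = polar q x y - bil B G x y - bil B G y x"
proof -
  have *: "polar (\<lambda>x. q x - bil B G x x) x y = polar q x y - bil B G x y - bil B G y x" for x y
    by (simp add: polar_def bil_add)
  show "coordinate_quadratic_form B (\<lambda>x. q x - bil B G x x)"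
  proof
    fix x y :: "'v \<Rightarrow> 'k" assume "\<And>b. b \<in> B \<Longrightarrow> x b = y b"
    then show "q x - bil B G x x = q y - bil B G y y"
      using cong[of x y] bil_cong[of B x y x y G] by simp
  qed (simp_all add: * polar_add polar_scale scale bil_add bil_scale algebra_simps)
  show "polar (\<lambda>x. q x - bil B G x x) x y = polar q x y - bil B G x y - bil B G y x" by (fact *)
qed

text \<open>A triangular Gram matrix has the values of \<open>q\<close> on the diagonal and polar
  values on one side of it. There is no division by 2, so every characteristic is covered.\<close>

lemma (in coordinate_quadratic_form) ex_bilinear:
  assumes "finite B"
  shows "\<exists>G. \<forall>x. q x = bil B G x x"
proof -
  \<comment> \<open>\<open>f\<close> orders the basis, which decides on which side of the diagonal a
    polar value is placed.\<close>
  obtain f :: "'v \<Rightarrow> nat" where f: "inj_on f B"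
    using assms finite_imp_inj_to_nat_seg by metis
  define \<delta> :: "'v \<Rightarrow> 'v \<Rightarrow> 'k" where "\<delta> p b = (if b = p then 1 else 0)" for p b
  define G where "G = (\<lambda>(b, c). if b = c then q (\<delta> b) else if f b < f c then polar q (\<delta> b) (\<delta> c) else 0)"
  interpret d: coordinate_quadratic_form B "\<lambda>x. q x - bil B G x x" by (rule diff_bil)
  have expand: "x b = (\<Sum>c\<in>B. x c * \<delta> c b)" if "b \<in> B" for x b
    using that assms by (simp add: \<delta>_def if_distrib[of "\<lambda>x. _ * x"] sum.delta' cong: if_cong)
  have dd: "bil B G (\<delta> b) (\<delta> c) = G (b, c)" if "b \<in> B" "c \<in> B" for b c
    using bil_delta[OF assms that, of G] by (simp add: \<delta>_def[abs_def])
  \<comment> \<open>Off the diagonal one of \<open>G (b, c)\<close> and \<open>G (c, b)\<close> is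
    the polar value and the other is 0; on the diagonal the polar form takes the value
    \<open>2 * q (\<delta> c)\<close>, which is the diagonal entry counted twice.\<close>
  have P: "polar (\<lambda>x. q x - bil B G x x) (\<delta> b) (\<delta> c) = 0" if "b \<in> B" "c \<in> B" for b c
  proof (cases "b = c")
    case True
    have "polar q (\<delta> c) (\<delta> c) = 2 * q (\<delta> c)"
      using scale[of 2 "\<delta> c"] by (simp add: polar_def)
    then show ?thesis unfolding polar_diff_bil using that True by (simp add: dd) (simp add: G_def)
  next
    case False
    then have "f b < f c \<or> f c < f b" using f that by (metis inj_on_contraD nat_neq_iff)
    then show ?thesis unfolding polar_diff_bil using that False
      by (auto simp add: dd) (auto simp: G_def polar_commute)
  qed
  have P: "polar (\<lambda>x. q x - bil B G x x) x y = 0" for x y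
  proof -
    have "polar (\<lambda>x. q x - bil B G x x) x y =
        polar (\<lambda>x. q x - bil B G x x) (\<lambda>b. \<Sum>c\<in>B. x c * \<delta> c b) (\<lambda>b. \<Sum>c\<in>B. y c * \<delta> c b)"
      by (rule d.polar_cong) (auto intro: expand)
    also have "\<dots> = (\<Sum>b\<in>B. \<Sum>c\<in>B. x b * (y c * polar (\<lambda>x. q x - bil B G x x) (\<delta> b) (\<delta> c)))"
      unfolding d.polar_sum2 d.polar_scale
      by (intro sum.cong refl arg_cong2[of _ _ _ _ "(*)"]) (subst d.polar_commute, subst d.polar_scale, subst d.polar_commute, simp)
    finally show ?thesis by (simp add: P)
  qed
  \<comment> \<open>A quadratic form with zero polar form is additive, and the difference vanishes
    on the basis by the choice of the diagonal of \<open>G\<close>.\<close>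
  have "q x = bil B G x x" for x
  proof -
    have "q x - bil B G x x = (\<lambda>x. q x - bil B G x x) (\<lambda>b. \<Sum>c\<in>B. x c * \<delta> c b)"
      by (rule d.cong) (auto intro: expand)
    also have "\<dots> = 0"
      by (rule d.eq_zero_of_sum) (auto simp: P d.scale dd, simp add: G_def)
    finally show ?thesis by simp
  qed
  then show ?thesis by blast
qed

section \<open>Weight decompositions and bilinear forms adapted to them\<close>

locale symmetric_idempotents = idempotents B S e
  for B :: "'v set" and S :: "'m::ab_group_add set" and e :: "'m \<Rightarrow> 'v \<times> 'v \<Rightarrow> 'k::field" +
  assumes sym: "\<And>m. m \<in> S \<Longrightarrow> - m \<in> S"
begin

definition proj :: "'m \<Rightarrow> ('v \<Rightarrow> 'k) \<Rightarrow> 'v \<Rightarrow> 'k"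
  where "proj m x b = (\<Sum>c\<in>B. e m (b, c) * x c)"

lemma proj_proj:
  assumes "m \<in> S" "n \<in> S" "b \<in> B"
  shows "proj m (proj n x) b = (if m = n then proj m x b else 0)"
proof -
  have "proj m (proj n x) b = (\<Sum>c\<in>B. \<Sum>d\<in>B. e m (b, c) * e n (c, d) * x d)"
    by (simp add: proj_def sum_distrib_left mult.assoc)
  also have "\<dots> = (\<Sum>d\<in>B. (\<Sum>c\<in>B. e m (b, c) * e n (c, d)) * x d)"
    by (subst sum.swap) (simp add: sum_distrib_right)
  also have "\<dots> = (if m = n then proj m x b else 0)"
    using assms by (auto simp: orthogonal proj_def)
  finally show ?thesis .
qed

lemma sum_proj: "b \<in> B \<Longrightarrow> (\<Sum>m\<in>S. proj m x b) = x b"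
  unfolding proj_def
  by (subst sum.swap) (simp add: sum_distrib_right[symmetric] complete if_distrib[of "\<lambda>x. x * _"] sum.delta' cong: if_cong)

lemma lmat_proj:
  "(\<Sum>c\<in>B. lmat S v e (b, c) * single 0 (z c)) = (\<Sum>n\<in>S. single (v n) (proj n z b))"
proof -
  have "(\<Sum>c\<in>B. lmat S v e (b, c) * single 0 (z c)) =
      (\<Sum>c\<in>B. \<Sum>n\<in>S. single (v n) (e n (b, c) * z c))"
    by (simp add: lmat_def sum_distrib_right mult_single)
  also have "\<dots> = (\<Sum>n\<in>S. single (v n) (proj n z b))"
    by (subst sum.swap) (simp add: proj_def single_sum)
  finally show ?thesis .
qed

text \<open>From an arbitrary Gram matrix \<open>G0\<close> only the blocks that pair weight
  \<open>m\<close> with weight \<open>- m\<close> are kept. The hypotheses say that the discarded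
  blocks contribute nothing to \<open>q\<close>, so the quadratic form does not change.\<close>

lemma adapted_bilinear_form:
  assumes "coordinate_quadratic_form B q"
    and q0: "\<And>m x. m \<in> S \<Longrightarrow> m \<noteq> 0 \<Longrightarrow> q (proj m x) = 0"
    and p0: "\<And>m n x y. m \<in> S \<Longrightarrow> n \<in> S \<Longrightarrow> m + n \<noteq> 0 \<Longrightarrow> polar q (proj m x) (proj n y) = 0"
  obtains G where "\<And>x. q x = bil B G x x"
    "\<And>m n x y. m \<in> S \<Longrightarrow> n \<in> S \<Longrightarrow> m + n \<noteq> 0 \<Longrightarrow> bil B G (proj m x) (proj n y) = 0"
proof -
  interpret q: coordinate_quadratic_form B q by fact
  obtain G0 where G0: "\<And>x. q x = bil B G0 x x"
    using q.ex_bilinear[OF finite_P] by blast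
  \<comment> \<open>In matrix terms, the sum over \<open>m\<close> of the transpose of
    \<open>e m\<close> times \<open>G0\<close> times \<open>e (- m)\<close>.\<close>
  define G where "G = (\<lambda>(b, c). \<Sum>m\<in>S. bil B G0 (\<lambda>b'. e m (b', b)) (\<lambda>c'. e (- m) (c', c)))"
  have G: "bil B G x y = (\<Sum>m\<in>S. bil B G0 (proj m x) (proj (- m) y))" for x y
  proof -
    have "bil B G0 (proj m x) (proj (- m) y) =
        (\<Sum>b\<in>B. \<Sum>c\<in>B. bil B G0 (\<lambda>b'. e m (b', b)) (\<lambda>c'. e (- m) (c', c)) * x b * y c)" for m
      unfolding proj_def[abs_def] bil_sum
      by (simp add: mult.commute[of "e _ _"] bil_scale sum_distrib_left mult_ac)
    then show ?thesis
      unfolding bil_def[of B G]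
      by (simp add: G_def sum_distrib_right) (subst sum.swap, intro sum.cong refl, rule sum.swap)
  qed
  have G_van: "bil B G (proj m x) (proj n y) = (if n = - m then bil B G0 (proj m x) (proj n y) else 0)"
    if "m \<in> S" "n \<in> S" for m n x y
  proof -
    have "bil B G (proj m x) (proj n y) = (\<Sum>l\<in>S. if l = m then
        (if n = - m then bil B G0 (proj m x) (proj n y) else 0) else 0)"
      unfolding G
    proof (intro sum.cong refl)
      fix l assume l: "l \<in> S"
      have "bil B G0 (proj l (proj m x)) (proj (- l) (proj n y)) =
        bil B G0 (\<lambda>b. if l = m then proj l x b else 0) (\<lambda>b. if - l = n then proj n y b else 0)"
        using l that sym by (intro bil_cong) (auto simp: proj_proj)
      then show "bil B G0 (proj l (proj m x)) (proj (- l) (proj n y)) = (if l = m then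
        (if n = - m then bil B G0 (proj m x) (proj n y) else 0) else 0)"
        by (auto simp: bil_def)
    qed
    then show ?thesis using that by simp
  qed
  interpret d: coordinate_quadratic_form B "\<lambda>x. q x - bil B G x x" by (rule q.diff_bil)
  have reidx: "(\<Sum>m\<in>S. f (- m)) = (\<Sum>m\<in>S. f m)" for f :: "'m \<Rightarrow> 'k"
    by (rule sum.reindex_bij_betw[OF bij_betw_uminus[OF sym]])
  have polar0: "polar (\<lambda>x. q x - bil B G x x) x y = 0" for x y
  proof -
    have "polar q x y = polar q (\<lambda>b. \<Sum>m\<in>S. proj m x b) (\<lambda>b. \<Sum>m\<in>S. proj m y b)"
      by (rule q.polar_cong) (simp_all add: sum_proj)
    also have "\<dots> = (\<Sum>m\<in>S. \<Sum>n\<in>S. polar q (proj m x) (proj n y))"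
      by (rule q.polar_sum2)
    also have "\<dots> = (\<Sum>m\<in>S. \<Sum>n\<in>S. if n = - m then polar q (proj m x) (proj (- m) y) else 0)"
      using p0 by (intro sum.cong refl) (auto simp: add_eq_0_iff)
    also have "\<dots> = (\<Sum>m\<in>S. polar q (proj m x) (proj (- m) y))"
      using sym by (intro sum.cong) auto
    also have "\<dots> = (\<Sum>m\<in>S. bil B G0 (proj m x) (proj (- m) y) + bil B G0 (proj (- m) y) (proj m x))"
      by (simp add: polar_def G0 bil_add)
    \<comment> \<open>Writing \<open>m\<close> as \<open>- (- m)\<close> prepares the substitution
      of \<open>- m\<close> for \<open>m\<close>, which turns the second sum into
      \<open>bil B G y x\<close>.\<close>
    also have "\<dots> = bil B G x y + (\<Sum>m\<in>S. bil B G0 (proj (- m) y) (proj (- (- m)) x))"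
      by (simp add: sum.distrib G)
    also have "\<dots> = bil B G x y + bil B G y x"
      unfolding reidx[of "\<lambda>m. bil B G0 (proj m y) (proj (- m) x)"] G ..
    finally show ?thesis by (simp add: q.polar_diff_bil)
  qed
  have "q x = bil B G x x" for x
  proof -
    have "q x - bil B G x x = (\<lambda>x. q x - bil B G x x) (\<lambda>b. \<Sum>m\<in>S. proj m x b)"
      by (rule d.cong) (simp add: sum_proj)
    also have "\<dots> = 0"
    proof (rule d.eq_zero_of_sum[OF _ polar0])
      fix m assume m: "m \<in> S"
      show "q (proj m x) - bil B G (proj m x) (proj m x) = 0"
      \<comment> \<open>In an arbitrary abelian group \<open>m = - m\<close> does not give
        \<open>m = 0\<close>. In that case the block of \<open>G0\<close> at \<open>(m, m)\<close>
        was kept and equals \<open>q\<close> there; otherwise \<open>m\<close> is nonzero and both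
        terms vanish.\<close>
      proof (cases "m = - m")
        case True
        then show ?thesis using G_van[OF m m, of x x] by (simp add: G0)
      next
        case False
        then have "m \<noteq> 0" by auto
        then show ?thesis using G_van[OF m m, of x x] q0[OF m] False by simp
      qed
    qed
    finally show ?thesis by simp
  qed
  moreover have "bil B G (proj m x) (proj n y) = 0" if "m \<in> S" "n \<in> S" "m + n \<noteq> 0" for m n x y
    using G_van[OF that(1,2), of x y] that(3) by auto
  ultimately show thesis using that by blast
qed

text \<open>The matrix identity \<open>N^T G N = G\<close> for the generic torus element
  \<open>N\<close>: the block of \<open>G\<close> pairing \<open>m\<close> and \<open>n\<close>
  acquires the exponent \<open>w m + w n\<close>, and only blocks with \<open>n = - m\<close> are
  present.\<close>

lemma lmat_bil_fix:
  assumes G: "\<And>m n x y. m \<in> S \<Longrightarrow> n \<in> S \<Longrightarrow> m + n \<noteq> 0 \<Longrightarrow> bil B G (proj m x) (proj n y) = 0"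
    and w: "\<And>m. m \<in> S \<Longrightarrow> w (- m) = - w m" and pq: "p \<in> B" "q \<in> B"
  shows "(\<Sum>b\<in>B. \<Sum>c\<in>B. single 0 (G (b, c)) * lmat S w e (b, p) * lmat S w e (c, q)) =
    single (0::'n::ab_group_add) (G (p, q))"
proof -
  let ?c = "\<lambda>m p b. e m (b, p)"
  let ?\<delta> = "\<lambda>p b. if b = p then 1 else 0 :: 'k"
  \<comment> \<open>The columns of \<open>e m\<close> are projections of unit vectors, so the
    vanishing hypothesis on \<open>G\<close> applies to them.\<close>
  have col: "proj m (?\<delta> p) = ?c m p" if "p \<in> B" for m p
    using that by (simp add: fun_eq_iff proj_def if_distrib[of "\<lambda>x. _ * x"] sum.delta cong: if_cong)
  have "(\<Sum>b\<in>B. \<Sum>c\<in>B. single 0 (G (b, c)) * lmat S w e (b, p) * lmat S w e (c, q)) =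
      (\<Sum>b\<in>B. \<Sum>c\<in>B. \<Sum>m\<in>S. \<Sum>n\<in>S. single (w m + w n) (G (b, c) * e m (b, p) * e n (c, q)))"
    by (simp add: lmat_def mult.assoc sum_product) (simp add: sum_distrib_left mult_single)
  also have "\<dots> = (\<Sum>m\<in>S. \<Sum>n\<in>S. \<Sum>b\<in>B. \<Sum>c\<in>B. single (w m + w n) (G (b, c) * e m (b, p) * e n (c, q)))"
    by (rule sum_swap4)
  also have "\<dots> = (\<Sum>m\<in>S. \<Sum>n\<in>S. single (w m + w n) (bil B G (?c m p) (?c n q)))"
    by (simp add: bil_def single_sum)
  also have "\<dots> = (\<Sum>m\<in>S. \<Sum>n\<in>S. single 0 (bil B G (?c m p) (?c n q)))"
  proof (intro sum.cong refl)
    fix m n assume mn: "m \<in> S" "n \<in> S"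
    show "single (w m + w n) (bil B G (?c m p) (?c n q)) =
        single 0 (bil B G (?c m p) (?c n q))"
    proof (cases "m + n = 0")
      case True
      then have "n = - m" by (simp add: add_eq_0_iff)
      then show ?thesis using w[OF mn(1)] by simp
    next
      case False
      then show ?thesis using G[OF mn False, of "?\<delta> p" "?\<delta> q"] pq by (simp add: col)
    qed
  qed
  also have "\<dots> = single 0 (bil B G (\<lambda>b. \<Sum>m\<in>S. ?c m p b) (\<lambda>b. \<Sum>m\<in>S. ?c m q b))"
    unfolding single_sum[symmetric] bil_sum ..
  also have "bil B G (\<lambda>b. \<Sum>m\<in>S. ?c m p b) (\<lambda>b. \<Sum>m\<in>S. ?c m q b) = bil B G (?\<delta> p) (?\<delta> q)"
    using pq by (intro bil_cong) (auto simp: complete)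
  also have "\<dots> = G (p, q)"
    using pq by (intro bil_delta) auto
  finally show ?thesis .
qed

end

section \<open>Laurent monomials on the split torus\<close>

lemma (in comm_monoid) comm_group_hom_finprod:
  assumes "comm_monoid H" "h \<in> hom G H" "h \<one> = \<one>\<^bsub>H\<^esub>" "f \<in> I \<rightarrow> carrier G"
  shows "h (finprod G f I) = finprod H (\<lambda>i. h (f i)) I"
proof -
  interpret H: comm_monoid H by fact
  show ?thesis
    using assms(4)
  proof (induction I rule: infinite_finite_induct)
    case (insert i I)
    have "f \<in> I \<rightarrow> carrier G" "f i \<in> carrier G" using insert by auto
    moreover have "(\<lambda>i. h (f i)) \<in> I \<rightarrow> carrier H" "h (f i) \<in> carrier H"
      using calculation assms(2) by (auto simp: hom_def Pi_iff)
    ultimately show ?case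
      using insert assms(2) by (simp add: hom_mult)
  qed (use assms in auto)
qed

text \<open>The value at \<open>x\<close> of the character with exponent \<open>m\<close>. The
  product is formed in the unit group because exponents may be negative; indices from
  \<open>s\<close> on are ignored.\<close>

definition monomial :: "('k::field, 'u) module \<Rightarrow> nat \<Rightarrow> (nat \<Rightarrow> 'u) \<Rightarrow> (nat \<Rightarrow>\<^sub>0 int) \<Rightarrow> 'u"
  where "monomial A s x m =
    finprod (units_of A) (\<lambda>i. x i [^]\<^bsub>units_of A\<^esub> lookup m i) {..<s}"

lemma carrier_Gm_power: "carrier (Gm_power s A) = {..<s} \<rightarrow>\<^sub>E Units A"
  by (simp add: Gm_power_def units_of_carrier)

lemma mult_Gm_power: "x \<otimes>\<^bsub>Gm_power s A\<^esub> y = (\<lambda>i\<in>{..<s}. x i \<otimes>\<^bsub>A\<^esub> y i)"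
  by (simp add: Gm_power_def units_of_mult)

lemma one_Gm_power: "\<one>\<^bsub>Gm_power s A\<^esub> = (\<lambda>i\<in>{..<s}. \<one>\<^bsub>A\<^esub>)"
  by (simp add: Gm_power_def units_of_one)

context k_algebra
begin

sublocale U: comm_group "units_of A"
  rewrites "carrier (units_of A) = Units A" and "monoid.mult (units_of A) = monoid.mult A" and "one (units_of A) = one A"
  by (rule units_comm_group) (simp_all add: units_of_carrier units_of_mult units_of_one)

lemma Gm_powerD: "x \<in> carrier (Gm_power s A) \<Longrightarrow> i < s \<Longrightarrow> x i \<in> Units A"
  by (auto simp: carrier_Gm_power)

lemma monomial_unit [intro, simp]:
  "x \<in> carrier (Gm_power s A) \<Longrightarrow> monomial A s x m \<in> Units A"
  unfolding monomial_def by (intro U.finprod_closed) (auto dest: Gm_powerD)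

lemma monomial_add:
  "x \<in> carrier (Gm_power s A) \<Longrightarrow> monomial A s x (m + n) = monomial A s x m \<otimes> monomial A s x n"
  unfolding monomial_def
  by (subst U.finprod_multf[symmetric])
    (auto dest: Gm_powerD simp: lookup_add U.int_pow_mult intro!: U.finprod_cong')

lemma monomial_zero [simp]: "monomial A s x 0 = \<one>"
  unfolding monomial_def by (rule U.finprod_one_eqI) (simp add: units_of_one)

lemma monomial_evaluation_monomial:
  "x \<in> carrier (Gm_power s A) \<Longrightarrow> monomial_evaluation A (monomial A s x)"
  by unfold_locales (auto simp: monomial_add Units_closed)

lemma monomial_uminus:
  assumes "x \<in> carrier (Gm_power s A)"
  shows "monomial A s x (- m) \<otimes> monomial A s x m = \<one>"
  using monomial_add[OF assms, of "- m" m] by simp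

lemma monomial_mult:
  assumes "x \<in> carrier (Gm_power s A)" "y \<in> carrier (Gm_power s A)"
  shows "monomial A s (x \<otimes>\<^bsub>Gm_power s A\<^esub> y) m = monomial A s x m \<otimes> monomial A s y m"
  unfolding monomial_def using assms
  by (subst U.finprod_multf[symmetric])
    (auto dest: Gm_powerD simp: mult_Gm_power U.int_pow_distrib[OF assms[THEN Gm_powerD]] intro!: U.finprod_cong')

lemma monomial_one: "monomial A s \<one>\<^bsub>Gm_power s A\<^esub> m = \<one>"
  unfolding monomial_def by (rule U.finprod_one_eqI) (simp add: one_Gm_power)

lemma monomial_single:
  assumes "x \<in> carrier (Gm_power s A)" "i < s"
  shows "monomial A s x (single i 1) = x i"
proof -
  have "monomial A s x (single i 1) =
      finprod (units_of A) (\<lambda>j. if i = j then x j else \<one>) {..<s}"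
    unfolding monomial_def using assms
    by (intro U.finprod_cong') (auto dest: Gm_powerD simp: lookup_single when_def units_of_one)
  also have "\<dots> = x i"
    using assms by (intro U.finprod_singleton) (auto dest: Gm_powerD)
  finally show ?thesis .
qed

lemma Gm_power_group: "group (Gm_power s A)"
  unfolding Gm_power_def by (rule product_group) (rule units_group)

lemma Gm_power_closed:
  assumes "x \<in> carrier (Gm_power s A)" "y \<in> carrier (Gm_power s A)"
  shows "x \<otimes>\<^bsub>Gm_power s A\<^esub> y \<in> carrier (Gm_power s A)" "\<one>\<^bsub>Gm_power s A\<^esub> \<in> carrier (Gm_power s A)"
  using assms by (auto simp: carrier_Gm_power mult_Gm_power one_Gm_power)

end

definition lev :: "('k::field, 'u) module \<Rightarrow> nat \<Rightarrow> (nat \<Rightarrow> 'u) \<Rightarrow> 'k laurent \<Rightarrow> 'u"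
  where "lev A s x = ev A (monomial A s x)"

lemma (in k_algebra) lev_lmat:
  assumes "x \<in> carrier (Gm_power s A)" "finite S"
  shows "lev A s x (lmat S w e p) = (\<Oplus>m\<in>S. structure_map A (e m p) \<otimes> monomial A s x (w m))"
proof -
  interpret E: monomial_evaluation A "monomial A s x"
    using assms by (intro monomial_evaluation_monomial)
  show ?thesis
    using assms(2) by (simp add: lev_def lmat_def E.ev_sum)
qed

lemma algebra_hom_Units:
  assumes "A \<in> k_algebras" "A' \<in> k_algebras" "h \<in> algebra_hom A A'" "a \<in> Units A"
  shows "h a \<in> Units A'"
proof -
  interpret h: ring_hom_cring A A' h by (rule algebra_homD(1)[OF assms(1-3)])
  obtain b where b: "b \<in> carrier A" "a \<otimes>\<^bsub>A\<^esub> b = \<one>\<^bsub>A\<^esub>" "a \<in> carrier A"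
    using assms(4) by (auto simp: Units_def)
  have "h a \<otimes>\<^bsub>A'\<^esub> h b = \<one>\<^bsub>A'\<^esub>"
    using b by (simp add: h.hom_mult[symmetric] del: h.hom_mult)
  then show ?thesis
    using b h.S.m_comm[of "h a" "h b"] by (auto simp: Units_def)
qed

lemma algebra_hom_Gm_power:
  assumes "A \<in> k_algebras" "A' \<in> k_algebras" "h \<in> algebra_hom A A'" "x \<in> carrier (Gm_power s A)"
  shows "(\<lambda>i\<in>{..<s}. h (x i)) \<in> carrier (Gm_power s A')"
  using assms algebra_hom_Units[OF assms(1-3)] by (auto simp: carrier_Gm_power)

lemma algebra_hom_monomial:
  assumes "A \<in> k_algebras" "A' \<in> k_algebras" "h \<in> algebra_hom A A'" "x \<in> carrier (Gm_power s A)"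
  shows "h (monomial A s x m) = monomial A' s (\<lambda>i\<in>{..<s}. h (x i)) m"
proof -
  interpret A: k_algebra A using assms by (simp add: k_algebra_iff)
  interpret A': k_algebra A' using assms by (simp add: k_algebra_iff)
  interpret h: ring_hom_cring A A' h by (rule algebra_homD(1)[OF assms(1-3)])
  have hom: "h \<in> hom (units_of A) (units_of A')"
    using algebra_hom_Units[OF assms(1-3)] by (auto simp: hom_def units_of_carrier units_of_mult A.Units_closed)
  have "h (monomial A s x m) = finprod (units_of A') (\<lambda>i. h (x i [^]\<^bsub>units_of A\<^esub> lookup m i)) {..<s}"
    unfolding monomial_def using assms(4)
    by (intro A.U.comm_group_hom_finprod[OF A'.U.comm_monoid_axioms hom])
      (auto dest: A.Gm_powerD simp: units_of_one units_of_carrier)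
  also have "\<dots> = monomial A' s (\<lambda>i\<in>{..<s}. h (x i)) m"
    unfolding monomial_def
    using assms(4) algebra_hom_Units[OF assms(1-3)]
    by (intro A'.U.finprod_cong')
      (auto dest: A.Gm_powerD simp: units_of_carrier
        hom_int_pow[OF hom _ A.U.group_axioms A'.U.group_axioms])
  finally show ?thesis .
qed

lemma algebra_hom_lev:
  assumes "A \<in> k_algebras" "A' \<in> k_algebras" "h \<in> algebra_hom A A'" "x \<in> carrier (Gm_power s A)"
  shows "h (lev A s x F) = lev A' s (\<lambda>i\<in>{..<s}. h (x i)) F"
proof -
  interpret A: k_algebra A using assms by (simp add: k_algebra_iff)
  show ?thesis
    unfolding lev_def algebra_hom_ev[OF A.monomial_evaluation_monomial[OF assms(4)] assms(2,3)]
      algebra_hom_monomial[OF assms] ..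
qed


section \<open>A copy of the Laurent polynomial ring in the universe\<close>

text \<open>Over a finite field, 1 plus the product of all monic linear polynomials has positive
  degree and no root.\<close>

lemma infinite_alg_closed_field: "infinite (UNIV :: 'k::alg_closed_field set)"
proof
  assume fin: "finite (UNIV :: 'k set)"
  define p :: "'k poly" where "p = (\<Prod>a\<in>UNIV. [:- a, 1:]) + 1"
  have one: "poly p x = 1" for x
    using fin by (auto simp: p_def poly_prod intro!: prod_zero[OF fin])
  have "degree (\<Prod>a\<in>UNIV. [:- a, 1:] :: 'k poly) = card (UNIV :: 'k set)"
    by (subst degree_prod_eq_sum_degree) auto
  then have "degree p > 0"
    using fin by (simp add: p_def degree_add_eq_left card_gt_0_iff)
  then show False
    using alg_closed_imp_poly_has_root[of p] one by auto
qed

lemma inj_pair_infinite: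
  assumes "infinite (UNIV :: 'k set)"
  shows "\<exists>f :: 'k \<times> 'k \<Rightarrow> 'k. inj f"
proof -
  have "|UNIV \<times> UNIV :: ('k \<times> 'k) set| \<le>o |UNIV :: 'k set|"
    using card_of_Times_same_infinite[OF assms] ordIso_iff_ordLeq by blast
  then show ?thesis
    unfolding card_of_ordLeq[symmetric] by auto
qed

text \<open>A finitely supported function is encoded by a finite list of its pairs of key and value,
  and such a list is encoded in an infinite set by iterated pairing.\<close>

lemma inj_poly_mapping_infinite:
  assumes inf: "infinite (UNIV :: 'k set)" and g: "inj (g :: 'm \<times> 'c::zero \<Rightarrow> 'k)"
  shows "\<exists>f :: ('m \<Rightarrow>\<^sub>0 'c) \<Rightarrow> 'k. inj f"
proof -
  obtain p :: "'k \<times> 'k \<Rightarrow> 'k" where p: "inj p"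
    using inj_pair_infinite[OF inf] by blast
  obtain n :: "nat \<Rightarrow> 'k" where n: "inj n"
    using infinite_countable_subset[OF inf] by auto
  \<comment> \<open>\<open>enc\<close> folds a list into nested pairs from an arbitrary seed, so it
    separates only lists of equal length; the length is recorded separately through
    \<open>n\<close>.\<close>
  define enc :: "'k list \<Rightarrow> 'k" where "enc = rec_list undefined (\<lambda>x _ y. p (x, y))"
  have enc: "enc xs = enc ys \<Longrightarrow> length xs = length ys \<Longrightarrow> xs = ys" for xs ys
  proof (induction xs arbitrary: ys)
    case (Cons x xs)
    then obtain y ys' where "ys = y # ys'" by (cases ys) auto
    with Cons show ?case by (simp add: enc_def inj_eq[OF p])
  qed simp
  define L where "L F = (SOME xs. set xs = (\<lambda>m. (m, lookup F m)) ` keys F)"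
    for F :: "'m \<Rightarrow>\<^sub>0 'c"
  have L: "set (L F) = (\<lambda>m. (m, lookup F m)) ` keys F" for F
    unfolding L_def by (rule someI_ex) (intro finite_list finite_imageI finite_keys)
  have L_inj: "F = G" if "L F = L G" for F G
  proof (rule poly_mapping_eqI)
    fix m
    have "(m, c) \<in> set (L F) \<longleftrightarrow> c \<noteq> 0 \<and> c = lookup F m" for c F
      unfolding L by (auto simp: in_keys_iff)
    then show "lookup F m = lookup G m"
      using that by metis
  qed
  have "inj (\<lambda>F. p (n (length (L F)), enc (map g (L F))))"
  proof (rule injI)
    fix F G assume "p (n (length (L F)), enc (map g (L F))) = p (n (length (L G)), enc (map g (L G)))"
    then have "length (L F) = length (L G)" "enc (map g (L F)) = enc (map g (L G))"
      by (simp_all add: inj_eq[OF p] inj_eq[OF n])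
    then have "map g (L F) = map g (L G)" by (intro enc) simp_all
    then show "F = G" by (intro L_inj) (rule injD[OF inj_mapI[OF g]])
  qed
  then show ?thesis by blast
qed

text \<open>Even with infinitely many indeterminates the Laurent ring is no larger than the infinite
  field, so it fits wherever the field fits. A single copy serves tori of all ranks.\<close>

lemma inj_laurent:
  assumes "inj (\<iota> :: 'k::alg_closed_field \<Rightarrow> 'u)"
  shows "\<exists>\<phi> :: 'k laurent \<Rightarrow> 'u. inj \<phi>"
proof -
  have inf: "infinite (UNIV :: 'k set)" by (rule infinite_alg_closed_field)
  obtain n :: "nat \<Rightarrow> 'k" where n: "inj n"
    using infinite_countable_subset[OF inf] by auto
  obtain p :: "'k \<times> 'k \<Rightarrow> 'k" where p: "inj p"
    using inj_pair_infinite[OF inf] by blast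
  have "inj (\<lambda>z :: nat \<times> int. n (to_nat z))"
    by (rule injI) (simp add: inj_eq[OF n])
  from inj_poly_mapping_infinite[OF inf this] obtain i :: "(nat \<Rightarrow>\<^sub>0 int) \<Rightarrow> 'k" where i: "inj i"
    by blast
  have "inj (\<lambda>z. p (i (fst z), snd z))"
    by (rule injI) (simp add: inj_eq[OF p] inj_eq[OF i] prod_eq_iff)
  from inj_poly_mapping_infinite[OF inf this] obtain f :: "'k laurent \<Rightarrow> 'k" where "inj f"
    by blast
  then have "inj (\<iota> \<circ> f)" using assms by (rule inj_compose[rotated])
  then show ?thesis by blast
qed

section \<open>The Laurent polynomial ring as an algebra, and its generic points\<close>

definition laurent_algebra :: "('k::field laurent \<Rightarrow> 'u) \<Rightarrow> ('k, 'u) module"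
  where "laurent_algebra \<phi> =
    \<lparr>carrier = range \<phi>, monoid.mult = (\<lambda>a b. \<phi> (inv_into UNIV \<phi> a * inv_into UNIV \<phi> b)), one = \<phi> 1,
     ring.zero = \<phi> 0, add = (\<lambda>a b. \<phi> (inv_into UNIV \<phi> a + inv_into UNIV \<phi> b)),
     module.smult = (\<lambda>c a. \<phi> (single 0 c * inv_into UNIV \<phi> a))\<rparr>"

locale laurent_copy =
  fixes \<phi> :: "'k::field laurent \<Rightarrow> 'u"
  assumes inj_phi: "inj \<phi>"
begin

abbreviation LA where "LA \<equiv> laurent_algebra \<phi>"

lemma inv_phi [simp]: "inv_into UNIV \<phi> (\<phi> F) = F"
  using inj_phi by simp

lemma phi_eq_iff [simp]: "\<phi> F = \<phi> G \<longleftrightarrow> F = G"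
  using inj_phi by (simp add: inj_eq)

lemma LA_simps [simp]:
  "carrier LA = range \<phi>" "\<phi> F \<otimes>\<^bsub>LA\<^esub> \<phi> G = \<phi> (F * G)" "\<phi> F \<oplus>\<^bsub>LA\<^esub> \<phi> G = \<phi> (F + G)"
  "\<one>\<^bsub>LA\<^esub> = \<phi> 1" "\<zero>\<^bsub>LA\<^esub> = \<phi> 0" "c \<odot>\<^bsub>LA\<^esub> \<phi> F = \<phi> (single 0 c * F)"
  by (simp_all add: laurent_algebra_def)

lemma LA_k_algebra: "LA \<in> k_algebras"
proof -
  have "abelian_group LA"
  proof (rule abelian_groupI)
    fix x assume "x \<in> carrier LA"
    then obtain F where "x = \<phi> F" by auto
    then show "\<exists>y\<in>carrier LA. y \<oplus>\<^bsub>LA\<^esub> x = \<zero>\<^bsub>LA\<^esub>" by (intro bexI[of _ "\<phi> (- F)"]) auto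
  qed (auto simp: algebra_simps)
  moreover have "comm_monoid LA"
    by (rule comm_monoidI) (auto simp: algebra_simps)
  ultimately have cLA: "cring LA"
    by (rule cringI) (auto simp: algebra_simps)
  have "algebra (ground_ring :: 'k ring) LA"
  proof (rule algebraI[OF cring_from_type_algebra cLA])
    fix a b :: 'k and x y assume xy: "x \<in> carrier LA"
    then obtain F where F: "x = \<phi> F" by auto
    show "a \<odot>\<^bsub>LA\<^esub> x \<in> carrier LA" by (simp add: F)
    show "(a \<oplus>\<^bsub>ground_ring\<^esub> b) \<odot>\<^bsub>LA\<^esub> x = a \<odot>\<^bsub>LA\<^esub> x \<oplus>\<^bsub>LA\<^esub> b \<odot>\<^bsub>LA\<^esub> x"
      by (simp add: F ring_of_type_algebra_def single_add distrib_right)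
    show "(a \<otimes>\<^bsub>ground_ring\<^esub> b) \<odot>\<^bsub>LA\<^esub> x = a \<odot>\<^bsub>LA\<^esub> (b \<odot>\<^bsub>LA\<^esub> x)"
      by (simp add: F ring_of_type_algebra_def mult_single mult.assoc[symmetric])
    show "\<one>\<^bsub>ground_ring\<^esub> \<odot>\<^bsub>LA\<^esub> x = x"
      by (simp add: F ring_of_type_algebra_def)
    assume "y \<in> carrier LA"
    then obtain G where G: "y = \<phi> G" by auto
    show "a \<odot>\<^bsub>LA\<^esub> (x \<oplus>\<^bsub>LA\<^esub> y) = a \<odot>\<^bsub>LA\<^esub> x \<oplus>\<^bsub>LA\<^esub> a \<odot>\<^bsub>LA\<^esub> y"
      by (simp add: F G distrib_left)
    show "(a \<odot>\<^bsub>LA\<^esub> x) \<otimes>\<^bsub>LA\<^esub> y = a \<odot>\<^bsub>LA\<^esub> (x \<otimes>\<^bsub>LA\<^esub> y)"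
      by (simp add: F G mult.assoc)
  qed
  then show ?thesis by (simp add: k_algebras_def)
qed

sublocale LA: k_algebra LA
  by (simp add: k_algebra_iff LA_k_algebra)

lemma sm_LA: "structure_map LA c = \<phi> (single 0 c)"
  by (simp add: structure_map_def)

lemma finsum_LA: "(\<Oplus>\<^bsub>LA\<^esub>i\<in>I. \<phi> (f i)) = \<phi> (\<Sum>i\<in>I. f i)"
  by (induction I rule: infinite_finite_induct) (auto simp: LA.finsum_infinite)

lemma unit_LA: "\<phi> (single d 1) \<in> Units LA"
proof (rule LA.unit_factor)
  have "\<phi> (single d 1) \<otimes>\<^bsub>LA\<^esub> \<phi> (single (- d) 1) = \<one>\<^bsub>LA\<^esub>"
    by (simp add: mult_single)
  then show "\<phi> (single d 1) \<otimes>\<^bsub>LA\<^esub> \<phi> (single (- d) 1) \<in> Units LA"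
    using LA.Units_one_closed by simp
qed simp_all

text \<open>With unit exponents \<open>d i\<close> this is the generic point of rank
  \<open>s\<close>; other choices of \<open>d\<close> give points in further indeterminates and
  products of such points.\<close>

definition point :: "nat \<Rightarrow> (nat \<Rightarrow> (nat \<Rightarrow>\<^sub>0 int)) \<Rightarrow> nat \<Rightarrow> 'u"
  where "point s d = (\<lambda>i\<in>{..<s}. \<phi> (single (d i) 1))"

text \<open>The substitution on exponents induced by evaluation at \<open>point s d\<close>. For the
  generic point it truncates \<open>m\<close> to the indices below \<open>s\<close>, hence the
  recurring condition that it leaves \<open>m\<close> unchanged.\<close>

definition expo :: "nat \<Rightarrow> (nat \<Rightarrow> (nat \<Rightarrow>\<^sub>0 int)) \<Rightarrow> (nat \<Rightarrow>\<^sub>0 int) \<Rightarrow> (nat \<Rightarrow>\<^sub>0 int)"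
  where "expo s d m = (\<Sum>i<s. frag_cmul (lookup m i) (d i))"

lemma point_closed [intro, simp]: "point s d \<in> carrier (Gm_power s LA)"
  by (auto simp: point_def carrier_Gm_power unit_LA)

lemma pow_LA: "\<phi> (single d 1) [^]\<^bsub>units_of LA\<^esub> (n::int) = \<phi> (single (frag_cmul n d) 1)"
proof -
  have nat: "\<phi> (single d 1) [^]\<^bsub>units_of LA\<^esub> (k::nat) = \<phi> (single (frag_cmul (int k) d) 1)" for k d
    by (induction k) (auto simp: mult_single frag_cmul_distrib algebra_simps units_of_one units_of_mult)
  show ?thesis
  proof (cases n rule: int_cases2)
    case (nonneg k)
    then show ?thesis by (simp add: int_pow_int nat)
  next
    case (nonpos k)
    have "\<phi> (single d 1) [^]\<^bsub>units_of LA\<^esub> (- int k) =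
        inv\<^bsub>units_of LA\<^esub> \<phi> (single (frag_cmul (int k) d) 1)"
      by (simp add: LA.U.int_pow_neg_int unit_LA nat)
    also have "\<dots> = \<phi> (single (frag_cmul (- int k) d) 1)"
      by (rule LA.U.inv_equality) (auto simp: unit_LA mult_single frag_cmul_distrib[symmetric])
    finally show ?thesis using nonpos by simp
  qed
qed

lemma monomial_point: "monomial LA s (point s d) m = \<phi> (single (expo s d m) 1)"
proof -
  have "finprod (units_of LA) (\<lambda>i. point s d i [^]\<^bsub>units_of LA\<^esub> lookup m i) I =
      \<phi> (single (\<Sum>i\<in>I. frag_cmul (lookup m i) (d i)) 1)"
    if "finite I" "I \<subseteq> {..<s}" for I
    using that
    by (induction I rule: finite_induct)
      (auto simp: point_def pow_LA unit_LA mult_single subset_iff)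
  then show ?thesis by (simp add: monomial_def expo_def)
qed

lemma lev_point: "lev LA s (point s d) F =
  \<phi> (\<Sum>m\<in>keys F. single (expo s d m) (lookup F m))"
  by (simp add: lev_def ev_def monomial_point sm_LA mult_single finsum_LA)

lemma lev_point_lmat: "finite S \<Longrightarrow> lev LA s (point s d) (lmat S w e p) = \<phi> (lmat S (\<lambda>m. expo s d (w m)) e p)"
  by (simp add: LA.lev_lmat monomial_point sm_LA mult_single finsum_LA) (simp add: lmat_def)

lemma point_mult: "point s d \<otimes>\<^bsub>Gm_power s LA\<^esub> point s d' = point s (\<lambda>i. d i + d' i)"
  by (auto simp: mult_Gm_power point_def mult_single intro!: restrict_ext)

lemma expo_add: "expo s (\<lambda>i. d i + d' i) m = expo s d m + expo s d' m"
  by (simp add: expo_def frag_cmul_distrib2 sum.distrib)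

lemma lookup_expo_single:
  assumes "inj j"
  shows "lookup (expo s (\<lambda>i. single (j i) 1) m) (j i) =
    (if i < s then lookup m i else 0)"
proof -
  have "lookup (expo s (\<lambda>i. single (j i) 1) m) (j i) =
      (\<Sum>k<s. if k = i then lookup m k else 0)"
    unfolding expo_def lookup_sum
    by (intro sum.cong refl) (simp add: lookup_single when_def inj_eq[OF assms])
  then show ?thesis by simp
qed

lemma lookup_expo_single_not_in:
  assumes "n \<notin> range j"
  shows "lookup (expo s (\<lambda>i. single (j i) 1) m) n = 0"
  using assms by (auto simp: expo_def lookup_sum lookup_single when_def intro!: sum.neutral)

text \<open>The universal property of the generic point: the first \<open>s\<close> indeterminates
  are specialized to the coordinates of \<open>x\<close> and, as \<open>monomial\<close> ignores
  them, the others to 1.\<close>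

lemma lev_hom:
  assumes "A \<in> k_algebras" "x \<in> carrier (Gm_power s A)"
  shows "(\<lambda>u. lev A s x (inv_into UNIV \<phi> u)) \<in> algebra_hom LA A"
proof -
  interpret A: k_algebra A using assms by (simp add: k_algebra_iff)
  interpret E: monomial_evaluation A "monomial A s x"
    using assms by (intro A.monomial_evaluation_monomial)
  show ?thesis
    by (auto simp: algebra_hom_def lev_def A.smult_eq intro!: ring_hom_memI)
qed

end

section \<open>Diagonal tori\<close>

lemma (in monomial_evaluation) ev_lmat:
  "finite S \<Longrightarrow> ev A \<mu> (lmat S w e p) = (\<Oplus>m\<in>S. structure_map A (e m p) \<otimes> \<mu> (w m))"
  by (simp add: lmat_def ev_sum)

text \<open>The projections and their weights are separate arguments: \<open>w = id\<close> gives
  the original torus, and another \<open>w\<close> on the same projections gives the enlarged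
  one.\<close>

definition tor :: "'v set \<Rightarrow> (nat \<Rightarrow>\<^sub>0 int) set \<Rightarrow> ((nat \<Rightarrow>\<^sub>0 int) \<Rightarrow> (nat \<Rightarrow>\<^sub>0 int)) \<Rightarrow>
    ((nat \<Rightarrow>\<^sub>0 int) \<Rightarrow> 'v \<times> 'v \<Rightarrow> 'k::field) \<Rightarrow> nat \<Rightarrow> ('k, 'u) module \<Rightarrow> (nat \<Rightarrow> 'u) \<Rightarrow> (('v \<Rightarrow> 'u) \<Rightarrow> ('v \<Rightarrow> 'u))"
  where "tor B S w e s A x = mact B A (\<lambda>p. lev A s x (lmat S w e p))"

locale torus_point = idempotents B S e + k_algebra A
  for B :: "'v set" and S :: "(nat \<Rightarrow>\<^sub>0 int) set" and e :: "(nat \<Rightarrow>\<^sub>0 int) \<Rightarrow> 'v \<times> 'v \<Rightarrow> 'k::field"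
    and A :: "('k, 'u) module" (structure)
begin

sublocale matrices A B
  by unfold_locales (rule finite_P)

lemma lev_matrix: "x \<in> carrier (Gm_power s A) \<Longrightarrow> matrix (\<lambda>p. lev A s x (F p))"
  unfolding lev_def by (intro matrixI monomial_evaluation.ev_closed monomial_evaluation_monomial)

lemma matrix_product_ev:
  assumes "monomial_evaluation A \<mu>"
  shows "(\<Oplus>d\<in>B. ev A \<mu> (F d) \<otimes> ev A \<mu> (G d)) = ev A \<mu> (\<Sum>d\<in>B. F d * G d)"
proof -
  interpret E: monomial_evaluation A \<mu> by fact
  show ?thesis by (simp add: E.ev_sum)
qed

lemma lev_cancel:
  assumes x: "x \<in> carrier (Gm_power s A)" and bc: "b \<in> B" "c \<in> B" and w: "\<And>m. m \<in> S \<Longrightarrow> w m + w' m = 0"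
  shows "(\<Oplus>d\<in>B. lev A s x (lmat S w e (b, d)) \<otimes> lev A s x (lmat S w' e (d, c))) = (if b = c then \<one> else \<zero>)"
proof -
  interpret E: monomial_evaluation A "monomial A s x" using x by (rule monomial_evaluation_monomial)
  show ?thesis
    unfolding lev_def matrix_product_ev[OF E.monomial_evaluation_axioms] lmat_mult[OF bc]
    using lmat_one[OF bc, of "\<lambda>m. w m + w' m"] w by simp
qed

lemma tor_GL:
  assumes x: "x \<in> carrier (Gm_power s A)"
  shows "tor B S w e s A x \<in> carrier (GL B A)"
  unfolding tor_def
  by (rule mact_in_GL[of _ "\<lambda>p. lev A s x (lmat S (\<lambda>m. - w m) e p)"])
    (simp_all add: lev_matrix[OF x] lev_cancel[OF x])

lemma tor_mult:
  assumes x: "x \<in> carrier (Gm_power s A)" and y: "y \<in> carrier (Gm_power s A)"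
  shows "tor B S w e s A x \<otimes>\<^bsub>GL B A\<^esub> tor B S w e s A y = tor B S w e s A (x \<otimes>\<^bsub>Gm_power s A\<^esub> y)"
proof -
  have xy: "x \<otimes>\<^bsub>Gm_power s A\<^esub> y \<in> carrier (Gm_power s A)"
    using x y by (rule Gm_power_closed)
  \<comment> \<open>Pairs of exponents, one component for each point, bring both evaluations under
    one homomorphism, so that \<open>lmat_mult\<close> applies.\<close>
  define \<mu> where "\<mu> = (\<lambda>(m, n). monomial A s x m \<otimes> monomial A s y n)"
  have cl: "monomial A s x m \<in> carrier A" "monomial A s y m \<in> carrier A" for m
    using x y by (auto intro: Units_closed)
  interpret E: monomial_evaluation A \<mu>
    by unfold_locales (auto simp: \<mu>_def cl monomial_add[OF x] monomial_add[OF y] zero_prod_def m_ac)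
  have mu: "\<mu> (m, 0) = monomial A s x m" "\<mu> (0, n) = monomial A s y n" "\<mu> (m, n) = monomial A s x m \<otimes> monomial A s y n" for m n
    by (simp_all add: \<mu>_def cl)
  have 1: "lev A s x (lmat S w e p) = ev A \<mu> (lmat S (\<lambda>m. (w m, 0)) e p)" for p
    by (simp add: lev_lmat[OF x] E.ev_lmat mu(1))
  have 2: "lev A s y (lmat S w e p) = ev A \<mu> (lmat S (\<lambda>m. (0, w m)) e p)" for p
    by (simp add: lev_lmat[OF y] E.ev_lmat mu(2))
  have 3: "lev A s (x \<otimes>\<^bsub>Gm_power s A\<^esub> y) (lmat S w e p) = ev A \<mu> (lmat S (\<lambda>m. (w m, 0) + (0, w m)) e p)" for p
    by (simp add: lev_lmat[OF xy] E.ev_lmat monomial_mult[OF x y] mu(3))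
  show ?thesis
    unfolding tor_def
    by (subst GL_mult_mact[OF lev_matrix[OF x] lev_matrix[OF y] tor_GL[OF x, unfolded tor_def] tor_GL[OF y, unfolded tor_def]])
      (auto intro!: mact_cong lev_matrix[OF xy]
        simp: 1 2 3 matrix_product_ev[OF E.monomial_evaluation_axioms] lmat_mult)
qed

lemma tor_hom: "tor B S w e s A \<in> hom (Gm_power s A) (GL B A)"
  by (auto simp: hom_def tor_GL tor_mult)

lemma tor_inv:
  assumes x: "x \<in> carrier (Gm_power s A)"
  shows "inv\<^bsub>GL B A\<^esub> (tor B S w e s A x) = tor B S (\<lambda>m. - w m) e s A x"
proof (rule group.inv_equality[OF GL_group _ tor_GL[OF x] tor_GL[OF x]])
  have "mact B A (\<lambda>(b, c). \<Oplus>d\<in>B. lev A s x (lmat S (\<lambda>m. - w m) e (b, d)) \<otimes> lev A s x (lmat S w e (d, c))) y = y"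
    if "y \<in> carrier E" for y
    using that by (intro mact_id) (auto simp: lev_cancel[OF x])
  then show "tor B S (\<lambda>m. - w m) e s A x \<otimes>\<^bsub>GL B A\<^esub> tor B S w e s A x = \<one>\<^bsub>GL B A\<^esub>"
    unfolding tor_def GL_one
    by (subst GL_mult_mact[OF lev_matrix[OF x] lev_matrix[OF x] tor_GL[OF x, unfolded tor_def] tor_GL[OF x, unfolded tor_def]])
      (auto simp: fun_eq_iff mact_def)
qed

lemma entry_tor:
  assumes "x \<in> carrier (Gm_power s A)" "b \<in> B" "c \<in> B"
  shows "entry A B (tor B S w e s A x) (b, c) = lev A s x (lmat S w e (b, c))"
  unfolding tor_def using assms by (intro entry_mact lev_matrix)

lemma base_change_tor:
  assumes x: "x \<in> carrier (Gm_power s A)" and A': "A' \<in> k_algebras" and h: "h \<in> algebra_hom A A'"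
  shows "base_change B A A' h (tor B S w e s A x) = tor B S w e s A' (\<lambda>i\<in>{..<s}. h (x i))"
proof -
  interpret A': matrices A' B using A' by (simp add: matrices_def k_algebra_iff matrices_axioms_def)
  interpret A': torus_point B S e A' by unfold_locales
  have x': "(\<lambda>i\<in>{..<s}. h (x i)) \<in> carrier (Gm_power s A')"
    by (rule algebra_hom_Gm_power[OF is_k_algebra A' h x])
  show ?thesis
    unfolding base_change_eq_mact tor_def[of _ _ _ _ _ A']
    by (intro A'.mact_cong A'.lev_matrix[OF x'])
      (simp add: entry_tor[OF x] algebra_hom_lev[OF is_k_algebra A' h x])
qed

end

lemma idempotents_torus_point:
  "idempotents B S e \<Longrightarrow> A \<in> k_algebras \<Longrightarrow> torus_point B S e A"
  by (simp add: torus_point_def k_algebra_iff)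

section \<open>Every homomorphism from a split torus to GL(V) is diagonalizable\<close>

context laurent_copy
begin

text \<open>The projections are the coefficients of the monomials in the image of the generic point.
  Comparing coefficients in \<open>\<psi> (X * Y) = \<psi> X * \<psi> Y\<close> for independent
  generic points gives orthogonality; the unit point gives completeness.\<close>

lemma diagonalization:
  fixes \<psi> :: "('k, 'u) module \<Rightarrow> (nat \<Rightarrow> 'u) \<Rightarrow> (('v \<Rightarrow> 'u) \<Rightarrow> ('v \<Rightarrow> 'u))"
  assumes B: "finite B"
    and hom: "\<And>A. A \<in> k_algebras \<Longrightarrow> \<psi> A \<in> hom (Gm_power r A) (GL B A)"
    and nat: "\<And>A A' h x. A \<in> k_algebras \<Longrightarrow> A' \<in> k_algebras \<Longrightarrow> h \<in> algebra_hom A A' \<Longrightarrow>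
        x \<in> carrier (Gm_power r A) \<Longrightarrow> \<psi> A' (\<lambda>i\<in>{..<r}. h (x i)) = base_change B A A' h (\<psi> A x)"
  obtains S e where "idempotents B S e" "\<And>m. m \<in> S \<Longrightarrow> - m \<in> S"
    "\<And>m. m \<in> S \<Longrightarrow> expo r (\<lambda>i. single i 1) m = m"
    "\<And>A x. A \<in> k_algebras \<Longrightarrow> x \<in> carrier (Gm_power r A) \<Longrightarrow> \<psi> A x = tor B S id e r A x"
proof -
  interpret LM: matrices LA B
    by (simp add: matrices_def matrices_axioms_def B LA.k_algebra_axioms)
  \<comment> \<open>Two disjoint blocks of \<open>r\<close> indeterminates provide the two
    independent generic points, in place of a tensor product of two coordinate rings.\<close>
  let ?d = "\<lambda>i. single i (1::int)" and ?d' = "\<lambda>i. single (r + i) (1::int)"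
  define M where "M p = inv_into UNIV \<phi> (entry LA B (\<psi> LA (point r ?d)) p)" for p
  have GL: "\<psi> A x \<in> carrier (GL B A)" if "A \<in> k_algebras" "x \<in> carrier (Gm_power r A)" for A x
    using hom[OF that(1)] that(2) by (auto simp: hom_def)
  have M: "\<phi> (M (b, c)) = entry LA B (\<psi> LA (point r ?d)) (b, c)" if "b \<in> B" "c \<in> B" for b c
    using LM.matrixD[OF LM.entry_closed[OF GL[OF LA_k_algebra point_closed]] that]
    unfolding M_def by (auto intro: f_inv_into_f)
  \<comment> \<open>The Yoneda argument: \<open>x\<close> is the image of the generic point under
    \<open>lev_hom\<close>, so naturality expresses \<open>\<psi> A x\<close> through
    \<open>M\<close>.\<close>
  have psi: "\<psi> A x = mact B A (\<lambda>p. lev A r x (M p))"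
    if A: "A \<in> k_algebras" and x: "x \<in> carrier (Gm_power r A)" for A x
  proof -
    interpret A: k_algebra A using A by (simp add: k_algebra_iff)
    interpret E: monomial_evaluation A "monomial A r x" using x by (rule A.monomial_evaluation_monomial)
    have "(\<lambda>i\<in>{..<r}. lev A r x (inv_into UNIV \<phi> (point r ?d i))) = (\<lambda>i\<in>{..<r}. x i)"
      by (rule restrict_ext)
        (use x in \<open>simp add: point_def lev_def A.monomial_single A.Gm_powerD A.Units_closed\<close>)
    also have "\<dots> = x" using x by (auto simp: carrier_Gm_power PiE_iff extensional_restrict)
    finally show ?thesis
      using nat[OF LA_k_algebra A lev_hom[OF A x] point_closed[of r ?d]]
      by (simp add: base_change_eq_mact M_def)
  qed
  have entry_psi: "entry A B (\<psi> A x) (b, c) = lev A r x (M (b, c))"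
    if A: "A \<in> k_algebras" and x: "x \<in> carrier (Gm_power r A)" and bc: "b \<in> B" "c \<in> B" for A x b c
  proof -
    interpret A: matrices A B using A B by (simp add: matrices_def k_algebra_iff matrices_axioms_def)
    show ?thesis
      unfolding psi[OF A x] lev_def
      by (intro A.entry_mact A.matrixI monomial_evaluation.ev_closed A.monomial_evaluation_monomial x bc)
  qed
  have expo_r: "lookup (expo r ?d m) i = (if i < r then lookup m i else 0)" for m i
    using lookup_expo_single[of id r m i] by (simp add: id_def)
  have idem: "expo r ?d (expo r ?d m) = expo r ?d m" for m
    by (rule poly_mapping_eqI) (simp add: expo_r)
  \<comment> \<open>Evaluation at the generic point returns \<open>M\<close> itself but truncates
    all exponents to the indices below \<open>r\<close>, so no other indeterminate occurs in
    \<open>M\<close>.\<close>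
  have keys_M: "expo r ?d m = m" if "m \<in> keys (M (b, c))" "b \<in> B" "c \<in> B" for m b c
  proof -
    have "M (b, c) = (\<Sum>m\<in>keys (M (b, c)).
        single (expo r ?d m) (lookup (M (b, c)) m))"
      using entry_psi[OF LA_k_algebra point_closed that(2,3), of ?d]
      unfolding lev_point M[OF that(2,3), symmetric] by simp
    then have "m \<in> keys (\<Sum>m\<in>keys (M (b, c)).
        single (expo r ?d m) (lookup (M (b, c)) m))"
      using that(1) by simp
    then obtain n where "m \<in> keys (single (expo r ?d n) (lookup (M (b, c)) n))"
      using Poly_Mapping.keys_sum[of "\<lambda>m. single (expo r ?d m) (lookup (M (b, c)) m)"]
      by blast
    then have "m = expo r ?d n" by (auto split: if_splits)
    then show ?thesis by (simp add: idem)
  qed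
  define K where "K = (\<Union>p\<in>B \<times> B. keys (M p))"
  \<comment> \<open>Opposites are added so that \<open>S\<close> can also index the weights of the
    dual; an opposite that does not occur in \<open>M\<close> has zero coefficients.\<close>
  define S where "S = K \<union> uminus ` K"
  define e where "e m p = lookup (M p) m" for m p
  have finS: "finite S" using B by (auto simp: S_def K_def)
  have symS: "- m \<in> S" if "m \<in> S" for m using that by (auto simp: S_def)
  have expo_uminus: "expo r ?d (- m) = - expo r ?d m" for m
    by (rule poly_mapping_eqI) (simp add: expo_r)
  have expoS: "expo r ?d m = m" if "m \<in> S" for m
    using that keys_M by (auto simp: S_def K_def expo_uminus)
  have M_lmat: "M (b, c) = lmat S id e (b, c)" if "b \<in> B" "c \<in> B" for b c
    unfolding lmat_def e_def id_def
    by (rule poly_mapping_expand[OF finS]) (use that in \<open>auto simp: S_def K_def\<close>)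
  have idemp: "idempotents B S e"
  proof
    fix m n b c assume mn: "m \<in> S" "n \<in> S" and bc: "b \<in> B" "c \<in> B"
    let ?X = "point r ?d" and ?Y = "point r ?d'"
    have GLs: "\<psi> LA ?X \<in> carrier (GL B LA)" "\<psi> LA ?Y \<in> carrier (GL B LA)"
      by (simp_all add: GL[OF LA_k_algebra])
    have "\<psi> LA (?X \<otimes>\<^bsub>Gm_power r LA\<^esub> ?Y) = \<psi> LA ?X \<otimes>\<^bsub>GL B LA\<^esub> \<psi> LA ?Y"
      using hom[OF LA_k_algebra] by (simp add: hom_mult)
    also have "\<dots> = mact B LA (\<lambda>(b, c). \<Oplus>\<^bsub>LA\<^esub>d\<in>B. entry LA B (\<psi> LA ?X) (b, d) \<otimes>\<^bsub>LA\<^esub> entry LA B (\<psi> LA ?Y) (d, c))"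
      using LM.GL_mult_mact[of "entry LA B (\<psi> LA ?X)" "entry LA B (\<psi> LA ?Y)"] GLs
      by (simp only: LM.GL_eq_mact[symmetric] LM.entry_closed)
    finally have "entry LA B (\<psi> LA (?X \<otimes>\<^bsub>Gm_power r LA\<^esub> ?Y)) (b, c) =
        (\<Oplus>\<^bsub>LA\<^esub>d\<in>B. entry LA B (\<psi> LA ?X) (b, d) \<otimes>\<^bsub>LA\<^esub> entry LA B (\<psi> LA ?Y) (d, c))"
      using LM.entry_mact[OF LM.matrix_mult[OF LM.entry_closed[OF GLs(1)] LM.entry_closed[OF GLs(2)]] bc] by simp
    also have "\<dots> = (\<Oplus>\<^bsub>LA\<^esub>d\<in>B. \<phi> (lmat S (expo r ?d) e (b, d) * lmat S (expo r ?d') e (d, c)))"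
      by (intro LA.add.finprod_cong')
        (simp_all add: entry_psi[OF LA_k_algebra] bc M_lmat lev_point_lmat[OF finS])
    also have "\<dots> = \<phi> (\<Sum>d\<in>B. lmat S (expo r ?d) e (b, d) * lmat S (expo r ?d') e (d, c))"
      by (rule finsum_LA)
    also have "entry LA B (\<psi> LA (?X \<otimes>\<^bsub>Gm_power r LA\<^esub> ?Y)) (b, c) =
        \<phi> (lmat S (\<lambda>m. expo r ?d m + expo r ?d' m) e (b, c))"
      using bc unfolding point_mult
      by (simp add: entry_psi[OF LA_k_algebra] M_lmat lev_point_lmat[OF finS] expo_add)
    finally have eq: "lmat S (\<lambda>m. expo r ?d m + expo r ?d' m) e (b, c) =
        (\<Sum>d\<in>B. lmat S (expo r ?d) e (b, d) * lmat S (expo r ?d') e (d, c))" by simp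
    \<comment> \<open>The exponent of the monomial \<open>X^m Y^n\<close>. As the two blocks of
      indeterminates are disjoint it determines the pair \<open>(m, n)\<close>, and in
      \<open>\<psi> (X * Y)\<close> only the pairs with \<open>m = n\<close> occur.\<close>
    define N where "N = expo r ?d m + expo r ?d' n"
    have N: "expo r ?d m' + expo r ?d' n' = N \<longleftrightarrow> m' = m \<and> n' = n" if "m' \<in> S" "n' \<in> S" for m' n'
    proof
      assume *: "expo r ?d m' + expo r ?d' n' = N"
      have sh: "lookup (expo r ?d' k) i = (if i < r then 0 else if i < r + r then lookup k (i - r) else 0)" for k i
      proof (cases "i < r")
        case True
        then show ?thesis using lookup_expo_single_not_in[of i "\<lambda>i. r + i" r k] by auto
      next
        case False
        then show ?thesis using lookup_expo_single[of "\<lambda>i. r + i" r k "i - r"] by (auto simp: inj_def)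
      qed
      have l: "lookup (expo r ?d m' + expo r ?d' n') i = lookup (expo r ?d m + expo r ?d' n) i" for i
        using * by (simp add: N_def)
      have m0: "lookup k i = 0" if "k \<in> S" "\<not> i < r" for k i
        using that expo_r[of k i] expoS[of k] by simp
      have "lookup m' i = lookup m i" for i
      proof (cases "i < r")
        case True
        then show ?thesis using l[of i] by (simp add: lookup_add expo_r sh)
      qed (simp add: m0 that mn)
      moreover have "lookup n' i = lookup n i" for i
      proof (cases "i < r")
        case True
        then show ?thesis using l[of "r + i"] by (simp add: lookup_add expo_r sh)
      qed (simp add: m0 that mn)
      ultimately show "m' = m \<and> n' = n" by (auto intro: poly_mapping_eqI)
    qed (simp add: N_def)
    have "lookup (lmat S (\<lambda>m. expo r ?d m + expo r ?d' m) e (b, c)) N =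
        (\<Sum>m'\<in>S. if m' = m then if m = n then e m (b, c) else 0 else 0)"
      unfolding lmat_def lookup_sum lookup_single when_def by (intro sum.cong) (auto simp: N)
    also have "\<dots> = (if m = n then e m (b, c) else 0)" using mn finS by simp
    finally have "(if m = n then e m (b, c) else 0) =
        lookup (\<Sum>d\<in>B. lmat S (expo r ?d) e (b, d) * lmat S (expo r ?d') e (d, c)) N"
      by (simp only: eq)
    also have "\<dots> = (\<Sum>d\<in>B. \<Sum>m'\<in>S. \<Sum>n'\<in>S. if m' = m then if n' = n then e m (b, d) * e n (d, c) else 0 else 0)"
      unfolding lmat_def sum_product mult_single lookup_sum lookup_single when_def
      by (intro sum.cong refl) (auto simp: N)
    also have "\<dots> = (\<Sum>d\<in>B. e m (b, d) * e n (d, c))"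
    proof (intro sum.cong refl)
      fix d
      have "(\<Sum>m'\<in>S. \<Sum>n'\<in>S. if m' = m then if n' = n then e m (b, d) * e n (d, c) else 0 else 0) =
          (\<Sum>m'\<in>S. if m' = m then e m (b, d) * e n (d, c) else 0)"
        using mn finS by (intro sum.cong refl) simp
      then show "(\<Sum>m'\<in>S. \<Sum>n'\<in>S. if m' = m then if n' = n then e m (b, d) * e n (d, c) else 0 else 0) =
          e m (b, d) * e n (d, c)"
        using mn finS by simp
    qed
    finally show "(\<Sum>d\<in>B. e m (b, d) * e n (d, c)) = (if m = n then e m (b, c) else 0)"
      by (rule sym)
  next
    fix b c assume bc: "b \<in> B" "c \<in> B"
    interpret G: group_hom "Gm_power r LA" "GL B LA" "\<psi> LA"
      using hom[OF LA_k_algebra] LA.Gm_power_group LM.GL_group by (simp add: group_hom_def group_hom_axioms_def)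
    have o: "\<one>\<^bsub>Gm_power r LA\<^esub> \<in> carrier (Gm_power r LA)"
      using LA.Gm_power_closed(2)[OF point_closed point_closed] .
    \<comment> \<open>At the unit point every monomial becomes 1, so the sums of coefficients are
      the entries of the identity matrix.\<close>
    have "\<phi> (single 0 (\<Sum>m\<in>S. e m (b, c))) = lev LA r \<one>\<^bsub>Gm_power r LA\<^esub> (M (b, c))"
      by (simp add: M_lmat[OF bc] LA.lev_lmat[OF o finS] LA.monomial_one sm_LA finsum_LA single_sum del: LA_simps(4))
    also have "\<dots> = entry LA B \<one>\<^bsub>GL B LA\<^esub> (b, c)"
      using entry_psi[OF LA_k_algebra o bc] G.hom_one by simp
    also have "\<dots> = \<phi> (single 0 (if b = c then 1 else 0))"
      using bc by (simp add: LM.GL_one entry_def) (simp add: unit_vec_def)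
    finally show "(\<Sum>m\<in>S. e m (b, c)) = (if b = c then 1 else 0)"
      by (simp add: single_eq_iff del: single_one)
  qed (use B finS in auto)
  show thesis
  proof (rule that[OF idemp symS expoS])
    fix A :: "('k, 'u) module" and x assume A: "A \<in> k_algebras" and x: "x \<in> carrier (Gm_power r A)"
    interpret A: torus_point B S e A using idemp A by (rule idempotents_torus_point)
    show "\<psi> A x = tor B S id e r A x"
      unfolding psi[OF A x] tor_def
      by (intro A.mact_cong A.lev_matrix x) (simp add: M_lmat)
  qed
qed

end

section \<open>Closed subschemes\<close>

lemma entry_polys_add [intro]: "F \<in> entry_polys B \<Longrightarrow> G \<in> entry_polys B \<Longrightarrow> F + G \<in> entry_polys B"
  using Poly_Mapping.keys_add[of F G] by (auto simp: entry_polys_def)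

lemma entry_polys_diff [intro]:
  "F \<in> entry_polys B \<Longrightarrow> G \<in> entry_polys B \<Longrightarrow> F - (G :: _ \<Rightarrow>\<^sub>0 'k::field) \<in> entry_polys B"
proof -
  have "keys (F - G) \<subseteq> keys F \<union> keys G"
    by (auto simp: in_keys_iff lookup_minus)
  then show "F \<in> entry_polys B \<Longrightarrow> G \<in> entry_polys B \<Longrightarrow> F - G \<in> entry_polys B"
    unfolding entry_polys_def by blast
qed

lemma entry_polys_mult [intro]: "F \<in> entry_polys B \<Longrightarrow> G \<in> entry_polys B \<Longrightarrow> F * G \<in> entry_polys B"
proof -
  assume FG: "F \<in> entry_polys B" "G \<in> entry_polys B"
  have "keys m \<subseteq> B \<times> B" if m: "m \<in> keys (F * G)" for m
  proof -
    obtain a b where "a \<in> keys F" "b \<in> keys G" "m = a + b"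
      using keys_mult[of F G] m by blast
    then show ?thesis using FG Poly_Mapping.keys_add[of a b] unfolding entry_polys_def by blast
  qed
  then show ?thesis by (simp add: entry_polys_def)
qed

lemma entry_polys_single [intro]: "keys m \<subseteq> B \<times> B \<Longrightarrow> single m c \<in> entry_polys B"
  by (auto simp: entry_polys_def)

lemma entry_polys_one [intro]: "1 \<in> entry_polys B"
  by (auto simp: entry_polys_def)

lemma entry_polys_zero [intro]: "0 \<in> entry_polys B"
  by (auto simp: entry_polys_def)

lemma entry_polys_sum [intro]: "(\<And>i. i \<in> I \<Longrightarrow> F i \<in> entry_polys B) \<Longrightarrow> sum F I \<in> entry_polys B"
  by (induction I rule: infinite_finite_induct) auto

text \<open>Taking the product over all of \<open>B \<times> B\<close> rather than over the support
  makes it visibly multiplicative in \<open>m\<close>; \<open>eval_entries_eq\<close> compares the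
  two forms.\<close>

definition entry_monomial :: "'v set \<Rightarrow> ('k, 'u) module \<Rightarrow> (('v \<Rightarrow> 'u) \<Rightarrow> ('v \<Rightarrow> 'u)) \<Rightarrow> ('v \<times> 'v \<Rightarrow>\<^sub>0 nat) \<Rightarrow> 'u"
  where "entry_monomial B A g m = (\<Otimes>\<^bsub>A\<^esub>p\<in>B \<times> B. entry A B g p [^]\<^bsub>A\<^esub> lookup m p)"

abbreviation entry_var :: "'v \<Rightarrow> 'v \<Rightarrow> ('v \<times> 'v \<Rightarrow>\<^sub>0 nat) \<Rightarrow>\<^sub>0 'k::field"
  where "entry_var b c \<equiv> single (single (b, c) 1) 1"

context matrices
begin

lemma entry_in_carrier: "g \<in> carrier (GL B A) \<Longrightarrow> p \<in> B \<times> B \<Longrightarrow> entry A B g p \<in> carrier A"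
  using entry_closed by (auto simp: matrix_def)

lemma entry_monomial_evaluation:
  assumes g: "g \<in> carrier (GL B A)"
  shows "monomial_evaluation A (entry_monomial B A g)"
proof
  note cl = entry_in_carrier[OF g]
  show "entry_monomial B A g m \<in> carrier A" for m
    unfolding entry_monomial_def using cl by (intro finprod_closed) blast
  show "entry_monomial B A g 0 = \<one>"
    unfolding entry_monomial_def by (intro finprod_one_eqI) simp
  show "entry_monomial B A g (m + n) = entry_monomial B A g m \<otimes> entry_monomial B A g n" for m n
  proof -
    have "entry_monomial B A g (m + n) = (\<Otimes>p\<in>B \<times> B. entry A B g p [^] lookup m p \<otimes> entry A B g p [^] lookup n p)"
      unfolding entry_monomial_def
      by (intro finprod_cong' refl) (use cl in \<open>auto simp: lookup_add nat_pow_mult\<close>)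
    also have "\<dots> = entry_monomial B A g m \<otimes> entry_monomial B A g n"
      unfolding entry_monomial_def by (intro finprod_multf) (use cl in blast)+
    finally show ?thesis .
  qed
qed

lemma eval_entries_eq:
  assumes g: "g \<in> carrier (GL B A)" and F: "F \<in> entry_polys B"
  shows "eval_entries B A g F = ev A (entry_monomial B A g) F"
proof -
  interpret E: monomial_evaluation A "entry_monomial B A g" using g by (rule entry_monomial_evaluation)
  have "(\<Otimes>p\<in>keys m. entry A B g p [^] lookup m p) = entry_monomial B A g m"
    if "m \<in> keys F" for m
    unfolding entry_monomial_def
    by (rule finprod_mono_neutral_cong_left)
      (use F that entry_in_carrier[OF g] in \<open>auto simp: entry_polys_def in_keys_iff\<close>)
  then show ?thesis
    unfolding eval_entries_def ev_def
    by (intro add.finprod_cong') (auto simp: smult_eq)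
qed

lemma ev_entry_var:
  assumes g: "g \<in> carrier (GL B A)" and bc: "b \<in> B" "c \<in> B"
  shows "ev A (entry_monomial B A g) (entry_var b c) = entry A B g (b, c)"
proof -
  interpret E: monomial_evaluation A "entry_monomial B A g" using g by (rule entry_monomial_evaluation)
  have "entry_monomial B A g (single (b, c) 1) =
      (\<Otimes>p\<in>B \<times> B. if (b, c) = p then entry A B g p else \<one>)"
    unfolding entry_monomial_def using entry_in_carrier[OF g]
    by (intro finprod_cong') (auto simp: lookup_single when_def)
  also have "\<dots> = entry A B g (b, c)"
    using bc entry_in_carrier[OF g] by (intro finprod_singleton) auto
  finally show ?thesis using bc entry_in_carrier[OF g] by simp
qed

end


section \<open>The enlarged torus\<close>

text \<open>
  \<open>R\<close> consists of the weights that occur, the \<open>k i\<close> represent the nonzero ones up to sign, and \<open>w\<close>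
  replaces \<open>k i\<close> by the \<open>i\<close>-th coordinate character of the enlarged torus.
\<close>

locale enlarged_torus = symmetric_idempotents B S e
  for B :: "'v set" and S :: "(nat \<Rightarrow>\<^sub>0 int) set" and e :: "(nat \<Rightarrow>\<^sub>0 int) \<Rightarrow> 'v \<times> 'v \<Rightarrow> 'k::field" +
  fixes R :: "(nat \<Rightarrow>\<^sub>0 int) set" and s :: nat and k :: "nat \<Rightarrow> (nat \<Rightarrow>\<^sub>0 int)" and w :: "(nat \<Rightarrow>\<^sub>0 int) \<Rightarrow> (nat \<Rightarrow>\<^sub>0 int)"
  assumes R_def: "R = {m \<in> S. \<exists>b\<in>B. \<exists>c\<in>B. e m (b, c) \<noteq> 0}"
    and w_uminus: "\<And>m. w (- m) = - w m"
    and k_R: "\<And>i. i < s \<Longrightarrow> k i \<in> R" and w_k: "\<And>i. i < s \<Longrightarrow> w (k i) = single i 1"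
    and R_cases: "\<And>m. m \<in> R \<Longrightarrow> m = 0 \<or> (\<exists>i<s. m = k i) \<or> (\<exists>i<s. m = - k i)"
begin

lemma w_zero [simp]: "w 0 = 0"
proof -
  have "w 0 = - w 0" using w_uminus[of 0] by simp
  then have "lookup (w 0) i = - lookup (w 0) i" for i
    by (metis lookup_uminus)
  then show ?thesis by (intro poly_mapping_eqI) simp
qed

lemma R_subset: "R \<subseteq> S" and finite_R [simp]: "finite R"
  using finite_L by (auto simp: R_def)

lemma e_not_R: "m \<in> S \<Longrightarrow> m \<notin> R \<Longrightarrow> b \<in> B \<Longrightarrow> c \<in> B \<Longrightarrow> e m (b, c) = 0"
  by (auto simp: R_def)

text \<open>The position of some nonzero entry of the projection; dividing by this entry normalizes
  \<open>coeff_poly\<close>.\<close>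

definition pos :: "(nat \<Rightarrow>\<^sub>0 int) \<Rightarrow> 'v \<times> 'v"
  where "pos m = (SOME p. p \<in> B \<times> B \<and> e m p \<noteq> 0)"

lemma pos: "m \<in> R \<Longrightarrow> fst (pos m) \<in> B" "m \<in> R \<Longrightarrow> snd (pos m) \<in> B" "m \<in> R \<Longrightarrow> e m (fst (pos m), snd (pos m)) \<noteq> 0"
proof -
  assume "m \<in> R"
  then have "\<exists>p. p \<in> B \<times> B \<and> e m p \<noteq> 0" unfolding R_def by blast
  from someI_ex[OF this] show "fst (pos m) \<in> B" "snd (pos m) \<in> B" "e m (fst (pos m), snd (pos m)) \<noteq> 0"
    by (auto simp: pos_def)
qed

text \<open>On a combination \<open>\<Sum>\<^sub>n t\<^sub>n e\<^sub>n\<close> this linear polynomial takes the value \<open>t\<^sub>m\<close>.\<close>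

definition coeff_poly :: "(nat \<Rightarrow>\<^sub>0 int) \<Rightarrow> ('v \<times> 'v \<Rightarrow>\<^sub>0 nat) \<Rightarrow>\<^sub>0 'k"
  where "coeff_poly m = (\<Sum>d\<in>B. single 0 (inverse (e m (pos m)) * e m (fst (pos m), d)) * entry_var d (snd (pos m)))"

definition combination_poly :: "'v \<times> 'v \<Rightarrow> ('v \<times> 'v \<Rightarrow>\<^sub>0 nat) \<Rightarrow>\<^sub>0 'k"
  where "combination_poly p = (\<Sum>m\<in>R. single 0 (e m p) * coeff_poly m)"

text \<open>The matrix is the combination of projections given by its own weight coordinates,
  coordinates of opposite weights are inverse to each other, and the coordinate of weight 0 is 1.
  That a coordinate whose opposite does not occur is a unit follows from invertibility in
  \<open>GL B A\<close>.\<close>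

definition torus_equations :: "(('v \<times> 'v \<Rightarrow>\<^sub>0 nat) \<Rightarrow>\<^sub>0 'k) set"
  where "torus_equations = (\<lambda>p. entry_var (fst p) (snd p) - combination_poly p) ` (B \<times> B) \<union>
    (\<lambda>m. coeff_poly m * coeff_poly (- m) - 1) ` {m \<in> R. - m \<in> R} \<union>
    (\<lambda>m. coeff_poly m - 1) ` (R \<inter> {0})"

lemma coeff_poly_in: "m \<in> R \<Longrightarrow> coeff_poly m \<in> entry_polys B"
  unfolding coeff_poly_def using pos by (intro entry_polys_sum entry_polys_mult entry_polys_single) auto

lemma combination_poly_in: "combination_poly p \<in> entry_polys B"
  unfolding combination_poly_def by (intro entry_polys_sum entry_polys_mult entry_polys_single coeff_poly_in) auto

lemma entry_var_in: "b \<in> B \<Longrightarrow> c \<in> B \<Longrightarrow> entry_var b c \<in> entry_polys B"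
  by (intro entry_polys_single) auto

lemma torus_equations_in: "torus_equations \<subseteq> entry_polys B"
  unfolding torus_equations_def
  by (auto intro!: entry_polys_diff entry_polys_mult coeff_poly_in combination_poly_in entry_var_in entry_polys_one)

text \<open>A column of \<open>e m\<close> is an eigenvector of any combination of the projections,
  with eigenvalue the coordinate at \<open>m\<close>. This serves to prove that the coordinate is a
  unit.\<close>

lemma combination_poly_column:
  assumes m: "m \<in> R" and bc: "b \<in> B" "c \<in> B"
  shows "(\<Sum>d\<in>B. combination_poly (b, d) * single 0 (e m (d, c))) =
    single 0 (e m (b, c)) * coeff_poly m"
proof -
  have "(\<Sum>d\<in>B. combination_poly (b, d) * single 0 (e m (d, c))) =
      (\<Sum>d\<in>B. \<Sum>n\<in>R. single 0 (e n (b, d) * e m (d, c)) * coeff_poly n)"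
    unfolding combination_poly_def sum_distrib_right
    by (intro sum.cong refl)
      (simp only: mult.assoc mult.commute[of "coeff_poly _" "single 0 _"],
        simp only: mult.assoc[symmetric] mult_single add_0)
  also have "\<dots> = (\<Sum>n\<in>R. single 0 (\<Sum>d\<in>B. e n (b, d) * e m (d, c)) * coeff_poly n)"
    by (subst sum.swap) (simp add: single_sum sum_distrib_right)
  also have "\<dots> = (\<Sum>n\<in>R. if n = m then single 0 (e m (b, c)) * coeff_poly m else 0)"
    using m bc R_subset by (intro sum.cong refl) (auto simp: orthogonal subset_iff)
  also have "\<dots> = single 0 (e m (b, c)) * coeff_poly m"
    using m by simp
  finally show ?thesis .
qed

end

locale enlarged_torus_point = enlarged_torus B S e R s k w + k_algebra A
  for B :: "'v set" and S and e :: "_ \<Rightarrow> 'v \<times> 'v \<Rightarrow> 'k::field" and R s k w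
    and A :: "('k, 'u) module" (structure)
begin

sublocale torus_point B S e A by unfold_locales

abbreviation \<tau> where "\<tau> g m \<equiv> ev A (entry_monomial B A g) (coeff_poly m)"

lemma lev_R:
  assumes x: "x \<in> carrier (Gm_power r A)" and bc: "b \<in> B" "c \<in> B"
  shows "lev A r x (lmat S v e (b, c)) = (\<Oplus>m\<in>R. structure_map A (e m (b, c)) \<otimes> monomial A r x (v m))"
  unfolding lev_lmat[OF x finite_L]
  by (rule add.finprod_mono_neutral_cong_right)
    (use R_subset bc e_not_R Units_closed[OF monomial_unit[OF x]] in auto)

text \<open>Multiplication by \<open>e m\<close> isolates the term of \<open>m\<close> in a
  combination of the projections; \<open>coeff_poly m\<close> is the entry of that product at
  \<open>pos m\<close>, divided by the entry of \<open>e m\<close> there.\<close>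

lemma coeff_tor:
  assumes x: "x \<in> carrier (Gm_power r A)" and m: "m \<in> R"
  shows "\<tau> (tor B S v e r A x) m = monomial A r x (v m)"
proof -
  let ?g = "tor B S v e r A x"
  have g: "?g \<in> carrier (GL B A)" using x by (rule tor_GL)
  interpret E: monomial_evaluation A "entry_monomial B A ?g" using g by (rule entry_monomial_evaluation)
  interpret M: monomial_evaluation A "monomial A r x" using x by (rule monomial_evaluation_monomial)
  obtain b c where p: "pos m = (b, c)" by (cases "pos m")
  have bc: "b \<in> B" "c \<in> B" "e m (b, c) \<noteq> 0" using pos[OF m] by (simp_all add: p)
  have mS: "m \<in> S" using m R_subset by auto
  have "\<tau> ?g m = (\<Oplus>d\<in>B. ev A (monomial A r x) (single 0 (inverse (e m (b, c)) * e m (b, d)) * lmat S v e (d, c)))"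
    unfolding coeff_poly_def p fst_conv snd_conv E.ev_sum[OF finite_B]
    by (intro add.finprod_cong' refl)
      (use bc in \<open>auto simp add: ev_entry_var[OF g] entry_tor[OF x] lev_def simp del: E.ev_single M.ev_single One_nat_def, simp\<close>)
  also have "\<dots> = ev A (monomial A r x) (\<Sum>d\<in>B. single 0 (inverse (e m (b, c)) * e m (b, d)) * lmat S v e (d, c))"
    by (rule M.ev_sum[OF finite_B, symmetric])
  also have "(\<Sum>d\<in>B. single 0 (inverse (e m (b, c)) * e m (b, d)) * lmat S v e (d, c)) =
      (\<Sum>n\<in>S. single (v n) (inverse (e m (b, c)) * (\<Sum>d\<in>B. e m (b, d) * e n (d, c))))"
    unfolding lmat_def
    by (simp add: sum_distrib_left mult_single single_sum mult.assoc) (rule sum.swap)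
  also have "\<dots> = (\<Sum>n\<in>S. if m = n then single (v m) 1 else 0)"
    using mS bc by (intro sum.cong refl) (auto simp: orthogonal)
  also have "\<dots> = single (v m) 1" using mS by simp
  finally show ?thesis by simp
qed

lemma tor_satisfies_equations:
  assumes x: "x \<in> carrier (Gm_power s A)" and F: "F \<in> torus_equations"
  shows "eval_entries B A (tor B S w e s A x) F = \<zero>"
proof -
  let ?g = "tor B S w e s A x"
  have g: "?g \<in> carrier (GL B A)" using x by (rule tor_GL)
  interpret E: monomial_evaluation A "entry_monomial B A ?g" using g by (rule entry_monomial_evaluation)
  have diff: "ev A (entry_monomial B A ?g) (F - G) = \<zero>"
    if "ev A (entry_monomial B A ?g) F = ev A (entry_monomial B A ?g) G" for F G
    unfolding diff_conv_add_uminus[of F G] using that by (simp add: r_neg del: add_uminus_conv_diff)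
  have "ev A (entry_monomial B A ?g) F = \<zero>"
    using F unfolding torus_equations_def
  proof (elim UnE imageE; clarify)
    fix b c assume bc: "b \<in> B" "c \<in> B"
    have "ev A (entry_monomial B A ?g) (combination_poly (b, c)) = lev A s x (lmat S w e (b, c))"
      unfolding combination_poly_def lev_R[OF x bc] E.ev_sum[OF finite_R] E.ev_mult
      by (intro add.finprod_cong') (use x in \<open>auto simp: coeff_tor intro: Units_closed\<close>)
    then have "ev A (entry_monomial B A ?g) (entry_var b c) = ev A (entry_monomial B A ?g) (combination_poly (b, c))"
      unfolding ev_entry_var[OF g bc] entry_tor[OF x bc] ..
    from diff[OF this] show "ev A (entry_monomial B A ?g) (entry_var (fst (b, c)) (snd (b, c)) - combination_poly (b, c)) = \<zero>"
      by simp
  next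
    fix m assume "m \<in> R" "- m \<in> R"
    then show "ev A (entry_monomial B A ?g) (coeff_poly m * coeff_poly (- m) - 1) = \<zero>"
      using monomial_uminus[OF x, of "- w m"] by (intro diff) (simp add: coeff_tor[OF x] w_uminus)
  next
    assume "0 \<in> R"
    then show "ev A (entry_monomial B A ?g) (coeff_poly 0 - 1) = \<zero>"
      by (intro diff) (simp add: coeff_tor[OF x])
  qed
  then show ?thesis
    using eval_entries_eq[OF g] F torus_equations_in by auto
qed

text \<open>The point of the torus is made of the weight coordinates of \<open>g\<close> at the
  representatives \<open>k i\<close>; the equations determine the other coordinates.\<close>

lemma solution_in_tor:
  assumes g: "g \<in> carrier (GL B A)" and eqs: "\<And>F. F \<in> torus_equations \<Longrightarrow> eval_entries B A g F = \<zero>"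
  shows "g \<in> tor B S w e s A ` carrier (Gm_power s A)"
proof -
  interpret E: monomial_evaluation A "entry_monomial B A g" using g by (rule entry_monomial_evaluation)
  have eq: "ev A (entry_monomial B A g) F = ev A (entry_monomial B A g) G" if "F - G \<in> torus_equations" for F G
  proof -
    have "ev A (entry_monomial B A g) (F - G) = \<zero>"
      using eqs[OF that] eval_entries_eq[OF g] that torus_equations_in by auto
    then have "ev A (entry_monomial B A g) (F - G + G) = ev A (entry_monomial B A g) G"
      unfolding E.ev_add by simp
    then show ?thesis by simp
  qed
  have entry: "entry A B g (b, c) = ev A (entry_monomial B A g) (combination_poly (b, c))" if "b \<in> B" "c \<in> B" for b c
    using eq[of "entry_var b c" "combination_poly (b, c)"] that
    unfolding ev_entry_var[OF g that, symmetric] torus_equations_def by force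
  have tau_neg: "\<tau> g m \<otimes> \<tau> g (- m) = \<one>" if "m \<in> R" "- m \<in> R" for m
    using eq[of "coeff_poly m * coeff_poly (- m)" 1] that by (simp add: torus_equations_def)
  have tau_0: "\<tau> g 0 = \<one>" if "0 \<in> R"
    using eq[of "coeff_poly 0" 1] that by (simp add: torus_equations_def)
  \<comment> \<open>\<open>g\<close> multiplies a column \<open>u\<close> of \<open>e m\<close> by
    the coordinate, so \<open>u\<close> is that coordinate times the preimage of \<open>u\<close>
    under \<open>g\<close>. One entry of \<open>u\<close> is a nonzero constant, so the coordinate
    divides a unit.\<close>
  have unit: "\<tau> g m \<in> Units A" if m: "m \<in> R" for m
  proof -
    interpret GLg: group "GL B A" by (rule GL_group)
    obtain b c where p: "pos m = (b, c)" by (cases "pos m")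
    have bc: "b \<in> B" "c \<in> B" "e m (b, c) \<noteq> 0" using pos[OF m] by (simp_all add: p)
    define u where "u = (\<lambda>b\<in>B. structure_map A (e m (b, c)))"
    have u: "u \<in> carrier E" by (auto simp: u_def)
    have "g u = \<tau> g m \<odot>\<^bsub>E\<^esub> u"
    proof (rule ext_module_eqI)
      fix b' assume b': "b' \<in> B"
      have "g u b' = (\<Oplus>d\<in>B. ev A (entry_monomial B A g) (combination_poly (b', d)) \<otimes> ev A (entry_monomial B A g) (single 0 (e m (d, c))))"
        by (subst GL_eq_mact[OF g], unfold mact_apply[OF u b'], intro add.finprod_cong' refl)
          (use b' in \<open>auto simp: entry u_def\<close>)
      also have "\<dots> = ev A (entry_monomial B A g) (\<Sum>d\<in>B. combination_poly (b', d) * single 0 (e m (d, c)))"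
        by (rule matrix_product_ev[OF E.monomial_evaluation_axioms])
      also have "\<dots> = structure_map A (e m (b', c)) \<otimes> \<tau> g m"
        unfolding combination_poly_column[OF m b' bc(2)] by simp
      finally show "g u b' = (\<tau> g m \<odot>\<^bsub>E\<^esub> u) b'"
        using b' by (simp add: u_def m_comm)
    qed (use u g GL_carrierD(4) in auto)
    moreover have ig: "inv\<^bsub>GL B A\<^esub> g \<in> carrier (GL B A)" using g by simp
    moreover have "(inv\<^bsub>GL B A\<^esub> g) (g u) = u"
    proof -
      have "compose (carrier E) (inv\<^bsub>GL B A\<^esub> g) g u = (\<lambda>x\<in>carrier E. x) u"
        using GLg.l_inv[OF g] GL_mult[OF ig g] GL_one by metis
      then show ?thesis using u by (simp add: compose_def)
    qed
    ultimately have "u = \<tau> g m \<odot>\<^bsub>E\<^esub> (inv\<^bsub>GL B A\<^esub> g) u"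
      using GL_carrierD(3)[OF ig E.ev_closed u] by simp
    then have "u b = \<tau> g m \<otimes> (inv\<^bsub>GL B A\<^esub> g) u b"
      using bc smult_E_apply by metis
    then have "\<tau> g m \<otimes> (inv\<^bsub>GL B A\<^esub> g) u b \<in> Units A"
      using bc sm_unit[OF bc(3)] by (simp add: u_def)
    then show ?thesis
      by (rule unit_factor) (use GL_carrierD(4)[OF ig u] bc in auto)
  qed
  define x where "x = (\<lambda>i\<in>{..<s}. \<tau> g (k i))"
  have x: "x \<in> carrier (Gm_power s A)"
    using unit k_R by (auto simp: x_def carrier_Gm_power)
  have mono: "monomial A s x (w m) = \<tau> g m" if m: "m \<in> R" for m
    using R_cases[OF m]
  proof (elim disjE exE conjE)
    assume "m = 0" then show ?thesis using tau_0 m by simp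
  next
    fix i assume "i < s" "m = k i"
    then show ?thesis by (simp add: w_k monomial_single[OF x]) (simp add: x_def)
  next
    \<comment> \<open>Both sides are inverse to the coordinate at \<open>k i\<close>, one by the law
      of monomials and the other by the equation for opposite weights.\<close>
    fix i assume i: "i < s" and mk: "m = - k i"
    have xi: "monomial A s x (w (k i)) = \<tau> g (k i)"
      using i by (simp add: w_k monomial_single[OF x]) (simp add: x_def)
    have "monomial A s x (w m) \<otimes> \<tau> g (k i) = \<one>"
      unfolding mk w_uminus xi[symmetric] by (rule monomial_uminus[OF x])
    moreover have "\<tau> g m \<otimes> \<tau> g (k i) = \<one>"
      using tau_neg[of "k i"] k_R[OF i] m mk by (simp add: m_comm)
    ultimately show ?thesis
      using unit[OF k_R[OF i]] x by (metis E.ev_closed Units_closed inv_unique' monomial_unit m_comm)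
  qed
  have "tor B S w e s A x = mact B A (entry A B g)"
    unfolding tor_def
  proof (rule mact_cong[OF _ entry_closed[OF g]])
    fix b c assume bc: "b \<in> B" "c \<in> B"
    show "lev A s x (lmat S w e (b, c)) = entry A B g (b, c)"
      unfolding lev_R[OF x bc] entry[OF bc] combination_poly_def E.ev_sum[OF finite_R] E.ev_mult
      by (intro add.finprod_cong') (auto simp: mono)
  qed
  then show ?thesis using GL_eq_mact[OF g] x by auto
qed

text \<open>The polynomials \<open>coeff_poly (k i)\<close> recover the coordinates of the point
  from its matrix.\<close>

lemma tor_inj: "inj_on (tor B S w e s A) (carrier (Gm_power s A))"
proof (rule inj_onI)
  fix x y assume x: "x \<in> carrier (Gm_power s A)" and y: "y \<in> carrier (Gm_power s A)"
    and eq: "tor B S w e s A x = tor B S w e s A y"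
  have "x i = y i" if "i < s" for i
    using coeff_tor[OF x k_R[OF that], of w] coeff_tor[OF y k_R[OF that], of w] eq that
    by (simp add: w_k monomial_single[OF x] monomial_single[OF y])
  then show "x = y"
    using x y unfolding carrier_Gm_power by (intro PiE_ext) auto
qed

text \<open>The point \<open>x\<close> of the original torus corresponds to the point whose
  \<open>i\<close>-th coordinate is the value at \<open>x\<close> of the weight
  \<open>k i\<close>.\<close>

lemma tor_id_in_tor:
  assumes x: "x \<in> carrier (Gm_power r A)"
  shows "tor B S id e r A x \<in> tor B S w e s A ` carrier (Gm_power s A)"
proof -
  define y where "y = (\<lambda>i\<in>{..<s}. monomial A r x (k i))"
  have y: "y \<in> carrier (Gm_power s A)"
    using x by (auto simp: y_def carrier_Gm_power)
  have mono: "monomial A s y (w m) = monomial A r x m" if m: "m \<in> R" for m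
    using R_cases[OF m]
  proof (elim disjE exE conjE)
    fix i assume "i < s" "m = k i"
    then show ?thesis by (simp add: w_k monomial_single[OF y]) (simp add: y_def)
  next
    fix i assume i: "i < s" and mk: "m = - k i"
    have yi: "monomial A s y (w (k i)) = monomial A r x (k i)"
      using i by (simp add: w_k monomial_single[OF y]) (simp add: y_def)
    have "monomial A s y (w m) \<otimes> monomial A r x (k i) = \<one>"
      unfolding mk w_uminus yi[symmetric] by (rule monomial_uminus[OF y])
    moreover have "monomial A r x m \<otimes> monomial A r x (k i) = \<one>"
      unfolding mk by (rule monomial_uminus[OF x])
    ultimately show ?thesis
      using x y by (metis Units_closed inv_unique' monomial_unit m_comm)
  qed simp
  have "tor B S w e s A y = tor B S id e r A x"
    unfolding tor_def
  proof (rule mact_cong[OF _ lev_matrix[OF x]])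
    fix b c assume bc: "b \<in> B" "c \<in> B"
    show "lev A s y (lmat S w e (b, c)) = lev A r x (lmat S id e (b, c))"
      unfolding lev_R[OF x bc] lev_R[OF y bc]
      by (intro add.finprod_cong') (use x in \<open>auto simp: mono intro: Units_closed\<close>)
  qed
  then show ?thesis using y by (metis image_eqI)
qed

lemma tor_image_subgroup: "subgroup (tor B S w e s A ` carrier (Gm_power s A)) (GL B A)"
proof -
  interpret group_hom "Gm_power s A" "GL B A" "tor B S w e s A"
    using tor_hom Gm_power_group GL_group by (simp add: group_hom_def group_hom_axioms_def)
  show ?thesis by (rule img_is_subgroup)
qed

lemma tor_iso:
  "tor B S w e s A \<in> iso (Gm_power s A) (points B (\<lambda>A. tor B S w e s A ` carrier (Gm_power s A)) A)"
  using tor_inj tor_hom by (auto simp: iso_def hom_def bij_betw_def points_def)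

end

context enlarged_torus
begin

lemma point_locale: "A \<in> k_algebras \<Longrightarrow> enlarged_torus_point B S e R s k w A"
  by (simp add: enlarged_torus_point_def enlarged_torus_axioms k_algebra_iff)

lemma subtorus_tor:
  "subtorus B (\<lambda>A :: ('k, 'u) module. tor B S w e s A ` carrier (Gm_power s A))"
  unfolding subtorus_def closed_subgroup_scheme_def
proof (intro conjI exI[of _ torus_equations] exI[of _ s] exI[of _ "tor B S w e s"] ballI torus_equations_in)
  fix A :: "('k, 'u) module" assume A: "A \<in> k_algebras"
  interpret enlarged_torus_point B S e R s k w A using A by (rule point_locale)
  show "subgroup (tor B S w e s A ` carrier (Gm_power s A)) (GL B A)"
    by (rule tor_image_subgroup)
  show "tor B S w e s A ` carrier (Gm_power s A) =
      {g \<in> carrier (GL B A). \<forall>F\<in>torus_equations. eval_entries B A g F = \<zero>\<^bsub>A\<^esub>}"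
    using solution_in_tor tor_satisfies_equations tor_GL by blast
  show "tor B S w e s A \<in> iso (Gm_power s A) (points B (\<lambda>A. tor B S w e s A ` carrier (Gm_power s A)) A)"
    by (rule tor_iso)
  fix A' :: "('k, 'u) module" and h x
  assume "A' \<in> k_algebras" "h \<in> algebra_hom A A'" "x \<in> carrier (Gm_power s A)"
  then show "tor B S w e s A' (\<lambda>i\<in>{..<s}. h (x i)) = base_change B A A' h (tor B S w e s A x)"
    by (simp add: base_change_tor)
qed

end

lemma enlarged_torus_exists:
  fixes e :: "(nat \<Rightarrow>\<^sub>0 int) \<Rightarrow> 'v \<times> 'v \<Rightarrow> 'k::field"
  assumes "symmetric_idempotents B S e"
  obtains R s k w where "enlarged_torus B S e R s k w" "inj_on k {..<s}"
proof -
  interpret symmetric_idempotents B S e by fact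
  define R where "R = {m \<in> S. \<exists>b\<in>B. \<exists>c\<in>B. e m (b, c) \<noteq> 0}"
  \<comment> \<open>The linear order on exponents selects one member of each pair of opposite
    nonzero weights; a negative weight is taken only if its opposite does not occur.\<close>
  define P where "P = {m \<in> R. 0 < m \<or> (m < 0 \<and> - m \<notin> R)}"
  have "finite P" by (auto simp: P_def R_def)
  then obtain k where k: "bij_betw k {..<card P} P"
    using ex_bij_betw_nat_finite[of P] by (auto simp: atLeast0LessThan)
  define s where "s = card P"
  have neg: "- m \<notin> P" "m \<noteq> 0" if "m \<in> P" for m
    using that by (auto simp: P_def)
  \<comment> \<open>The value 0 away from \<open>P\<close> and its opposites makes \<open>w\<close>
    odd on all exponents.\<close>
  define w where "w m = (if m \<in> P then single (inv_into {..<s} k m) 1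
      else if - m \<in> P then - single (inv_into {..<s} k (- m)) (1::int) else 0)" for m
  have kP: "k i \<in> P" if "i < s" for i
    using k that by (auto simp: s_def bij_betw_def)
  have kinj: "inj_on k {..<s}" using k by (simp add: s_def bij_betw_def)
  have ex: "\<exists>i<s. k i = m" if "m \<in> P" for m
    using k that unfolding s_def bij_betw_def by (metis imageE lessThan_iff)
  have "enlarged_torus B S e R s k w"
  proof
    show "R = {m \<in> S. \<exists>b\<in>B. \<exists>c\<in>B. e m (b, c) \<noteq> 0}" by (rule R_def)
    show "w (- m) = - w m" for m
      using neg[of m] neg[of "- m"] by (auto simp: w_def)
    show "k i \<in> R" if "i < s" for i using kP[OF that] by (simp add: P_def)
    show "w (k i) = single i 1" if "i < s" for i
      using kP[OF that] kinj that by (simp add: w_def)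
    show "m = 0 \<or> (\<exists>i<s. m = k i) \<or> (\<exists>i<s. m = - k i)" if "m \<in> R" for m
    proof (cases "m \<in> P")
      case True
      then show ?thesis using ex by metis
    next
      case False
      show ?thesis
      proof (cases "m = 0")
        case False
        then have "- m \<in> P" using \<open>m \<notin> P\<close> that by (auto simp: P_def)
        then obtain i where "i < s" "k i = - m" using ex by blast
        then show ?thesis by (metis minus_minus)
      qed simp
    qed
  qed
  then show thesis using kinj by (rule that)
qed

section \<open>Fixed vectors and tensors\<close>

lemma (in k_algebra) lev_fixed_iff:
  assumes "finite P" "x \<in> carrier (Gm_power s A)"
  shows "(\<Oplus>q\<in>P. lev A s x (F q) \<otimes> structure_map A (\<tau> q)) =
    lev A s x (\<Sum>q\<in>P. F q * single 0 (\<tau> q))"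
proof -
  interpret E: monomial_evaluation A "monomial A s x" using assms(2) by (rule monomial_evaluation_monomial)
  show ?thesis unfolding lev_def by (simp add: E.ev_sum assms(1))
qed

lemma (in k_algebra) lev_const:
  assumes "x \<in> carrier (Gm_power s A)"
  shows "lev A s x (single 0 c) = structure_map A c"
proof -
  interpret E: monomial_evaluation A "monomial A s x" using assms by (rule monomial_evaluation_monomial)
  show ?thesis unfolding lev_def by simp
qed

lemma (in k_algebra) lev_closed [intro, simp]: "x \<in> carrier (Gm_power s A) \<Longrightarrow> lev A s x F \<in> carrier A"
  unfolding lev_def by (intro monomial_evaluation.ev_closed monomial_evaluation_monomial)

context torus_point
begin

lemma tor_apply_ext:
  assumes "x \<in> carrier (Gm_power s A)" "b \<in> B"
  shows "tor B S v e s A x (\<lambda>b\<in>B. structure_map A (\<tau> b)) b =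
    lev A s x (\<Sum>c\<in>B. lmat S v e (b, c) * single 0 (\<tau> c))"
proof -
  have "tor B S v e s A x (\<lambda>b\<in>B. structure_map A (\<tau> b)) b =
      (\<Oplus>c\<in>B. lev A s x (lmat S v e (b, c)) \<otimes> structure_map A (\<tau> c))"
    unfolding tor_def by (subst mact_apply) (use assms in \<open>auto intro!: add.finprod_cong'\<close>)
  then show ?thesis by (simp only: lev_fixed_iff[OF finite_P assms(1)])
qed

lemma tor_closed: "x \<in> carrier (Gm_power s A) \<Longrightarrow> y \<in> carrier E \<Longrightarrow> tor B S v e s A x y \<in> carrier E"
  using GL_carrierD(4)[OF tor_GL] .

lemma tor_fixes_vector_iff:
  assumes x: "x \<in> carrier (Gm_power s A)"
  shows "tor B S v e s A x (\<lambda>b\<in>B. structure_map A (\<tau> b)) = (\<lambda>b\<in>B. structure_map A (\<tau> b)) \<longleftrightarrow>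
    (\<forall>b\<in>B. lev A s x (\<Sum>c\<in>B. lmat S v e (b, c) * single 0 (\<tau> c)) =
       lev A s x (single 0 (\<tau> b)))" (is "?l \<longleftrightarrow> ?r")
proof
  assume ?l
  then have "tor B S v e s A x (\<lambda>b\<in>B. structure_map A (\<tau> b)) b = structure_map A (\<tau> b)" if "b \<in> B" for b
    using that by simp
  then show ?r by (simp add: tor_apply_ext[OF x] lev_const[OF x])
next
  assume ?r
  have u: "(\<lambda>b\<in>B. structure_map A (\<tau> b)) \<in> carrier E" by auto
  show ?l
    by (rule ext_module_eqI[OF tor_closed[OF x u] u])
      (use \<open>?r\<close> in \<open>simp add: tor_apply_ext[OF x] lev_const[OF x]\<close>)
qed

text \<open>For the tensor family on \<open>B \<times> B\<close> a fixed tensor is a fixed vector,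
  so the criterion takes the shape that \<open>fixed_transfer\<close> expects.\<close>

lemma tor_fixes_tensor_iff:
  assumes f: "idempotents B S f" and x: "x \<in> carrier (Gm_power s A)"
    and t: "t = (\<lambda>(b, c) \<in> B \<times> B. structure_map A (\<tau> (b, c)))"
  shows "tensor_action B A (tor B S v e s A x) (tor B S v f s A x) t = t \<longleftrightarrow>
    (\<forall>p\<in>B \<times> B. lev A s x (\<Sum>q\<in>B \<times> B. lmat (S \<times> S) (\<lambda>l. v (fst l) + v (snd l)) (tensor_family e f) (p, q) *
        single 0 (\<tau> q)) = lev A s x (single 0 (\<tau> p)))" (is "?l \<longleftrightarrow> ?r")
proof -
  interpret f: torus_point B S f A by (rule idempotents_torus_point[OF f is_k_algebra])
  interpret X: monomial_evaluation A "monomial A s x" using x by (rule monomial_evaluation_monomial)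
  have *: "tensor_action B A (tor B S v e s A x) (tor B S v f s A x) t (b, c) =
      lev A s x (\<Sum>q\<in>B \<times> B. lmat (S \<times> S) (\<lambda>l. v (fst l) + v (snd l)) (tensor_family e f) ((b, c), q) *
        single 0 (\<tau> q))" if bc: "b \<in> B" "c \<in> B" for b c
  proof -
    have "tensor_action B A (tor B S v e s A x) (tor B S v f s A x) t (b, c) =
      (\<Oplus>q\<in>B \<times> B. lev A s x (lmat (S \<times> S) (\<lambda>l. v (fst l) + v (snd l)) (tensor_family e f) ((b, c), q)) \<otimes> structure_map A (\<tau> q))"
      unfolding tensor_action_def
      by (simp add: bc)
        (intro add.finprod_cong' refl;
          use bc x in \<open>auto simp: entry_tor f.entry_tor lmat_tensor t lev_def\<close>)
    then show ?thesis by (simp only: lev_fixed_iff[OF finite_cartesian_product[OF finite_P finite_P] x])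
  qed
  have ext: "tensor_action B A (tor B S v e s A x) (tor B S v f s A x) t \<in> extensional (B \<times> B)" "t \<in> extensional (B \<times> B)"
    unfolding tensor_action_def t by (rule restrict_extensional)+
  have tp: "t (b, c) = lev A s x (single 0 (\<tau> (b, c)))" if "b \<in> B" "c \<in> B" for b c
    using that by (simp add: t lev_const[OF x])
  show ?thesis
  proof
    assume l: ?l
    show ?r
    proof
      fix p assume "p \<in> B \<times> B"
      then obtain b c where p: "p = (b, c)" and bc: "b \<in> B" "c \<in> B" by blast
      show "lev A s x (\<Sum>q\<in>B \<times> B. lmat (S \<times> S) (\<lambda>l. v (fst l) + v (snd l)) (tensor_family e f) (p, q) *
          single 0 (\<tau> q)) = lev A s x (single 0 (\<tau> p))"
        unfolding p *[OF bc, symmetric] tp[OF bc, symmetric] l ..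
    qed
  next
    assume ?r
    show ?l
    proof (rule extensionalityI[OF ext])
      fix p assume "p \<in> B \<times> B"
      then obtain b c where p: "p = (b, c)" and bc: "b \<in> B" "c \<in> B" by blast
      show "tensor_action B A (tor B S v e s A x) (tor B S v f s A x) t p = t p"
        unfolding p *[OF bc] tp[OF bc] using \<open>?r\<close> bc by blast
    qed
  qed
qed

end

definition odd_weight :: "(nat \<Rightarrow>\<^sub>0 int) set \<Rightarrow> ((nat \<Rightarrow>\<^sub>0 int) \<Rightarrow> (nat \<Rightarrow>\<^sub>0 int)) \<Rightarrow> bool"
  where "odd_weight S w \<longleftrightarrow> (\<forall>m\<in>S. - m \<in> S \<and> w (- m) = - w m)"

text \<open>The inverse negates the weights and the transpose passes to the dual; for odd
  \<open>w\<close> the two together give the same weights on \<open>dual_family e\<close>.\<close>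

lemma (in torus_point) contragredient_tor:
  assumes x: "x \<in> carrier (Gm_power s A)" and w: "odd_weight S w"
  shows "contragredient B A (tor B S w e s A x) = tor B S w (dual_family e) s A x"
proof -
  have sym: "\<And>m. m \<in> S \<Longrightarrow> - m \<in> S" and odd: "\<And>m. m \<in> S \<Longrightarrow> w (- m) = - w m"
    using w by (auto simp: odd_weight_def)
  have ld: "lmat S w (dual_family e) (p, q) = lmat S (\<lambda>m. - w m) e (q, p)" for p q
    by (rule lmat_dual) (use sym odd in auto)
  have "contragredient B A (tor B S w e s A x) = mact B A (\<lambda>(b, c). entry A B (inv\<^bsub>GL B A\<^esub> (tor B S w e s A x)) (c, b))"
  proof -
    have cl: "entry A B (tor B S (\<lambda>m. - w m) e s A x) (c, b) \<in> carrier A" if "b \<in> B" "c \<in> B" for b c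
      using x that by (simp add: entry_tor)
    show ?thesis
      unfolding contragredient_def mact_def tor_inv[OF x]
      by (intro restrict_ext add.finprod_cong' refl)
        (use cl in \<open>auto simp: entry_def m_comm\<close>)
  qed
  also have "\<dots> = tor B S w (dual_family e) s A x"
    unfolding tor_inv[OF x] unfolding tor_def[of B S w "dual_family e"]
    by (rule mact_cong) (use x in \<open>auto simp: entry_tor ld\<close>)
  finally show ?thesis .
qed

context laurent_copy
begin

abbreviation univ_point where "univ_point r \<equiv> point r (\<lambda>i. single i 1)"
abbreviation univ_expo where "univ_expo r \<equiv> expo r (\<lambda>i. single i 1)"

lemma lev_X_sum:
  assumes "finite L" "finite P"
  shows "lev LA r (univ_point r) (\<Sum>q\<in>P. lmat L v E (p, q) * single 0 (\<tau> q)) =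
    \<phi> (\<Sum>q\<in>P. lmat L (\<lambda>l. univ_expo r (v l)) E (p, q) * single 0 (\<tau> q))"
proof -
  have l: "lev LA r (univ_point r) (lmat L v E z) = \<phi> (lmat L (\<lambda>l. univ_expo r (v l)) E z)" for z
  proof -
    interpret E: monomial_evaluation LA "monomial LA r (univ_point r)"
      by (rule LA.monomial_evaluation_monomial) simp
    show ?thesis
      unfolding lev_def E.ev_lmat[OF assms(1)]
      by (simp add: monomial_point sm_LA mult_single finsum_LA) (simp add: lmat_def)
  qed
  show ?thesis
    unfolding LA.lev_fixed_iff[OF assms(2) point_closed, symmetric] l sm_LA
    by (simp add: finsum_LA)
qed

text \<open>At the generic point the fixed-point condition is an identity of Laurent polynomials.
  \<open>lmat_fix\<close> turns it into the identity for the new weights, which can then be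
  evaluated at any point.\<close>

lemma fixed_transfer:
  assumes "idempotents P L E"
    and fixed: "\<forall>p\<in>P. lev LA r (univ_point r) (\<Sum>q\<in>P. lmat L v E (p, q) * single 0 (\<tau> q)) =
        lev LA r (univ_point r) (single 0 (\<tau> p))"
    and v: "\<And>l. l \<in> L \<Longrightarrow> univ_expo r (v l) = 0 \<Longrightarrow> v' l = 0" and p: "p \<in> P"
  shows "(\<Sum>q\<in>P. lmat L v' E (p, q) * single 0 (\<tau> q)) = single 0 (\<tau> p)"
proof -
  interpret idempotents P L E by fact
  show ?thesis
  proof (rule lmat_fix[OF _ v p])
    fix p assume "p \<in> P"
    then have "lev LA r (univ_point r) (\<Sum>q\<in>P. lmat L v E (p, q) * single 0 (\<tau> q)) =
        lev LA r (univ_point r) (single 0 (\<tau> p))" using fixed by blast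
    then show "(\<Sum>q\<in>P. lmat L (\<lambda>l. univ_expo r (v l)) E (p, q) * single 0 (\<tau> q)) = single 0 (\<tau> p)"
      unfolding lev_X_sum[OF finite_L finite_P] LA.lev_const[OF point_closed] sm_LA by simp
  qed auto
qed

lemma vector_transfer:
  assumes "idempotents B S f" "\<And>m. m \<in> S \<Longrightarrow> univ_expo r m = m" "w 0 = 0"
    and A: "A \<in> k_algebras" and x: "x \<in> carrier (Gm_power s A)"
    and fixed: "tor B S id f r LA (univ_point r) (\<lambda>b\<in>B. structure_map LA (\<tau> b)) = (\<lambda>b\<in>B. structure_map LA (\<tau> b))"
  shows "tor B S w f s A x (\<lambda>b\<in>B. structure_map A (\<tau> b)) = (\<lambda>b\<in>B. structure_map A (\<tau> b))"
proof -
  interpret L: torus_point B S f LA by (rule idempotents_torus_point[OF assms(1) LA_k_algebra])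
  interpret A: torus_point B S f A by (rule idempotents_torus_point[OF assms(1) A])
  show ?thesis
    unfolding A.tor_fixes_vector_iff[OF x]
    using fixed_transfer[OF assms(1) fixed[unfolded L.tor_fixes_vector_iff[OF point_closed]], of w] assms(2,3)
    by auto
qed

lemma tensor_transfer:
  assumes f: "idempotents B S f" and g: "idempotents B S g" and S: "\<And>m. m \<in> S \<Longrightarrow> univ_expo r m = m"
    and w: "w 0 = 0" "odd_weight S w"
    and A: "A \<in> k_algebras" and x: "x \<in> carrier (Gm_power s A)"
    and t: "t = (\<lambda>(b, c) \<in> B \<times> B. structure_map LA (\<tau> (b, c)))" "t' = (\<lambda>(b, c) \<in> B \<times> B. structure_map A (\<tau> (b, c)))"
    and fixed: "tensor_action B LA (tor B S id f r LA (univ_point r)) (tor B S id g r LA (univ_point r)) t = t"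
  shows "tensor_action B A (tor B S w f s A x) (tor B S w g s A x) t' = t'"
proof -
  interpret L: torus_point B S f LA by (rule idempotents_torus_point[OF f LA_k_algebra])
  interpret A: torus_point B S f A by (rule idempotents_torus_point[OF f A])
  have "(\<Sum>q\<in>B \<times> B. lmat (S \<times> S) (\<lambda>l. w (fst l) + w (snd l)) (tensor_family f g) (p, q) * single 0 (\<tau> q)) =
      single 0 (\<tau> p)" if "p \<in> B \<times> B" for p
  proof (rule fixed_transfer[OF idempotents_tensor[OF f g] fixed[unfolded L.tor_fixes_tensor_iff[OF g point_closed t(1)]] _ that])
    \<comment> \<open>A summand of weight zero in the tensor product pairs \<open>m\<close> with
      \<open>- m\<close>, and an odd \<open>w\<close> gives it weight zero again.\<close>
    fix l assume l: "l \<in> S \<times> S" and 0: "univ_expo r (id (fst l) + id (snd l)) = 0"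
    have "univ_expo r (m + n) = univ_expo r m + univ_expo r n" for m n
      by (simp add: expo_def lookup_add frag_cmul_distrib sum.distrib)
    then have "fst l + snd l = 0" using 0 S l by auto
    then have "snd l = - fst l" by (simp add: add_eq_0_iff)
    then show "w (fst l) + w (snd l) = 0" using w l by (auto simp: odd_weight_def)
  qed
  then show ?thesis
    unfolding A.tor_fixes_tensor_iff[OF g x t(2)] by simp
qed

end


section \<open>Stable subspaces\<close>

text \<open>A basis of \<open>W\<close> together with \<open>u\<close> is independent, so a
  functional may be prescribed to be 0 on the former and 1 on \<open>u\<close>. Membership in
  \<open>W\<close> thus becomes a matter of linear equations, which survive extension of
  scalars.\<close>

lemma (in vector_space) separating_functional:
  assumes W: "subspace W" and u: "u \<notin> W"
  obtains f where "Vector_Spaces.linear scale (*) f" "\<And>v. v \<in> W \<Longrightarrow> f v = 0" "f u \<noteq> 0"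
proof -
  interpret vs: vector_space_pair scale "(*) :: 'a \<Rightarrow> 'a \<Rightarrow> 'a"
    by unfold_locales (simp_all add: algebra_simps)
  obtain C where C: "C \<subseteq> W" "independent C" "span C = W"
    using W by (metis basis_exists span_subspace)
  have ind: "independent (insert u C)"
    using C u by (simp add: independent_insert)
  define f where "f = vs.construct (insert u C) (\<lambda>b. if b = u then 1 else 0)"
  have lin: "Vector_Spaces.linear scale (*) f"
    unfolding f_def by (rule vs.linear_construct[OF ind])
  have b: "f b = (if b = u then 1 else 0)" if "b \<in> insert u C" for b
    unfolding f_def by (rule vs.construct_basis[OF ind that])
  have "f v = 0" if "v \<in> W" for v
  proof (rule vs.linear_eq_0_on_span[OF lin])
    show "v \<in> span C" using that C by simp
    show "f c = 0" if "c \<in> C" for c using that b[of c] C u by auto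
  qed
  then show thesis using that[OF lin] b[of u] by simp
qed

context matrices
begin

lemma E_module: "module A E"
proof (rule moduleI)
  show "abelian_group E"
  proof (rule abelian_groupI)
    fix x assume x: "x \<in> carrier E"
    show "\<exists>y\<in>carrier E. y \<oplus>\<^bsub>E\<^esub> x = \<zero>\<^bsub>E\<^esub>"
      by (rule bexI[of _ "\<lambda>b\<in>B. \<ominus> x b"]) (use x in \<open>auto simp: add_ext_module zero_ext_module l_neg intro!: restrict_ext\<close>)
    show "\<zero>\<^bsub>E\<^esub> \<oplus>\<^bsub>E\<^esub> x = x"
      by (rule ext_module_eqI[of _ A B]) (use x in \<open>auto simp: zero_ext_module\<close>)
    fix y assume y: "y \<in> carrier E"
    show "x \<oplus>\<^bsub>E\<^esub> y = y \<oplus>\<^bsub>E\<^esub> x"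
      by (rule ext_module_eqI[of _ A B]) (use x y in \<open>auto simp: a_comm\<close>)
    fix z assume z: "z \<in> carrier E"
    show "x \<oplus>\<^bsub>E\<^esub> y \<oplus>\<^bsub>E\<^esub> z = x \<oplus>\<^bsub>E\<^esub> (y \<oplus>\<^bsub>E\<^esub> z)"
      by (rule ext_module_eqI[of _ A B]) (use x y z in \<open>auto simp: a_assoc\<close>)
  qed (auto simp: zero_ext_module)
qed (auto simp: is_cring intro!: ext_module_eqI[of _ A B] simp: l_distr r_distr m_assoc)

lemma submoduleI':
  assumes "N \<subseteq> carrier E" "(\<lambda>b\<in>B. \<zero>) \<in> N" "\<And>y z. y \<in> N \<Longrightarrow> z \<in> N \<Longrightarrow> y \<oplus>\<^bsub>E\<^esub> z \<in> N"
    "\<And>a y. a \<in> carrier A \<Longrightarrow> y \<in> N \<Longrightarrow> a \<odot>\<^bsub>E\<^esub> y \<in> N"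
  shows "submodule N A E"
proof -
  interpret M: module A E by (rule E_module)
  show ?thesis
  proof (rule M.submoduleI)
    fix y assume y: "y \<in> N"
    then have yE: "y \<in> carrier E" using assms(1) by auto
    have "\<ominus>\<^bsub>E\<^esub> y = (\<ominus> \<one>) \<odot>\<^bsub>E\<^esub> y"
      using M.smult_l_minus[of \<one> y] yE by simp
    then show "\<ominus>\<^bsub>E\<^esub> y \<in> N" using assms(4)[of "\<ominus> \<one>" y] y by simp
  qed (use assms in \<open>auto simp: zero_ext_module\<close>)
qed

lemma submoduleD:
  assumes "submodule N A E"
  shows "N \<subseteq> carrier E" "(\<lambda>b\<in>B. \<zero>) \<in> N" "\<And>y z. y \<in> N \<Longrightarrow> z \<in> N \<Longrightarrow> y \<oplus>\<^bsub>E\<^esub> z \<in> N"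
    "\<And>a y. a \<in> carrier A \<Longrightarrow> y \<in> N \<Longrightarrow> a \<odot>\<^bsub>E\<^esub> y \<in> N"
proof -
  interpret M: module A E by (rule E_module)
  interpret N: subgroup N "add_monoid E" using assms by (simp add: submodule_def)
  show "N \<subseteq> carrier E" using N.subset by simp
  show "(\<lambda>b\<in>B. \<zero>) \<in> N" using N.one_closed by (simp add: zero_ext_module)
  show "y \<oplus>\<^bsub>E\<^esub> z \<in> N" if "y \<in> N" "z \<in> N" for y z using N.m_closed[OF that] by simp
  show "a \<odot>\<^bsub>E\<^esub> y \<in> N" if "a \<in> carrier A" "y \<in> N" for a y
    using submodule.smult_closed[OF assms that] .
qed

lemma submodule_sum:
  assumes N: "submodule N A E" and fin: "finite I" and y: "\<And>i. i \<in> I \<Longrightarrow> y i \<in> N"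
  shows "(\<lambda>b\<in>B. \<Oplus>i\<in>I. y i b) \<in> N"
  using fin y
proof (induction I rule: finite_induct)
  case empty
  then show ?case using submoduleD(2)[OF N] by (simp only: finsum_empty)
next
  case (insert i I)
  have cl: "y j \<in> carrier E" if "j \<in> insert i I" for j
    using insert.prems[OF that] submoduleD(1)[OF N] by auto
  have eq: "(\<lambda>b\<in>B. \<Oplus>i\<in>insert i I. y i b) = y i \<oplus>\<^bsub>E\<^esub> (\<lambda>b\<in>B. \<Oplus>i\<in>I. y i b)"
    unfolding add_ext_module using insert.hyps cl
    by (intro restrict_ext) (subst add.finprod_insert; auto)
  show ?case
    unfolding eq using insert by (intro submoduleD(3)[OF N]) blast+
qed

text \<open>The extended subspace is an intersection of submodules, so any submodule that contains
  the image of \<open>W\<close> bounds it from above; linear equations supply such bounds.\<close>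

lemma kernel_submodule:
  assumes "\<And>b. b \<in> B \<Longrightarrow> f b \<in> carrier A"
  shows "submodule {y \<in> carrier E. (\<Oplus>b\<in>B. f b \<otimes> y b) = \<zero>} A E"
proof (rule submoduleI')
  fix y z assume yz: "y \<in> {y \<in> carrier E. (\<Oplus>b\<in>B. f b \<otimes> y b) = \<zero>}" "z \<in> {y \<in> carrier E. (\<Oplus>b\<in>B. f b \<otimes> y b) = \<zero>}"
  have "(\<Oplus>b\<in>B. f b \<otimes> (y \<oplus>\<^bsub>E\<^esub> z) b) = (\<Oplus>b\<in>B. f b \<otimes> y b \<oplus> f b \<otimes> z b)"
    using assms yz by (intro add.finprod_cong' refl) (auto simp: r_distr)
  also have "\<dots> = (\<Oplus>b\<in>B. f b \<otimes> y b) \<oplus> (\<Oplus>b\<in>B. f b \<otimes> z b)"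
    using assms yz by (intro finsum_addf) auto
  finally show "y \<oplus>\<^bsub>E\<^esub> z \<in> {y \<in> carrier E. (\<Oplus>b\<in>B. f b \<otimes> y b) = \<zero>}" using yz by auto
next
  fix a y assume a: "a \<in> carrier A" and y: "y \<in> {y \<in> carrier E. (\<Oplus>b\<in>B. f b \<otimes> y b) = \<zero>}"
  have "(\<Oplus>b\<in>B. f b \<otimes> (a \<odot>\<^bsub>E\<^esub> y) b) = (\<Oplus>b\<in>B. a \<otimes> (f b \<otimes> y b))"
    using assms a y by (intro add.finprod_cong' refl) (auto simp: m_lcomm)
  also have "\<dots> = a \<otimes> (\<Oplus>b\<in>B. f b \<otimes> y b)"
    using assms a y by (intro finsum_rdistr[symmetric]) auto
  finally show "a \<odot>\<^bsub>E\<^esub> y \<in> {y \<in> carrier E. (\<Oplus>b\<in>B. f b \<otimes> y b) = \<zero>}" using a y by auto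
next
  have "(\<Oplus>b\<in>B. f b \<otimes> (\<lambda>b\<in>B. \<zero>) b) = \<zero>"
    by (rule add.finprod_one_eqI) (use assms in auto)
  then show "(\<lambda>b\<in>B. \<zero>) \<in> {y \<in> carrier E. (\<Oplus>b\<in>B. f b \<otimes> y b) = \<zero>}" by auto
qed auto

text \<open>Reduces a claim about the image of a generated submodule to its generators.\<close>

lemma preimage_submodule:
  assumes g: "g \<in> carrier (GL B A)" and N: "submodule N A E"
  shows "submodule {y \<in> carrier E. g y \<in> N} A E"
proof (rule submoduleI')
  show "(\<lambda>b\<in>B. \<zero>) \<in> {y \<in> carrier E. g y \<in> N}"
    using GL_zero[OF g] submoduleD(2)[OF N] by (simp add: ext_moduleI del: restrict_apply)
qed (use submoduleD[OF N] GL_carrierD[OF g] in auto)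

end

locale coordinates = finite_dimensional_vector_space scale B
  for scale :: "'k::field \<Rightarrow> 'v::ab_group_add \<Rightarrow> 'v" and B :: "'v set"
begin

lemma finite_basis: "finite B" by (rule finite_Basis)

lemma coord_expand: "(\<Sum>b\<in>B. scale (coord scale B b v) b) = v"
  using sum_representation_eq[OF independent_Basis _ finite_Basis subset_refl] span_Basis by auto

lemma coord_add: "coord scale B b (u + v) = coord scale B b u + coord scale B b v"
  using representation_add[OF independent_Basis] span_Basis by auto

lemma coord_scale: "coord scale B b (scale c v) = c * coord scale B b v"
  using representation_scale[OF independent_Basis] span_Basis by auto

lemma coord_basis: "b \<in> B \<Longrightarrow> c \<in> B \<Longrightarrow> coord scale B b c = (if c = b then 1 else 0)"
  using representation_basis[OF independent_Basis, of c] by auto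

lemma coord_sum: "coord scale B b (\<Sum>i\<in>I. f i) = (\<Sum>i\<in>I. coord scale B b (f i))"
proof -
  have "coord scale B b 0 = 0" using coord_scale[where b = b and c = 0 and v = 0] by simp
  then show ?thesis
    by (induction I rule: infinite_finite_induct) (auto simp: coord_add)
qed

lemma coord_combination: "b \<in> B \<Longrightarrow> coord scale B b (\<Sum>c\<in>B. scale (x c) c) = x b"
  using finite_basis by (simp add: coord_sum coord_scale coord_basis if_distrib[of "\<lambda>z. _ * z"] cong: if_cong)

lemma functional_expand:
  assumes "Vector_Spaces.linear scale (*) f"
  shows "f v = (\<Sum>b\<in>B. f b * coord scale B b v)"
proof -
  interpret f: Vector_Spaces.linear scale "(*)" f by fact
  have "f v = f (\<Sum>b\<in>B. scale (coord scale B b v) b)" by (simp add: coord_expand)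
  also have "\<dots> = (\<Sum>b\<in>B. f b * coord scale B b v)"
    by (simp add: f.sum f.scale mult.commute)
  finally show ?thesis .
qed

end

text \<open>The generic point attaches to each weight component its own monomial, so the components
  are the coefficients of the result.\<close>

lemma (in laurent_copy) tor_X_ext:
  assumes e: "symmetric_idempotents B S e" and S: "\<And>m. m \<in> S \<Longrightarrow> univ_expo r m = m" and b: "b \<in> B"
  shows "tor B S id e r LA (univ_point r) (\<lambda>b\<in>B. structure_map LA (\<tau> b)) b =
    \<phi> (\<Sum>m\<in>S. single m (symmetric_idempotents.proj B e m \<tau> b))"
proof -
  interpret e: symmetric_idempotents B S e by fact
  interpret L: torus_point B S e LA by (rule idempotents_torus_point[OF e.idempotents_axioms LA_k_algebra])
  have "(\<Sum>m\<in>S. single (univ_expo r (id m)) (e.proj m \<tau> b)) = (\<Sum>m\<in>S. single m (e.proj m \<tau> b))"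
    using S by (intro sum.cong refl) simp
  then show ?thesis
    unfolding L.tor_apply_ext[OF point_closed b] lev_X_sum[OF e.finite_L e.finite_P] unfolding e.lmat_proj by simp
qed

lemma (in laurent_copy) subspace_transfer:
  assumes "finite_dimensional_vector_space scale B" and e: "symmetric_idempotents B S e"
    and S: "\<And>m. m \<in> S \<Longrightarrow> univ_expo r m = m"
    and A: "A \<in> k_algebras" and x: "x \<in> carrier (Gm_power s A)"
    and W: "module.subspace scale W"
    and fixed: "tor B S id e r LA (univ_point r) ` ext_subspace scale B LA W \<subseteq> ext_subspace scale B LA W"
  shows "tor B S w e s A x ` ext_subspace scale B A W \<subseteq> ext_subspace scale B A W"
proof -
  interpret V: coordinates scale B using assms(1) by (simp add: coordinates_def)
  interpret e: symmetric_idempotents B S e by fact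
  interpret L: torus_point B S e LA by (rule idempotents_torus_point[OF e.idempotents_axioms LA_k_algebra])
  interpret A: torus_point B S e A by (rule idempotents_torus_point[OF e.idempotents_axioms A])
  define pv where "pv m v = (\<Sum>b\<in>B. scale (e.proj m (\<lambda>b. coord scale B b v) b) b)" for m v
  have coord_pv: "coord scale B b (pv m v) = e.proj m (\<lambda>b. coord scale B b v) b" if "b \<in> B" for b m v
    unfolding pv_def using that by (rule V.coord_combination)
  \<comment> \<open>If a component left \<open>W\<close>, some functional vanishing on
    \<open>W\<close> would be nonzero on it. Extended to the Laurent ring, that functional kills the
    image of \<open>v\<close> under the generic point; its value on the component
    \<open>pv m v\<close> is the coefficient of exponent \<open>m\<close> and hence 0.\<close>
  have pv: "pv m v \<in> W" if v: "v \<in> W" and m: "m \<in> S" for m v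
  proof (rule ccontr)
    assume "pv m v \<notin> W"
    then obtain f where f: "Vector_Spaces.linear scale (*) f" "\<And>v. v \<in> W \<Longrightarrow> f v = 0" "f (pv m v) \<noteq> 0"
      using V.separating_functional[OF W] by blast
    define K where "K = {y \<in> carrier L.E. (\<Oplus>\<^bsub>LA\<^esub>b\<in>B. structure_map LA (f b) \<otimes>\<^bsub>LA\<^esub> y b) = \<zero>\<^bsub>LA\<^esub>}"
    have K: "submodule K LA L.E"
      unfolding K_def by (rule L.kernel_submodule) (rule LA.sm_closed)
    have W_ext: "ext_vec scale B LA ` W \<subseteq> ext_subspace scale B LA W"
      by (auto simp: ext_subspace_def)
    have "ext_vec scale B LA u \<in> K" if "u \<in> W" for u
    proof -
      have "(\<Oplus>\<^bsub>LA\<^esub>b\<in>B. structure_map LA (f b) \<otimes>\<^bsub>LA\<^esub> ext_vec scale B LA u b) =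
          (\<Oplus>\<^bsub>LA\<^esub>b\<in>B. \<phi> (single 0 (f b * coord scale B b u)))"
        by (intro LA.add.finprod_cong') (auto simp: ext_vec_def sm_LA mult_single)
      also have "\<dots> = \<phi> (single 0 (f u))"
        by (simp add: finsum_LA single_sum[symmetric] V.functional_expand[OF f(1), of u])
      finally show ?thesis
        using f(2)[OF that] by (simp add: K_def) (auto simp: ext_vec_def simp del: LA_simps)
    qed
    then have "ext_subspace scale B LA W \<subseteq> K" using K by (auto simp: ext_subspace_def)
    then have "tor B S id e r LA (univ_point r) (ext_vec scale B LA v) \<in> K"
      using fixed W_ext v by blast
    then have "(\<Oplus>\<^bsub>LA\<^esub>b\<in>B. structure_map LA (f b) \<otimes>\<^bsub>LA\<^esub> tor B S id e r LA (univ_point r) (ext_vec scale B LA v) b) = \<zero>\<^bsub>LA\<^esub>"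
      by (simp add: K_def)
    also have "(\<Oplus>\<^bsub>LA\<^esub>b\<in>B. structure_map LA (f b) \<otimes>\<^bsub>LA\<^esub> tor B S id e r LA (univ_point r) (ext_vec scale B LA v) b) =
        (\<Oplus>\<^bsub>LA\<^esub>b\<in>B. \<phi> (\<Sum>n\<in>S. single n (f b * e.proj n (\<lambda>b. coord scale B b v) b)))"
    proof (intro LA.add.finprod_cong' refl)
      fix b assume "b \<in> B"
      from tor_X_ext[OF e S this, where \<tau> = "\<lambda>b. coord scale B b v"]
      show "structure_map LA (f b) \<otimes>\<^bsub>LA\<^esub> tor B S id e r LA (univ_point r) (ext_vec scale B LA v) b =
          \<phi> (\<Sum>n\<in>S. single n (f b * e.proj n (\<lambda>b. coord scale B b v) b))"
        unfolding ext_vec_def by (simp add: sm_LA mult_single sum_distrib_left del: restrict_apply)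
    qed simp
    also have "\<dots> = \<phi> (\<Sum>n\<in>S. single n (f (pv n v)))"
      unfolding finsum_LA
      by (subst sum.swap) (simp add: single_sum[symmetric] V.functional_expand[OF f(1), of "pv _ v"] coord_pv)
    finally have "lookup (\<Sum>n\<in>S. single n (f (pv n v))) m = 0" by simp
    then have "f (pv m v) = 0"
      using m e.finite_L by (simp add: lookup_sum lookup_single when_def)
    then show False using f(3) by simp
  qed
  \<comment> \<open>The image of \<open>ext_vec scale B A v\<close> is a combination of the extended
    components \<open>pv m v\<close>, which come from \<open>W\<close>. General elements follow by
    taking the preimage of each submodule in the defining intersection.\<close>
  have main: "tor B S w e s A x y \<in> N"
    if N: "submodule N A A.E" "ext_vec scale B A ` W \<subseteq> N" and y: "y \<in> ext_subspace scale B A W" for N y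
  proof -
    have "ext_vec scale B A v \<in> {y \<in> carrier A.E. tor B S w e s A x y \<in> N}" if v: "v \<in> W" for v
    proof -
      have vE: "ext_vec scale B A v \<in> carrier A.E" by (auto simp: ext_vec_def)
      have "tor B S w e s A x (ext_vec scale B A v) =
          (\<lambda>b\<in>B. \<Oplus>\<^bsub>A\<^esub>m\<in>S. (monomial A s x (w m) \<odot>\<^bsub>A.E\<^esub> ext_vec scale B A (pv m v)) b)"
      proof (rule ext_module_eqI[OF A.tor_closed[OF x vE]])
        interpret X: monomial_evaluation A "monomial A s x" using x by (rule A.monomial_evaluation_monomial)
        show "(\<lambda>b\<in>B. \<Oplus>\<^bsub>A\<^esub>m\<in>S. (monomial A s x (w m) \<odot>\<^bsub>A.E\<^esub> ext_vec scale B A (pv m v)) b) \<in> carrier A.E"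
          by (auto simp: ext_vec_def intro!: A.finsum_closed)
        fix b assume b: "b \<in> B"
        show "tor B S w e s A x (ext_vec scale B A v) b =
            (\<lambda>b\<in>B. \<Oplus>\<^bsub>A\<^esub>m\<in>S. (monomial A s x (w m) \<odot>\<^bsub>A.E\<^esub> ext_vec scale B A (pv m v)) b) b"
          unfolding ext_vec_def A.tor_apply_ext[OF x b] e.lmat_proj
          using b by (simp add: lev_def X.ev_sum coord_pv)
            (intro A.add.finprod_cong'; auto simp: A.m_comm)
      qed
      also have "\<dots> \<in> N"
        using N pv[OF v] x
        by (intro A.submodule_sum A.submoduleD(4)[OF N(1)]) (auto intro: A.Units_closed)
      finally show ?thesis using vE by simp
    qed
    then have "ext_subspace scale B A W \<subseteq> {y \<in> carrier A.E. tor B S w e s A x y \<in> N}"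
      using A.preimage_submodule[OF A.tor_GL[OF x] N(1)] by (auto simp: ext_subspace_def)
    then show ?thesis using y by auto
  qed
  then show ?thesis by (auto simp: ext_subspace_def[of scale B A W] image_subset_iff)
qed

section \<open>Fixed quadratic forms\<close>

context matrices
begin

definition gram :: "('v \<times> 'v \<Rightarrow> 'u) \<Rightarrow> ('v \<Rightarrow> 'u) \<Rightarrow> ('v \<Rightarrow> 'u) \<Rightarrow> 'u"
  where "gram N y z = (\<Oplus>b\<in>B. \<Oplus>c\<in>B. N (b, c) \<otimes> y b \<otimes> z c)"

lemma gram_closed [simp, intro]:
  "matrix N \<Longrightarrow> y \<in> carrier E \<Longrightarrow> z \<in> carrier E \<Longrightarrow> gram N y z \<in> carrier A"
  unfolding gram_def by (auto intro!: finsum_closed)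

lemma gram_add:
  assumes N: "matrix N" and y: "y \<in> carrier E" and y': "y' \<in> carrier E" and z: "z \<in> carrier E"
  shows "gram N (y \<oplus>\<^bsub>E\<^esub> y') z = gram N y z \<oplus> gram N y' z"
    and "gram N z (y \<oplus>\<^bsub>E\<^esub> y') = gram N z y \<oplus> gram N z y'"
proof -
  have "gram N (y \<oplus>\<^bsub>E\<^esub> y') z = (\<Oplus>b\<in>B. \<Oplus>c\<in>B. N (b, c) \<otimes> y b \<otimes> z c \<oplus> N (b, c) \<otimes> y' b \<otimes> z c)"
    unfolding gram_def using assms
    by (intro add.finprod_cong' refl) (auto simp: r_distr l_distr intro!: finsum_closed)
  also have "\<dots> = (\<Oplus>b\<in>B. (\<Oplus>c\<in>B. N (b, c) \<otimes> y b \<otimes> z c) \<oplus> (\<Oplus>c\<in>B. N (b, c) \<otimes> y' b \<otimes> z c))"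
    using assms by (intro add.finprod_cong' refl finsum_addf) (auto intro!: finsum_closed)
  also have "\<dots> = gram N y z \<oplus> gram N y' z"
    unfolding gram_def using assms by (intro finsum_addf) (auto intro!: finsum_closed)
  finally show "gram N (y \<oplus>\<^bsub>E\<^esub> y') z = gram N y z \<oplus> gram N y' z" .
  have "gram N z (y \<oplus>\<^bsub>E\<^esub> y') = (\<Oplus>b\<in>B. \<Oplus>c\<in>B. N (b, c) \<otimes> z b \<otimes> y c \<oplus> N (b, c) \<otimes> z b \<otimes> y' c)"
    unfolding gram_def using assms
    by (intro add.finprod_cong' refl) (auto simp: r_distr intro!: finsum_closed)
  also have "\<dots> = (\<Oplus>b\<in>B. (\<Oplus>c\<in>B. N (b, c) \<otimes> z b \<otimes> y c) \<oplus> (\<Oplus>c\<in>B. N (b, c) \<otimes> z b \<otimes> y' c))"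
    using assms by (intro add.finprod_cong' refl finsum_addf) (auto intro!: finsum_closed)
  also have "\<dots> = gram N z y \<oplus> gram N z y'"
    unfolding gram_def using assms by (intro finsum_addf) (auto intro!: finsum_closed)
  finally show "gram N z (y \<oplus>\<^bsub>E\<^esub> y') = gram N z y \<oplus> gram N z y'" .
qed

lemma gram_smult:
  assumes N: "matrix N" and a: "a \<in> carrier A" and y: "y \<in> carrier E" and z: "z \<in> carrier E"
  shows "gram N (a \<odot>\<^bsub>E\<^esub> y) z = a \<otimes> gram N y z" and "gram N z (a \<odot>\<^bsub>E\<^esub> y) = a \<otimes> gram N z y"
proof -
  have *: "(\<Oplus>b\<in>B. \<Oplus>c\<in>B. a \<otimes> h b c) = a \<otimes> (\<Oplus>b\<in>B. \<Oplus>c\<in>B. h b c)"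
    if h: "\<And>b c. b \<in> B \<Longrightarrow> c \<in> B \<Longrightarrow> h b c \<in> carrier A" for h
  proof -
    have "(\<Oplus>b\<in>B. \<Oplus>c\<in>B. a \<otimes> h b c) = (\<Oplus>b\<in>B. a \<otimes> (\<Oplus>c\<in>B. h b c))"
      using h a by (intro add.finprod_cong' refl finsum_rdistr[symmetric]) (auto intro!: finsum_closed)
    also have "\<dots> = a \<otimes> (\<Oplus>b\<in>B. \<Oplus>c\<in>B. h b c)"
      using h a by (intro finsum_rdistr[symmetric]) (auto intro!: finsum_closed)
    finally show ?thesis .
  qed
  have "gram N (a \<odot>\<^bsub>E\<^esub> y) z = (\<Oplus>b\<in>B. \<Oplus>c\<in>B. a \<otimes> (N (b, c) \<otimes> y b \<otimes> z c))"
    unfolding gram_def using assms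
    by (intro add.finprod_cong' refl) (auto simp: m_ac intro!: finsum_closed)
  also have "\<dots> = a \<otimes> gram N y z"
    unfolding gram_def using assms by (intro *) auto
  finally show "gram N (a \<odot>\<^bsub>E\<^esub> y) z = a \<otimes> gram N y z" .
  have "gram N z (a \<odot>\<^bsub>E\<^esub> y) = (\<Oplus>b\<in>B. \<Oplus>c\<in>B. a \<otimes> (N (b, c) \<otimes> z b \<otimes> y c))"
    unfolding gram_def using assms
    by (intro add.finprod_cong' refl) (auto simp: m_ac intro!: finsum_closed)
  also have "\<dots> = a \<otimes> gram N z y"
    unfolding gram_def using assms by (intro *) auto
  finally show "gram N z (a \<odot>\<^bsub>E\<^esub> y) = a \<otimes> gram N z y" .
qed

lemma quadratic_form_gram:
  assumes N: "matrix N"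
  shows "quadratic_form A E (\<lambda>y. gram N y y)"
proof -
  have polar: "gram N (y \<oplus>\<^bsub>E\<^esub> z) (y \<oplus>\<^bsub>E\<^esub> z) \<ominus> gram N y y \<ominus> gram N z z = gram N y z \<oplus> gram N z y"
    if y: "y \<in> carrier E" and z: "z \<in> carrier E" for y z
  proof -
    have "gram N (y \<oplus>\<^bsub>E\<^esub> z) (y \<oplus>\<^bsub>E\<^esub> z) = (gram N y y \<oplus> gram N z y) \<oplus> (gram N y z \<oplus> gram N z z)"
      using N y z by (simp add: gram_add)
    moreover have "(a \<oplus> c) \<oplus> (b \<oplus> d) \<ominus> a \<ominus> d = b \<oplus> c"
      if "a \<in> carrier A" "b \<in> carrier A" "c \<in> carrier A" "d \<in> carrier A" for a b c d
      using that by algebra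
    ultimately show ?thesis using N y z by simp
  qed
  have "bilinear_form A E \<beta>"
    if "\<And>y z. y \<in> carrier E \<Longrightarrow> z \<in> carrier E \<Longrightarrow> \<beta> y z = gram N y z \<oplus> gram N z y" for \<beta>
    unfolding bilinear_form_def
    using N by (auto simp: that gram_add gram_smult r_distr a_ac)
  from this[OF polar]
  show ?thesis
    using N unfolding quadratic_form_def by (auto simp: gram_smult m_assoc)
qed

text \<open>Invariance of the form is the matrix identity \<open>N^T G N = G\<close>, which
  \<open>lmat_bil_fix\<close> provides for torus elements.\<close>

lemma gram_mact:
  assumes G: "matrix G" and N: "matrix N" and y: "y \<in> carrier E"
    and inv: "\<And>p q. p \<in> B \<Longrightarrow> q \<in> B \<Longrightarrow> (\<Oplus>b\<in>B. \<Oplus>c\<in>B. G (b, c) \<otimes> N (b, p) \<otimes> N (c, q)) = G (p, q)"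
  shows "gram G (mact B A N y) (mact B A N y) = gram G y y"
proof -
  have "gram G (mact B A N y) (mact B A N y) =
      (\<Oplus>b\<in>B. \<Oplus>c\<in>B. G (b, c) \<otimes> (\<Oplus>p\<in>B. N (b, p) \<otimes> y p) \<otimes> (\<Oplus>q\<in>B. N (c, q) \<otimes> y q))"
    unfolding gram_def using assms
    by (intro add.finprod_cong' refl) (auto simp: mact_apply intro!: finsum_closed)
  also have "\<dots> = (\<Oplus>b\<in>B. \<Oplus>c\<in>B. \<Oplus>p\<in>B. \<Oplus>q\<in>B. G (b, c) \<otimes> N (b, p) \<otimes> N (c, q) \<otimes> (y p \<otimes> y q))"
  proof (intro add.finprod_cong' refl Pi_I finsum_closed)
    fix b c assume bc: "b \<in> B" "c \<in> B"
    have "G (b, c) \<otimes> (\<Oplus>p\<in>B. N (b, p) \<otimes> y p) \<otimes> (\<Oplus>q\<in>B. N (c, q) \<otimes> y q) =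
        (\<Oplus>p\<in>B. G (b, c) \<otimes> (N (b, p) \<otimes> y p)) \<otimes> (\<Oplus>q\<in>B. N (c, q) \<otimes> y q)"
      using assms bc by (subst finsum_rdistr) auto
    also have "\<dots> = (\<Oplus>p\<in>B. G (b, c) \<otimes> (N (b, p) \<otimes> y p) \<otimes> (\<Oplus>q\<in>B. N (c, q) \<otimes> y q))"
      using assms bc by (intro finsum_ldistr) (auto intro!: finsum_closed)
    also have "\<dots> = (\<Oplus>p\<in>B. \<Oplus>q\<in>B. G (b, c) \<otimes> (N (b, p) \<otimes> y p) \<otimes> (N (c, q) \<otimes> y q))"
      using assms bc by (intro add.finprod_cong' refl finsum_rdistr) (auto intro!: finsum_closed)
    also have "\<dots> = (\<Oplus>p\<in>B. \<Oplus>q\<in>B. G (b, c) \<otimes> N (b, p) \<otimes> N (c, q) \<otimes> (y p \<otimes> y q))"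
      using assms bc by (intro add.finprod_cong' refl) (auto simp: m_ac intro!: finsum_closed)
    finally show "G (b, c) \<otimes> (\<Oplus>p\<in>B. N (b, p) \<otimes> y p) \<otimes> (\<Oplus>q\<in>B. N (c, q) \<otimes> y q) =
      (\<Oplus>p\<in>B. \<Oplus>q\<in>B. G (b, c) \<otimes> N (b, p) \<otimes> N (c, q) \<otimes> (y p \<otimes> y q))" .
  qed (use assms in auto)
  also have "\<dots> = (\<Oplus>r\<in>B \<times> B. \<Oplus>t\<in>B \<times> B. G (fst r, snd r) \<otimes> N (fst r, fst t) \<otimes> N (snd r, snd t) \<otimes> (y (fst t) \<otimes> y (snd t)))"
  proof -
    have "(\<Oplus>t\<in>B \<times> B. G (b, c) \<otimes> N (b, fst t) \<otimes> N (c, snd t) \<otimes> (y (fst t) \<otimes> y (snd t))) =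
        (\<Oplus>p\<in>B. \<Oplus>q\<in>B. G (b, c) \<otimes> N (b, p) \<otimes> N (c, q) \<otimes> (y p \<otimes> y q))" if "b \<in> B" "c \<in> B" for b c
      using assms that by (subst finsum_cartesian) auto
    then show ?thesis
      using assms by (subst finsum_cartesian) (auto intro!: add.finprod_cong' finsum_closed)
  qed
  also have "\<dots> = (\<Oplus>t\<in>B \<times> B. \<Oplus>r\<in>B \<times> B. G (fst r, snd r) \<otimes> N (fst r, fst t) \<otimes> N (snd r, snd t) \<otimes> (y (fst t) \<otimes> y (snd t)))"
    using assms by (intro finsum_swap) auto
  also have "\<dots> = (\<Oplus>t\<in>B \<times> B. (\<Oplus>r\<in>B \<times> B. G (fst r, snd r) \<otimes> N (fst r, fst t) \<otimes> N (snd r, snd t)) \<otimes> (y (fst t) \<otimes> y (snd t)))"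
    using assms by (intro add.finprod_cong' refl finsum_ldistr[symmetric]) (auto intro!: finsum_closed)
  also have "\<dots> = (\<Oplus>t\<in>B \<times> B. G (fst t, snd t) \<otimes> (y (fst t) \<otimes> y (snd t)))"
  proof (intro add.finprod_cong' refl)
    fix t assume t: "t \<in> B \<times> B"
    have "(\<Oplus>r\<in>B \<times> B. G (fst r, snd r) \<otimes> N (fst r, fst t) \<otimes> N (snd r, snd t)) = G (fst t, snd t)"
      using assms t by (subst finsum_cartesian) (auto simp: inv)
    then show "(\<Oplus>r\<in>B \<times> B. G (fst r, snd r) \<otimes> N (fst r, fst t) \<otimes> N (snd r, snd t)) \<otimes> (y (fst t) \<otimes> y (snd t)) =
        G (fst t, snd t) \<otimes> (y (fst t) \<otimes> y (snd t))" by simp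
  qed (use assms in auto)
  also have "\<dots> = gram G y y"
    unfolding gram_def using assms
    by (subst finsum_cartesian) (auto simp: m_assoc intro!: add.finprod_cong' finsum_closed)
  finally show ?thesis .
qed

end

context laurent_copy
begin

lemma a_inv_LA: "\<ominus>\<^bsub>LA\<^esub> \<phi> F = \<phi> (- F)"
  by (rule LA.minus_equality) auto

lemma a_minus_LA: "\<phi> F \<ominus>\<^bsub>LA\<^esub> \<phi> G = \<phi> (F - G)"
  by (simp add: a_minus_def a_inv_LA)

lemma double_eq_zero: "(m :: nat \<Rightarrow>\<^sub>0 int) + m = 0 \<Longrightarrow> m = 0"
proof (rule poly_mapping_eqI)
  fix i assume "m + m = 0"
  then have "lookup m i + lookup m i = 0"
    by (metis lookup_add lookup_zero)
  then show "lookup m i = lookup 0 i" by simp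
qed

text \<open>The given \<open>Q\<close> lives over the Laurent ring, so a form over \<open>A\<close>
  has to be constructed. \<open>Q\<close> yields vanishing conditions on \<open>q\<close>; an
  adapted Gram matrix over the field then defines an invariant form over every algebra.\<close>

lemma quadratic_transfer:
  assumes f: "symmetric_idempotents B S f" and S: "\<And>m. m \<in> S \<Longrightarrow> univ_expo r m = m"
    and w: "odd_weight S w" and q: "coordinate_quadratic_form B q"
    and A: "A \<in> k_algebras" and x: "x \<in> carrier (Gm_power s A)"
    and Q: "quadratic_form LA (ext_module LA B) Q"
    and Qq: "\<And>z. Q (\<lambda>b\<in>B. structure_map LA (z b)) = structure_map LA (q z)"
    and Q_inv: "\<And>y. y \<in> carrier (ext_module LA B) \<Longrightarrow> Q (tor B S id f r LA (univ_point r) y) = Q y"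
  shows "\<exists>Q'. quadratic_form A (ext_module A B) Q' \<and>
    (\<forall>z. Q' (\<lambda>b\<in>B. structure_map A (z b)) = structure_map A (q z)) \<and>
    (\<forall>y\<in>carrier (ext_module A B). Q' (tor B S w f s A x y) = Q' y)"
proof -
  interpret f: symmetric_idempotents B S f by fact
  interpret q: coordinate_quadratic_form B q by fact
  interpret L: torus_point B S f LA by (rule idempotents_torus_point[OF f.idempotents_axioms LA_k_algebra])
  interpret A: torus_point B S f A by (rule idempotents_torus_point[OF f.idempotents_axioms A])
  define v where "v m z = (\<lambda>b\<in>B. structure_map LA (f.proj m z b))" for m z
  define Xm where "Xm m = \<phi> (single m (1::'k))" for m
  let ?g = "tor B S id f r LA (univ_point r)"
  let ?b = "\<lambda>y z. Q (y \<oplus>\<^bsub>L.E\<^esub> z) \<ominus>\<^bsub>LA\<^esub> Q y \<ominus>\<^bsub>LA\<^esub> Q z"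
  have vE: "v m z \<in> carrier L.E" for m z unfolding v_def by (rule ext_moduleI) (rule LA.sm_closed)
  have Xm_closed: "Xm m \<in> carrier LA" for m by (simp add: Xm_def)
  have bil: "bilinear_form LA L.E ?b" using Q by (simp add: quadratic_form_def)
  \<comment> \<open>A vector of weight \<open>m\<close> is an eigenvector of the generic element,
    with the monomial \<open>Xm m\<close> as eigenvalue.\<close>
  have gv: "?g (v m z) = Xm m \<odot>\<^bsub>L.E\<^esub> v m z" if m: "m \<in> S" for m z
  proof (rule ext_module_eqI[OF L.tor_closed[OF point_closed vE]])
    show "Xm m \<odot>\<^bsub>L.E\<^esub> v m z \<in> carrier L.E" using Xm_closed vE by blast
    fix b assume b: "b \<in> B"
    have "(\<Sum>n\<in>S. single n (f.proj n (f.proj m z) b)) =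
        (\<Sum>n\<in>S. if n = m then single m (f.proj m z b) else 0)"
      using m b by (intro sum.cong refl) (auto simp: f.proj_proj)
    also have "\<dots> = single m (f.proj m z b)" using m by simp
    finally have "?g (v m z) b = \<phi> (single m (f.proj m z b))"
      using tor_X_ext[OF f S b, where \<tau> = "f.proj m z"] by (simp add: v_def del: restrict_apply)
    then show "?g (v m z) b = (Xm m \<odot>\<^bsub>L.E\<^esub> v m z) b"
      using b by (simp add: v_def Xm_def sm_LA mult_single)
  qed
  \<comment> \<open>Invariance multiplies the value by the monomial of exponent
    \<open>m + m\<close>, and this exponent is nonzero because exponents have no torsion. The
    argument concerns exponents, not scalars, so it also works in characteristic 2.\<close>
  have q0: "q (f.proj m z) = 0" if m: "m \<in> S" "m \<noteq> 0" for m z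
  proof -
    have "Q (v m z) = Q (Xm m \<odot>\<^bsub>L.E\<^esub> v m z)"
      using Q_inv[OF vE, of m z] by (simp add: gv[OF m(1)])
    also have "\<dots> = Xm m \<otimes>\<^bsub>LA\<^esub> Xm m \<otimes>\<^bsub>LA\<^esub> Q (v m z)"
      using Q Xm_closed vE unfolding quadratic_form_def by blast
    finally have eq: "single 0 (q (f.proj m z)) = single (m + m) (q (f.proj m z))"
      unfolding v_def Qq by (simp add: Xm_def sm_LA mult_single)
    have mm: "m + m \<noteq> 0" using double_eq_zero m by blast
    then show ?thesis
      using arg_cong[OF eq, of "\<lambda>F. lookup F 0"] by (simp only: lookup_single_eq lookup_single_not_eq[OF mm])
  qed
  have add: "v m z \<oplus>\<^bsub>L.E\<^esub> v n z' = (\<lambda>b\<in>B. structure_map LA (f.proj m z b + f.proj n z' b))" for m n z z'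
    unfolding add_ext_module v_def by (intro restrict_ext) (simp add: LA.sm_add)
  have bv: "?b (v m z) (v n z') = structure_map LA (polar q (f.proj m z) (f.proj n z'))" for m n z z'
    unfolding add unfolding v_def Qq unfolding sm_LA a_minus_LA by (simp add: polar_def single_diff)
  \<comment> \<open>The same comparison for the polar form, with exponent
    \<open>m + n\<close>.\<close>
  have p0: "polar q (f.proj m z) (f.proj n z') = 0" if mn: "m \<in> S" "n \<in> S" "m + n \<noteq> 0" for m n z z'
  proof -
    have "?b (v m z) (v n z') = ?b (?g (v m z)) (?g (v n z'))"
      using Q_inv vE L.GL_carrierD(2)[OF L.tor_GL[OF point_closed] vE vE, symmetric] by (simp add: L.add_closed_E del: LA_simps)
    also have "\<dots> = Xm m \<otimes>\<^bsub>LA\<^esub> ?b (v m z) (Xm n \<odot>\<^bsub>L.E\<^esub> v n z')"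
      using bil Xm_closed vE L.smult_closed_E unfolding gv[OF mn(1)] gv[OF mn(2)] bilinear_form_def by blast
    also have "?b (v m z) (Xm n \<odot>\<^bsub>L.E\<^esub> v n z') = Xm n \<otimes>\<^bsub>LA\<^esub> ?b (v m z) (v n z')"
      using bil Xm_closed vE unfolding bilinear_form_def by blast
    finally have eq: "single 0 (polar q (f.proj m z) (f.proj n z')) =
        single (m + n) (polar q (f.proj m z) (f.proj n z'))"
      unfolding bv by (simp add: Xm_def sm_LA mult_single)
    show ?thesis
      using arg_cong[OF eq, of "\<lambda>F. lookup F 0"]
      by (simp only: lookup_single_eq lookup_single_not_eq[OF mn(3)])
  qed
  obtain G where G: "\<And>x. q x = bil B G x x"
      "\<And>m n x y. m \<in> S \<Longrightarrow> n \<in> S \<Longrightarrow> m + n \<noteq> 0 \<Longrightarrow> bil B G (f.proj m x) (f.proj n y) = 0"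
    using f.adapted_bilinear_form[OF q q0 p0] by blast
  interpret X: monomial_evaluation A "monomial A s x" using x by (rule A.monomial_evaluation_monomial)
  define G' where "G' p = structure_map A (G p)" for p
  have G': "A.matrix G'" by (auto simp: G'_def)
  have "A.gram G' (\<lambda>b\<in>B. structure_map A (z b)) (\<lambda>b\<in>B. structure_map A (z b)) = structure_map A (q z)" for z
  proof -
    have "structure_map A (q z) = (\<Oplus>\<^bsub>A\<^esub>b\<in>B. \<Oplus>\<^bsub>A\<^esub>c\<in>B. structure_map A (G (b, c) * z b * z c))"
      unfolding G(1) bil_def by (simp add: A.sm_sum)
    also have "\<dots> = A.gram G' (\<lambda>b\<in>B. structure_map A (z b)) (\<lambda>b\<in>B. structure_map A (z b))"
      unfolding A.gram_def G'_def
      by (intro A.add.finprod_cong' refl) (auto simp: A.sm_mult intro!: A.finsum_closed)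
    finally show ?thesis by simp
  qed
  moreover have "A.gram G' (tor B S w f s A x y) (tor B S w f s A x y) = A.gram G' y y" if y: "y \<in> carrier A.E" for y
    unfolding tor_def
  proof (rule A.gram_mact[OF G' A.lev_matrix[OF x] y])
    fix p p' assume p: "p \<in> B" "p' \<in> B"
    have odd: "\<And>m. m \<in> S \<Longrightarrow> w (- m) = - w m" using w by (auto simp: odd_weight_def)
    have "(\<Oplus>\<^bsub>A\<^esub>b\<in>B. \<Oplus>\<^bsub>A\<^esub>c\<in>B. G' (b, c) \<otimes>\<^bsub>A\<^esub> lev A s x (lmat S w f (b, p)) \<otimes>\<^bsub>A\<^esub> lev A s x (lmat S w f (c, p'))) =
        ev A (monomial A s x) (\<Sum>b\<in>B. \<Sum>c\<in>B. single 0 (G (b, c)) * lmat S w f (b, p) * lmat S w f (c, p'))"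
      by (simp add: X.ev_sum lev_def G'_def)
    also have "\<dots> = G' (p, p')"
      by (subst f.lmat_bil_fix) (use G(2) odd p in \<open>auto simp: G'_def\<close>)
    finally show "(\<Oplus>\<^bsub>A\<^esub>b\<in>B. \<Oplus>\<^bsub>A\<^esub>c\<in>B. G' (b, c) \<otimes>\<^bsub>A\<^esub> lev A s x (lmat S w f (b, p)) \<otimes>\<^bsub>A\<^esub> lev A s x (lmat S w f (c, p'))) = G' (p, p')" .
  qed
  ultimately show ?thesis
    using A.quadratic_form_gram[OF G'] by blast
qed

end

section \<open>Quadratic forms on V and on its dual in coordinates\<close>

lemma ring_minus_ground: "(a :: 'k::field) \<ominus>\<^bsub>(ground_ring :: 'k ring)\<^esub> b = a - b"
proof -
  interpret cring "ground_ring :: 'k ring" by (rule cring_from_type_algebra)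
  have "\<ominus>\<^bsub>(ground_ring :: 'k ring)\<^esub> b = - b"
    by (rule minus_equality) (simp_all add: ring_of_type_algebra_def)
  then show ?thesis by (simp add: a_minus_def ring_of_type_algebra_def)
qed

context coordinates
begin

text \<open>\<open>L\<close> turns coordinates into an element of the module: a combination of basis
  vectors in the case of \<open>V\<close>, and of coordinate forms in the case of the dual.\<close>

lemma quadratic_form_coordinates:
  fixes q :: "'x \<Rightarrow> 'k" and M :: "('k, 'x, 'z) module_scheme"
  assumes q: "quadratic_form ground_ring M q"
    and L: "\<And>z. L z \<in> carrier M" and L_cong: "\<And>z z'. (\<And>b. b \<in> B \<Longrightarrow> z b = z' b) \<Longrightarrow> L z = L z'"
    and L_add: "\<And>z z'. L (\<lambda>b. z b + z' b) = L z \<oplus>\<^bsub>M\<^esub> L z'" and L_scale: "\<And>c z. L (\<lambda>b. c * z b) = c \<odot>\<^bsub>M\<^esub> L z"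
  shows "coordinate_quadratic_form B (\<lambda>z. q (L z))"
proof -
  have polar: "polar (\<lambda>z. q (L z)) z z' = q (L z \<oplus>\<^bsub>M\<^esub> L z') \<ominus>\<^bsub>(ground_ring :: 'k ring)\<^esub> q (L z) \<ominus>\<^bsub>(ground_ring :: 'k ring)\<^esub> q (L z')" for z z'
    by (simp add: polar_def L_add ring_minus_ground)
  have bil: "bilinear_form (ground_ring :: 'k ring) M (\<lambda>x y. q (x \<oplus>\<^bsub>M\<^esub> y) \<ominus>\<^bsub>(ground_ring :: 'k ring)\<^esub> q x \<ominus>\<^bsub>(ground_ring :: 'k ring)\<^esub> q y)"
    using q by (simp add: quadratic_form_def)
  show ?thesis
  proof
    show "q (L z) = q (L z')" if "\<And>b. b \<in> B \<Longrightarrow> z b = z' b" for z z'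
      using L_cong[of z z'] that by simp
    show "q (L (\<lambda>b. c * z b)) = c * c * q (L z)" for c z
      using q L[of z] by (auto simp: quadratic_form_def L_scale ring_of_type_algebra_def)
    show "polar (\<lambda>z. q (L z)) (\<lambda>b. x b + x' b) y = polar (\<lambda>z. q (L z)) x y + polar (\<lambda>z. q (L z)) x' y" for x x' y
      using bil L[of x] L[of x'] L[of y] unfolding polar L_add[of x x'] bilinear_form_def
      by (simp add: ring_of_type_algebra_def)
    show "polar (\<lambda>z. q (L z)) (\<lambda>b. c * x b) y = c * polar (\<lambda>z. q (L z)) x y" for c x y
      using bil L[of x] L[of y] unfolding polar L_scale bilinear_form_def
      by (simp add: ring_of_type_algebra_def)
  qed
qed

lemma quadratic_form_on_space:
  assumes "quadratic_form ground_ring (vec_module scale) q"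
  shows "coordinate_quadratic_form B (\<lambda>z. q (\<Sum>b\<in>B. scale (z b) b))"
  by (rule quadratic_form_coordinates[OF assms])
    (auto simp: vec_module_def scale_left_distrib sum.distrib scale_sum_right intro!: arg_cong[of _ _ q] sum.cong)

lemma dual_combination: "(\<lambda>v. \<Sum>b\<in>B. z b * coord scale B b v) \<in> carrier (dual_module scale)"
proof -
  have *: "(\<Sum>b\<in>B. z b * coord scale B b (u + v)) = (\<Sum>b\<in>B. z b * coord scale B b u) + (\<Sum>b\<in>B. z b * coord scale B b v)"
    "(\<Sum>b\<in>B. z b * coord scale B b (scale c v)) = c * (\<Sum>b\<in>B. z b * coord scale B b v)" for u v c
    by (simp_all add: coord_add coord_scale distrib_left sum.distrib sum_distrib_left mult.left_commute)
  interpret vector_space_pair scale "(*) :: 'k \<Rightarrow> 'k \<Rightarrow> 'k"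
    by unfold_locales (simp_all add: algebra_simps)
  have "Vector_Spaces.linear scale (*) (\<lambda>v. \<Sum>b\<in>B. z b * coord scale B b v)"
    by unfold_locales (rule *)+
  then show ?thesis by (simp add: dual_module_def)
qed

lemma quadratic_form_on_dual:
  assumes "quadratic_form ground_ring (dual_module scale) q"
  shows "coordinate_quadratic_form B (\<lambda>z. q (\<lambda>v. \<Sum>b\<in>B. z b * coord scale B b v))"
proof (rule quadratic_form_coordinates[OF assms dual_combination])
  show "(\<lambda>v. \<Sum>b\<in>B. c * z b * coord scale B b v) =
      c \<odot>\<^bsub>dual_module scale\<^esub> (\<lambda>v. \<Sum>b\<in>B. z b * coord scale B b v)" for c z
    by (simp add: dual_module_def sum_distrib_left mult.assoc)
qed (auto simp: dual_module_def distrib_right sum.distrib fun_eq_iff)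

end

text \<open>Four transfer results, for vectors, tensors, quadratic forms and subspaces, cover all
  eight kinds: the contragredient action is the same torus acting through
  \<open>dual_family e\<close>.\<close>

lemma (in laurent_copy) fixes_object_transfer:
  assumes fd: "finite_dimensional_vector_space scale B" and e: "symmetric_idempotents B S e"
    and S: "\<And>m. m \<in> S \<Longrightarrow> univ_expo r m = m" and w: "odd_weight S w" "w 0 = 0"
    and A: "A \<in> k_algebras" and x: "x \<in> carrier (Gm_power s A)"
    and wf: "wf_object scale \<theta>"
    and fixed: "fixes_object scale B LA (tor B S id e r LA (univ_point r)) \<theta>"
  shows "fixes_object scale B A (tor B S w e s A x) \<theta>"
proof -
  interpret V: coordinates scale B using fd by (simp add: coordinates_def)
  interpret e: symmetric_idempotents B S e by fact
  let ?d = "dual_family e"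
  have id: "idempotents B S e" and idd: "idempotents B S ?d"
    using idempotents_dual[OF e.idempotents_axioms e.sym] e.idempotents_axioms by auto
  have dual: "symmetric_idempotents B S ?d"
    using idd e.sym by (simp add: symmetric_idempotents_def symmetric_idempotents_axioms_def)
  have odd_id: "odd_weight S id" using e.sym by (simp add: odd_weight_def)
  have cL: "contragredient B LA (tor B S id e r LA (univ_point r)) = tor B S id ?d r LA (univ_point r)"
    by (rule torus_point.contragredient_tor[OF idempotents_torus_point[OF id LA_k_algebra] point_closed odd_id])
  have cA: "contragredient B A (tor B S w e s A x) = tor B S w ?d s A x"
    by (rule torus_point.contragredient_tor[OF idempotents_torus_point[OF id A] x w(1)])
  note vec = vector_transfer[where w = w, OF _ S w(2) A x]
    and ten = tensor_transfer[where w = w, OF _ _ S w(2,1) A x refl refl]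
  show ?thesis
  proof (cases \<theta>)
    case (Vector v)
    then show ?thesis
      using fixed vec[OF id, where \<tau> = "\<lambda>b. coord scale B b v"] by (simp add: ext_vec_def del: restrict_apply)
  next
    case (Covector f)
    then show ?thesis
      using fixed vec[OF idd, where \<tau> = f] by (simp add: ext_covec_def cL cA del: restrict_apply)
  next
    case (Tensor t)
    then show ?thesis
      using fixed ten[OF id id, where \<tau> = "\<lambda>p. t (coord scale B (fst p)) (coord scale B (snd p))"]
      by (simp add: Let_def del: restrict_apply)
  next
    case (Cotensor t)
    then show ?thesis
      using fixed ten[OF idd idd, where \<tau> = "\<lambda>p. t (fst p) (snd p)"]
      by (simp add: Let_def cL cA del: restrict_apply)
  next
    case (Endomorphism u)
    then show ?thesis
      using fixed ten[OF id idd, where \<tau> = "\<lambda>p. coord scale B (fst p) (u (snd p))"]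
      by (simp add: Let_def cL cA del: restrict_apply)
  next
    case (Quadratic q)
    then obtain Q where Q: "quadratic_form LA (ext_module LA B) Q"
        "\<And>v. Q (ext_vec scale B LA v) = structure_map LA (q v)"
        "\<And>y. y \<in> carrier (ext_module LA B) \<Longrightarrow> Q (tor B S id e r LA (univ_point r) y) = Q y"
      using fixed by auto
    have "Q (\<lambda>b\<in>B. structure_map LA (z b)) = structure_map LA (q (\<Sum>b\<in>B. scale (z b) b))" for z
    proof -
      have "(\<lambda>b\<in>B. structure_map LA (z b)) = ext_vec scale B LA (\<Sum>b\<in>B. scale (z b) b)"
        unfolding ext_vec_def by (intro restrict_ext) (simp add: V.coord_combination)
      then show ?thesis using Q(2)[of "\<Sum>b\<in>B. scale (z b) b"] by simp
    qed
    from quadratic_transfer[OF e S w(1) V.quadratic_form_on_space A x Q(1) this Q(3)] wf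
    obtain Q' where Q': "quadratic_form A (ext_module A B) Q'"
        "\<And>z. Q' (\<lambda>b\<in>B. structure_map A (z b)) = structure_map A (q (\<Sum>b\<in>B. scale (z b) b))"
        "\<And>y. y \<in> carrier (ext_module A B) \<Longrightarrow> Q' (tor B S w e s A x y) = Q' y"
      unfolding Quadratic by auto
    have "Q' (ext_vec scale B A v) = structure_map A (q v)" for v
      unfolding ext_vec_def Q'(2) V.coord_expand ..
    then show ?thesis unfolding Quadratic using Q'(1,3) by auto
  next
    case (Dual_Quadratic q)
    then obtain Q where Q: "quadratic_form LA (ext_module LA B) Q"
        "\<And>f. f \<in> carrier (dual_module scale) \<Longrightarrow> Q (ext_covec B LA f) = structure_map LA (q f)"
        "\<And>y. y \<in> carrier (ext_module LA B) \<Longrightarrow> Q (tor B S id ?d r LA (univ_point r) y) = Q y"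
      using fixed by (auto simp: cL)
    have "Q (\<lambda>b\<in>B. structure_map LA (z b)) = structure_map LA (q (\<lambda>v. \<Sum>b\<in>B. z b * coord scale B b v))" for z
    proof -
      have "(\<Sum>b\<in>B. z b * coord scale B b c) = z c" if "c \<in> B" for c
        using that V.finite_basis by (simp add: V.coord_basis if_distrib[of "\<lambda>x. _ * x"] cong: if_cong)
      then have "(\<lambda>b\<in>B. structure_map LA (z b)) = ext_covec B LA (\<lambda>v. \<Sum>b\<in>B. z b * coord scale B b v)"
        unfolding ext_covec_def by (intro restrict_ext) simp
      then show ?thesis using Q(2)[OF V.dual_combination[of z]] by simp
    qed
    from quadratic_transfer[OF dual S w(1) V.quadratic_form_on_dual A x Q(1) this Q(3)] wf
    obtain Q' where Q': "quadratic_form A (ext_module A B) Q'"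
        "\<And>z. Q' (\<lambda>b\<in>B. structure_map A (z b)) = structure_map A (q (\<lambda>v. \<Sum>b\<in>B. z b * coord scale B b v))"
        "\<And>y. y \<in> carrier (ext_module A B) \<Longrightarrow> Q' (tor B S w ?d s A x y) = Q' y"
      unfolding Dual_Quadratic by auto
    have "Q' (ext_covec B A f) = structure_map A (q f)" if "f \<in> carrier (dual_module scale)" for f
    proof -
      have "(\<lambda>v. \<Sum>b\<in>B. f b * coord scale B b v) = f"
        by (intro ext V.functional_expand[symmetric]) (use that in \<open>simp add: dual_module_def\<close>)
      then show ?thesis unfolding ext_covec_def Q'(2) by (simp only:)
    qed
    then show ?thesis unfolding Dual_Quadratic using Q'(1,3) by (auto simp: cA)
  next
    case (Subspace W)
    then show ?thesis
      using subspace_transfer[OF fd e S A x, of W w] fixed wf by simp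
  qed
qed


section \<open>Characters\<close>

locale character_setting =
  fixes B :: "'v set" and T :: "('k::field, 'v, 'u) subfunctor"
  assumes finite_B: "finite B"
    and T_subgroup: "\<And>A. A \<in> k_algebras \<Longrightarrow> subgroup (T A) (GL B A)"
    and T_base_change: "\<And>A A' h g. A \<in> k_algebras \<Longrightarrow> A' \<in> k_algebras \<Longrightarrow> h \<in> algebra_hom A A' \<Longrightarrow>
      g \<in> T A \<Longrightarrow> base_change B A A' h g \<in> T A'"
begin

abbreviation "CG \<equiv> character_group B T"

lemma character_iff:
  "\<chi> \<in> carrier CG \<longleftrightarrow> \<chi> \<in> extensional k_algebras \<and>
    (\<forall>A\<in>k_algebras. \<chi> A \<in> extensional (T A) \<and> (\<forall>g\<in>T A. \<chi> A g \<in> Units A) \<and>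
       (\<forall>g\<in>T A. \<forall>g'\<in>T A. \<chi> A (g \<otimes>\<^bsub>GL B A\<^esub> g') = \<chi> A g \<otimes>\<^bsub>A\<^esub> \<chi> A g')) \<and>
    (\<forall>A\<in>k_algebras. \<forall>A'\<in>k_algebras. \<forall>h\<in>algebra_hom A A'. \<forall>g\<in>T A. \<chi> A' (base_change B A A' h g) = h (\<chi> A g))"
  by (auto simp: character_group_def hom_def points_def units_of_carrier units_of_mult)

lemma characterD:
  assumes "\<chi> \<in> carrier CG" "A \<in> k_algebras"
  shows "\<chi> A \<in> extensional (T A)" "g \<in> T A \<Longrightarrow> \<chi> A g \<in> Units A"
    "g \<in> T A \<Longrightarrow> g' \<in> T A \<Longrightarrow> \<chi> A (g \<otimes>\<^bsub>GL B A\<^esub> g') = \<chi> A g \<otimes>\<^bsub>A\<^esub> \<chi> A g'"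
    "A' \<in> k_algebras \<Longrightarrow> h \<in> algebra_hom A A' \<Longrightarrow> g \<in> T A \<Longrightarrow> \<chi> A' (base_change B A A' h g) = h (\<chi> A g)"
  using assms unfolding character_iff by blast+

lemma character_eqI:
  assumes "\<chi> \<in> carrier CG" "\<chi>' \<in> carrier CG"
    and eq: "\<And>A g. A \<in> k_algebras \<Longrightarrow> g \<in> T A \<Longrightarrow> \<chi> A g = \<chi>' A g"
  shows "\<chi> = \<chi>'"
proof (rule extensionalityI)
  show "\<chi> \<in> extensional k_algebras" "\<chi>' \<in> extensional k_algebras"
    using assms by (auto simp: character_iff)
  fix A :: "('k, 'u) module" assume A: "A \<in> k_algebras"
  show "\<chi> A = \<chi>' A"
    by (rule extensionalityI[OF characterD(1)[OF assms(1) A] characterD(1)[OF assms(2) A]]) (rule eq[OF A])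
qed

lemma character_mult_apply [simp]:
  "A \<in> k_algebras \<Longrightarrow> g \<in> T A \<Longrightarrow> (\<chi> \<otimes>\<^bsub>CG\<^esub> \<chi>') A g = \<chi> A g \<otimes>\<^bsub>A\<^esub> \<chi>' A g"
  by (simp add: character_group_def)

lemma character_one_apply [simp]: "A \<in> k_algebras \<Longrightarrow> g \<in> T A \<Longrightarrow> \<one>\<^bsub>CG\<^esub> A g = \<one>\<^bsub>A\<^esub>"
  by (simp add: character_group_def)

lemma character_memI:
  assumes ext: "\<chi> = (\<lambda>A\<in>k_algebras. \<lambda>g\<in>T A. f A g)"
    and unit: "\<And>A g. A \<in> k_algebras \<Longrightarrow> g \<in> T A \<Longrightarrow> f A g \<in> Units A"
    and mult: "\<And>A g g'. A \<in> k_algebras \<Longrightarrow> g \<in> T A \<Longrightarrow> g' \<in> T A \<Longrightarrow> f A (g \<otimes>\<^bsub>GL B A\<^esub> g') = f A g \<otimes>\<^bsub>A\<^esub> f A g'"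
    and nat: "\<And>A A' h g. A \<in> k_algebras \<Longrightarrow> A' \<in> k_algebras \<Longrightarrow> h \<in> algebra_hom A A' \<Longrightarrow> g \<in> T A \<Longrightarrow>
      f A' (base_change B A A' h g) = h (f A g)"
  shows "\<chi> \<in> carrier CG"
  unfolding character_iff ext
  using unit mult nat T_base_change subgroup.m_closed[OF T_subgroup] by (auto simp: restrict_def extensional_def)

lemma character_mult_closed:
  assumes c: "\<chi> \<in> carrier CG" "\<chi>' \<in> carrier CG"
  shows "\<chi> \<otimes>\<^bsub>CG\<^esub> \<chi>' \<in> carrier CG"
proof (rule character_memI[where f = "\<lambda>A g. \<chi> A g \<otimes>\<^bsub>A\<^esub> \<chi>' A g"])
  show "\<chi> \<otimes>\<^bsub>CG\<^esub> \<chi>' = (\<lambda>A\<in>k_algebras. \<lambda>g\<in>T A. \<chi> A g \<otimes>\<^bsub>A\<^esub> \<chi>' A g)"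
    by (simp add: character_group_def)
  fix A :: "('k, 'u) module" and g assume A: "A \<in> k_algebras" and g: "g \<in> T A"
  interpret A: k_algebra A using A by (simp add: k_algebra_iff)
  note u = characterD(2)[OF c(1) A] characterD(2)[OF c(2) A]
  note u' = u[THEN A.Units_closed]
  show "\<chi> A g \<otimes>\<^bsub>A\<^esub> \<chi>' A g \<in> Units A" using u g by simp
  show "\<chi> A (g \<otimes>\<^bsub>GL B A\<^esub> g') \<otimes>\<^bsub>A\<^esub> \<chi>' A (g \<otimes>\<^bsub>GL B A\<^esub> g') = \<chi> A g \<otimes>\<^bsub>A\<^esub> \<chi>' A g \<otimes>\<^bsub>A\<^esub> (\<chi> A g' \<otimes>\<^bsub>A\<^esub> \<chi>' A g')" if "g' \<in> T A" for g'
    using characterD(3)[OF c(1) A g that] characterD(3)[OF c(2) A g that] u'[OF g] u'[OF that] by (simp add: A.m_ac)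
  fix A' :: "('k, 'u) module" and h assume A': "A' \<in> k_algebras" and h: "h \<in> algebra_hom A A'"
  interpret h: ring_hom_cring A A' h by (rule algebra_homD(1)[OF A A' h])
  show "\<chi> A' (base_change B A A' h g) \<otimes>\<^bsub>A'\<^esub> \<chi>' A' (base_change B A A' h g) = h (\<chi> A g \<otimes>\<^bsub>A\<^esub> \<chi>' A g)"
    using characterD(4)[OF c(1) A A' h g] characterD(4)[OF c(2) A A' h g] u'[OF g] by simp
qed

lemma character_one_closed: "\<one>\<^bsub>CG\<^esub> \<in> carrier CG"
proof (rule character_memI[where f = "\<lambda>A g. \<one>\<^bsub>A\<^esub>"])
  show "\<one>\<^bsub>CG\<^esub> = (\<lambda>A\<in>k_algebras. \<lambda>g\<in>T A. \<one>\<^bsub>A\<^esub>)"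
    by (simp add: character_group_def)
  fix A :: "('k, 'u) module" assume A: "A \<in> k_algebras"
  interpret A: k_algebra A using A by (simp add: k_algebra_iff)
  show "\<one>\<^bsub>A\<^esub> \<in> Units A" by simp
  show "\<one>\<^bsub>A\<^esub> = \<one>\<^bsub>A\<^esub> \<otimes>\<^bsub>A\<^esub> \<one>\<^bsub>A\<^esub>" by simp
  fix A' :: "('k, 'u) module" and h assume A': "A' \<in> k_algebras" and h: "h \<in> algebra_hom A A'"
  interpret h: ring_hom_cring A A' h by (rule algebra_homD(1)[OF A A' h])
  show "\<one>\<^bsub>A'\<^esub> = h \<one>\<^bsub>A\<^esub>" by simp
qed

lemma character_inverse_closed:
  assumes c: "\<chi> \<in> carrier CG"
  shows "(\<lambda>A\<in>k_algebras. \<lambda>g\<in>T A. inv\<^bsub>A\<^esub> (\<chi> A g)) \<in> carrier CG"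
proof (rule character_memI[OF refl])
  fix A :: "('k, 'u) module" and g assume A: "A \<in> k_algebras" and g: "g \<in> T A"
  interpret A: k_algebra A using A by (simp add: k_algebra_iff)
  note u = characterD(2)[OF c A]
  show "inv\<^bsub>A\<^esub> (\<chi> A g) \<in> Units A" using u[OF g] by simp
  show "inv\<^bsub>A\<^esub> (\<chi> A (g \<otimes>\<^bsub>GL B A\<^esub> g')) = inv\<^bsub>A\<^esub> (\<chi> A g) \<otimes>\<^bsub>A\<^esub> inv\<^bsub>A\<^esub> (\<chi> A g')" if "g' \<in> T A" for g'
    unfolding characterD(3)[OF c A g that]
    using u[OF g] u[OF that]
    by (intro A.comm_inv_char) (auto simp: A.Units_closed A.m_ac intro: A.Units_inv_closed)
  fix A' :: "('k, 'u) module" and h assume A': "A' \<in> k_algebras" and h: "h \<in> algebra_hom A A'"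
  interpret A': k_algebra A' using A' by (simp add: k_algebra_iff)
  interpret h: ring_hom_cring A A' h by (rule algebra_homD(1)[OF A A' h])
  have "h (\<chi> A g) \<otimes>\<^bsub>A'\<^esub> h (inv\<^bsub>A\<^esub> (\<chi> A g)) = \<one>\<^bsub>A'\<^esub>"
    using u[OF g] by (simp add: h.hom_mult[symmetric] A.Units_closed del: h.hom_mult)
  then show "inv\<^bsub>A'\<^esub> (\<chi> A' (base_change B A A' h g)) = h (inv\<^bsub>A\<^esub> (\<chi> A g))"
    unfolding characterD(4)[OF c A A' h g]
    using u[OF g] by (intro A'.comm_inv_char) (auto simp: A.Units_closed)
qed

lemma character_comm_group: "comm_group CG"
proof (rule comm_groupI)
  fix \<chi> assume c: "\<chi> \<in> carrier CG"
  have U: "\<chi> A g \<in> Units A" "\<chi> A g \<in> carrier A" "inv\<^bsub>A\<^esub> (\<chi> A g) \<otimes>\<^bsub>A\<^esub> \<chi> A g = \<one>\<^bsub>A\<^esub>" "\<one>\<^bsub>A\<^esub> \<otimes>\<^bsub>A\<^esub> \<chi> A g = \<chi> A g"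
    if A: "A \<in> k_algebras" and "g \<in> T A" for A g
  proof -
    interpret A: k_algebra A using A by (simp add: k_algebra_iff)
    show "\<chi> A g \<in> Units A" "\<chi> A g \<in> carrier A" "inv\<^bsub>A\<^esub> (\<chi> A g) \<otimes>\<^bsub>A\<^esub> \<chi> A g = \<one>\<^bsub>A\<^esub>" "\<one>\<^bsub>A\<^esub> \<otimes>\<^bsub>A\<^esub> \<chi> A g = \<chi> A g"
      using characterD(2)[OF c that] by (auto simp: A.Units_closed)
  qed
  show "\<one>\<^bsub>CG\<^esub> \<otimes>\<^bsub>CG\<^esub> \<chi> = \<chi>"
    by (rule character_eqI) (use c U in \<open>auto simp: character_mult_closed character_one_closed\<close>)
  show "\<exists>\<chi>'\<in>carrier CG. \<chi>' \<otimes>\<^bsub>CG\<^esub> \<chi> = \<one>\<^bsub>CG\<^esub>"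
    by (rule bexI[OF _ character_inverse_closed[OF c]], rule character_eqI)
      (use c U in \<open>auto simp: character_mult_closed character_one_closed character_inverse_closed\<close>)
  fix \<chi>' assume c': "\<chi>' \<in> carrier CG"
  show "\<chi> \<otimes>\<^bsub>CG\<^esub> \<chi>' = \<chi>' \<otimes>\<^bsub>CG\<^esub> \<chi>"
  proof (rule character_eqI)
    fix A :: "('k, 'u) module" and g assume A: "A \<in> k_algebras" and g: "g \<in> T A"
    interpret A: k_algebra A using A by (simp add: k_algebra_iff)
    show "(\<chi> \<otimes>\<^bsub>CG\<^esub> \<chi>') A g = (\<chi>' \<otimes>\<^bsub>CG\<^esub> \<chi>) A g"
      using characterD(2)[OF c A g] characterD(2)[OF c' A g] A g by (simp add: A.m_comm A.Units_closed)
  qed (use c c' in \<open>auto simp: character_mult_closed\<close>)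
  fix \<chi>'' assume c'': "\<chi>'' \<in> carrier CG"
  show "\<chi> \<otimes>\<^bsub>CG\<^esub> \<chi>' \<otimes>\<^bsub>CG\<^esub> \<chi>'' = \<chi> \<otimes>\<^bsub>CG\<^esub> (\<chi>' \<otimes>\<^bsub>CG\<^esub> \<chi>'')"
  proof (rule character_eqI)
    fix A :: "('k, 'u) module" and g assume A: "A \<in> k_algebras" and g: "g \<in> T A"
    interpret A: k_algebra A using A by (simp add: k_algebra_iff)
    show "(\<chi> \<otimes>\<^bsub>CG\<^esub> \<chi>' \<otimes>\<^bsub>CG\<^esub> \<chi>'') A g = (\<chi> \<otimes>\<^bsub>CG\<^esub> (\<chi>' \<otimes>\<^bsub>CG\<^esub> \<chi>'')) A g"
      using characterD(2)[OF c A g] characterD(2)[OF c' A g] characterD(2)[OF c'' A g] A g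
      by (simp add: A.m_assoc A.Units_closed)
  qed (use c c' c'' in \<open>auto simp: character_mult_closed\<close>)
qed (auto simp: character_mult_closed character_one_closed)

text \<open>Turns a relation among characters into a relation among units, where it can be
  computed.\<close>

lemma evaluation_hom:
  assumes "A \<in> k_algebras" "g \<in> T A"
  shows "(\<lambda>\<chi>. \<chi> A g) \<in> hom CG (units_of A)"
  using assms characterD(2) by (auto simp: hom_def units_of_carrier units_of_mult)

end

section \<open>Weights of the maximal tori\<close>

lemma single_key_eqD:
  assumes "single m c = single n d" "c \<noteq> 0"
  shows "m = n"
proof -
  have "lookup (single n d) m = c"
    unfolding assms(1)[symmetric] by simp
  then show ?thesis using assms(2) by (auto simp: lookup_single when_def split: if_splits)
qed

text \<open>Maximality enters as \<open>enlarged_le\<close>: points of the enlarged torus are points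
  of \<open>T\<close>, so characters of \<open>T\<close> can be evaluated at them.\<close>

locale maximal_diagonal_torus = laurent_copy \<phi> + enlarged_torus B S e R s k w + V: coordinates scale B
  for \<phi> :: "'k::field laurent \<Rightarrow> 'u" and B :: "'v::ab_group_add set" and S
    and e :: "(nat \<Rightarrow>\<^sub>0 int) \<Rightarrow> 'v \<times> 'v \<Rightarrow> 'k" and R s k w and scale :: "'k \<Rightarrow> 'v \<Rightarrow> 'v" +
  fixes r :: nat and T :: "('k, 'v, 'u) subfunctor"
  assumes T_eq: "\<And>A. A \<in> k_algebras \<Longrightarrow> T A = tor B S id e r A ` carrier (Gm_power r A)"
    and enlarged_le: "\<And>A. A \<in> k_algebras \<Longrightarrow> tor B S w e s A ` carrier (Gm_power s A) \<subseteq> T A"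
    and subgroup_T: "\<And>A. A \<in> k_algebras \<Longrightarrow> subgroup (T A) (GL B A)"
    and k_inj: "inj_on k {..<s}"
begin

sublocale C: character_setting B T
proof (rule character_setting.intro)
  fix A A' :: "('k, 'u) module" and h g
  assume A: "A \<in> k_algebras" "A' \<in> k_algebras" "h \<in> algebra_hom A A'" and "g \<in> T A"
  then obtain x where x: "x \<in> carrier (Gm_power r A)" and g: "g = tor B S id e r A x"
    by (auto simp: T_eq)
  interpret torus_point B S e A by (rule idempotents_torus_point[OF idempotents_axioms A(1)])
  show "base_change B A A' h g \<in> T A'"
    unfolding g base_change_tor[OF x A(2,3)] T_eq[OF A(2)]
    using algebra_hom_Gm_power[OF A x] by blast
qed (rule finite_P, rule subgroup_T)

text \<open>The weight \<open>m\<close> as a character. A polynomial in the matrix entries does not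
  refer to a parametrization, so the same expression can be computed on the original and on the
  enlarged torus.\<close>

definition chi :: "(nat \<Rightarrow>\<^sub>0 int) \<Rightarrow> ('k, 'v, 'u) character"
  where "chi m = (\<lambda>A\<in>k_algebras. \<lambda>g\<in>T A. ev A (entry_monomial B A g) (coeff_poly m))"

lemma chi_tor:
  assumes "A \<in> k_algebras" "x \<in> carrier (Gm_power r A)" "m \<in> R"
  shows "chi m A (tor B S id e r A x) = monomial A r x m"
proof -
  interpret enlarged_torus_point B S e R s k w A using assms(1) by (rule point_locale)
  have "tor B S id e r A x \<in> T A" using assms by (simp add: T_eq)
  then show ?thesis using coeff_tor[OF assms(2,3), of id] assms(1) by (simp add: chi_def)
qed

lemma chi_enlarged:
  assumes "A \<in> k_algebras" "x \<in> carrier (Gm_power s A)" "m \<in> R"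
  shows "chi m A (tor B S w e s A x) = monomial A s x (w m)"
proof -
  interpret enlarged_torus_point B S e R s k w A using assms(1) by (rule point_locale)
  have "tor B S w e s A x \<in> T A" using assms enlarged_le by auto
  then show ?thesis using coeff_tor[OF assms(2,3), of w] assms(1) by (simp add: chi_def)
qed

lemma T_cases:
  assumes "A \<in> k_algebras" "g \<in> T A"
  obtains x where "x \<in> carrier (Gm_power r A)" "g = tor B S id e r A x"
  using assms by (auto simp: T_eq)

lemma chi_closed:
  assumes m: "m \<in> R"
  shows "chi m \<in> carrier C.CG"
proof (rule C.character_memI[where f = "chi m"])
  show "chi m = (\<lambda>A\<in>k_algebras. \<lambda>g\<in>T A. chi m A g)"
    by (auto simp: chi_def intro!: restrict_ext)
  fix A :: "('k, 'u) module" and g assume A: "A \<in> k_algebras" and g: "g \<in> T A"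
  interpret torus_point B S e A by (rule idempotents_torus_point[OF idempotents_axioms A])
  obtain x where x: "x \<in> carrier (Gm_power r A)" and gx: "g = tor B S id e r A x"
    using T_cases[OF A g] .
  show "chi m A g \<in> Units A"
    unfolding gx chi_tor[OF A x m] using x by simp
  show "chi m A (g \<otimes>\<^bsub>GL B A\<^esub> g') = chi m A g \<otimes>\<^bsub>A\<^esub> chi m A g'" if g': "g' \<in> T A" for g'
  proof -
    obtain y where y: "y \<in> carrier (Gm_power r A)" and gy: "g' = tor B S id e r A y"
      using T_cases[OF A g'] .
    show ?thesis
      unfolding gx gy tor_mult[OF x y] chi_tor[OF A x m] chi_tor[OF A y m]
        chi_tor[OF A Gm_power_closed(1)[OF x y] m] by (rule monomial_mult[OF x y])
  qed
  fix A' :: "('k, 'u) module" and h assume A': "A' \<in> k_algebras" and h: "h \<in> algebra_hom A A'"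
  show "chi m A' (base_change B A A' h g) = h (chi m A g)"
    unfolding gx base_change_tor[OF x A' h] chi_tor[OF A x m]
      chi_tor[OF A' algebra_hom_Gm_power[OF A A' h x] m] algebra_hom_monomial[OF A A' h x] ..
qed

lemma tor_apply_proj:
  assumes A: "A \<in> k_algebras" and x: "x \<in> carrier (Gm_power r A)" and b: "b \<in> B"
  shows "tor B S id e r A x (\<lambda>b\<in>B. structure_map A (z b)) b = lev A r x (\<Sum>n\<in>S. single n (proj n z b))"
proof -
  interpret torus_point B S e A by (rule idempotents_torus_point[OF idempotents_axioms A])
  show ?thesis unfolding tor_apply_ext[OF x b] lmat_proj by simp
qed

text \<open>A nonzero column of the projection \<open>e m\<close> is a weight vector;
  \<open>pos m\<close> supplies one.\<close>

lemma chi_weight: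
  assumes m: "m \<in> R"
  shows "chi m \<in> weights scale B T"
proof -
  obtain b0 c0 where p: "pos m = (b0, c0)" by (cases "pos m")
  have bc: "b0 \<in> B" "c0 \<in> B" "e m (b0, c0) \<noteq> 0" using pos[OF m] by (simp_all add: p)
  have mS: "m \<in> S" using m R_subset by auto
  define v where "v = (\<Sum>b\<in>B. scale (e m (b, c0)) b)"
  have coord_v: "coord scale B b v = e m (b, c0)" if "b \<in> B" for b
    unfolding v_def using that by (rule V.coord_combination)
  have "v \<noteq> 0"
    using coord_v[OF bc(1)] bc(3) V.coord_scale[where c = 0 and v = 0 and b = b0] by auto
  moreover have "g (ext_vec scale B A v) = chi m A g \<odot>\<^bsub>ext_module A B\<^esub> ext_vec scale B A v"
    if A: "A \<in> k_algebras" and g: "g \<in> T A" for A g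
  proof -
    interpret torus_point B S e A by (rule idempotents_torus_point[OF idempotents_axioms A])
    obtain x where x: "x \<in> carrier (Gm_power r A)" and gx: "g = tor B S id e r A x"
      using T_cases[OF A g] .
    interpret X: monomial_evaluation A "monomial A r x" using x by (rule monomial_evaluation_monomial)
    have vE: "ext_vec scale B A v = (\<lambda>b\<in>B. structure_map A (e m (b, c0)))"
      unfolding ext_vec_def by (intro restrict_ext) (simp add: coord_v)
    have vE': "ext_vec scale B A v \<in> carrier E" unfolding vE by (rule ext_moduleI) (rule sm_closed)
    have cl: "chi m A g \<in> carrier A" unfolding gx chi_tor[OF A x m] by (rule X.mu_closed)
    show ?thesis
    proof (rule ext_module_eqI[of _ A B])
      fix b assume b: "b \<in> B"
      have "(\<Sum>n\<in>S. single n (proj n (\<lambda>b. e m (b, c0)) b)) =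
          (\<Sum>n\<in>S. if n = m then single m (e m (b, c0)) else 0)"
        using b bc mS by (intro sum.cong refl) (simp add: proj_def orthogonal)
      also have "\<dots> = single m (e m (b, c0))" using mS by simp
      finally show "g (ext_vec scale B A v) b = (chi m A g \<odot>\<^bsub>E\<^esub> ext_vec scale B A v) b"
        unfolding gx vE tor_apply_proj[OF A x b] chi_tor[OF A x m]
        using b by (simp add: lev_def m_comm)
    qed (use vE' cl GL_carrierD(4)[OF tor_GL[OF x]] gx in auto)
  qed
  ultimately show ?thesis
    using chi_closed[OF m] unfolding weights_def by blast
qed

text \<open>A weight vector has a nonzero component for some \<open>m\<close>. Projecting the
  eigenvector equation onto it, and dividing by a nonzero constant, shows that the eigenvalue is the
  monomial of exponent \<open>m\<close>.\<close>

lemma weight_is_chi: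
  assumes "\<chi> \<in> weights scale B T"
  shows "\<chi> \<in> chi ` R"
proof -
  obtain v where \<chi>: "\<chi> \<in> carrier C.CG" and v0: "v \<noteq> 0" and
      v: "\<And>A g. A \<in> k_algebras \<Longrightarrow> g \<in> T A \<Longrightarrow>
        g (ext_vec scale B A v) = \<chi> A g \<odot>\<^bsub>ext_module A B\<^esub> ext_vec scale B A v"
    using assms unfolding weights_def by blast
  define z where "z b = coord scale B b v" for b
  have "\<exists>b\<in>B. z b \<noteq> 0"
  proof (rule ccontr)
    assume "\<not> ?thesis"
    then have "(\<Sum>b\<in>B. scale (coord scale B b v) b) = 0"
      by (intro sum.neutral) (simp add: z_def)
    then show False using v0 by (simp add: V.coord_expand)
  qed
  then obtain b' where b': "b' \<in> B" "z b' \<noteq> 0" by blast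
  then have "(\<Sum>m\<in>S. proj m z b') \<noteq> 0" by (simp add: sum_proj)
  then obtain m where m: "m \<in> S" "proj m z b' \<noteq> 0"
    by (meson sum.neutral)
  then have mR: "m \<in> R"
    using b' e_not_R[of m b'] unfolding proj_def by (metis (no_types, lifting) mult_zero_left sum.neutral)
  have "\<chi> = chi m"
  proof (rule C.character_eqI[OF \<chi> chi_closed[OF mR]])
    fix A :: "('k, 'u) module" and g assume A: "A \<in> k_algebras" and g: "g \<in> T A"
    interpret torus_point B S e A by (rule idempotents_torus_point[OF idempotents_axioms A])
    obtain x where x: "x \<in> carrier (Gm_power r A)" and gx: "g = tor B S id e r A x"
      using T_cases[OF A g] .
    interpret X: monomial_evaluation A "monomial A r x" using x by (rule monomial_evaluation_monomial)
    have cl: "\<chi> A g \<in> carrier A" using C.characterD(2)[OF \<chi> A g] by (rule Units_closed)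
    have eq: "ev A (monomial A r x) (\<Sum>n\<in>S. single n (proj n z b)) = \<chi> A g \<otimes>\<^bsub>A\<^esub> structure_map A (z b)"
      if b: "b \<in> B" for b
    proof -
      have "g (\<lambda>b\<in>B. structure_map A (z b)) b = (\<chi> A g \<odot>\<^bsub>E\<^esub> (\<lambda>b\<in>B. structure_map A (z b))) b"
        using v[OF A g] by (simp only: ext_vec_def z_def)
      then show ?thesis
        using b unfolding gx tor_apply_proj[OF A x b] lev_def by simp
    qed
    have "structure_map A (proj m z b') \<otimes>\<^bsub>A\<^esub> monomial A r x m =
        ev A (monomial A r x) (\<Sum>b\<in>B. single 0 (e m (b', b)) * (\<Sum>n\<in>S. single n (proj n z b)))"
    proof -
      have "(\<Sum>b\<in>B. single 0 (e m (b', b)) * (\<Sum>n\<in>S. single n (proj n z b))) =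
          (\<Sum>n\<in>S. single n (proj m (proj n z) b'))"
        by (simp add: sum_distrib_left mult_single proj_def[of m "proj _ z"] single_sum) (rule sum.swap)
      also have "\<dots> = (\<Sum>n\<in>S. if n = m then single m (proj m z b') else 0)"
        using m b' by (intro sum.cong refl) (auto simp: proj_proj)
      also have "\<dots> = single m (proj m z b')" using m by simp
      finally show ?thesis by simp
    qed
    also have "\<dots> = (\<Oplus>\<^bsub>A\<^esub>b\<in>B. \<chi> A g \<otimes>\<^bsub>A\<^esub> structure_map A (e m (b', b) * z b))"
      unfolding X.ev_sum[OF finite_P] X.ev_mult
      by (intro add.finprod_cong' refl) (use cl in \<open>auto simp: eq sm_mult m_lcomm simp del: X.ev_single\<close>, simp_all add: cl m_lcomm)
    also have "\<dots> = \<chi> A g \<otimes>\<^bsub>A\<^esub> structure_map A (proj m z b')"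
      using cl by (simp add: proj_def sm_sum finsum_rdistr)
    also have "\<dots> = structure_map A (proj m z b') \<otimes>\<^bsub>A\<^esub> \<chi> A g"
      using cl by (simp add: m_comm)
    finally have "\<chi> A g = monomial A r x m"
      using sm_inverse[OF m(2)] cl X.mu_closed by metis
    then show "\<chi> A g = chi m A g"
      unfolding gx chi_tor[OF A x mR] by simp
  qed
  then show ?thesis using mR by blast
qed

lemma weights_eq: "weights scale B T = chi ` R"
  using chi_weight weight_is_chi by blast

lemma chi_zero: "0 \<in> R \<Longrightarrow> chi 0 = \<one>\<^bsub>C.CG\<^esub>"
proof (rule C.character_eqI)
  fix A :: "('k, 'u) module" and g assume R: "0 \<in> R" and A: "A \<in> k_algebras" and g: "g \<in> T A"
  interpret k_algebra A using A by (simp add: k_algebra_iff)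
  obtain x where x: "x \<in> carrier (Gm_power r A)" and gx: "g = tor B S id e r A x"
    using T_cases[OF A g] .
  show "chi 0 A g = \<one>\<^bsub>C.CG\<^esub> A g"
    using A g chi_tor[OF A x R] by (simp add: gx)
qed (auto simp: chi_closed C.character_one_closed)

lemma chi_uminus:
  assumes m: "m \<in> R" "- m \<in> R"
  shows "chi (- m) = inv\<^bsub>C.CG\<^esub> (chi m)"
proof -
  interpret G: comm_group C.CG by (rule C.character_comm_group)
  have "chi (- m) \<otimes>\<^bsub>C.CG\<^esub> chi m = \<one>\<^bsub>C.CG\<^esub>"
  proof (rule C.character_eqI)
    fix A :: "('k, 'u) module" and g assume A: "A \<in> k_algebras" and g: "g \<in> T A"
    interpret k_algebra A using A by (simp add: k_algebra_iff)
    obtain x where x: "x \<in> carrier (Gm_power r A)" and gx: "g = tor B S id e r A x"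
      using T_cases[OF A g] .
    show "(chi (- m) \<otimes>\<^bsub>C.CG\<^esub> chi m) A g = \<one>\<^bsub>C.CG\<^esub> A g"
      using A g chi_tor[OF A x m(1)] chi_tor[OF A x m(2)] monomial_uminus[OF x] by (simp add: gx)
  qed (auto simp: chi_closed m C.character_one_closed C.character_mult_closed)
  then show ?thesis by (intro G.inv_equality[symmetric] chi_closed m)
qed

text \<open>At the generic point of the enlarged torus \<open>chi (k i)\<close> takes as value the
  \<open>i\<close>-th indeterminate. A relation thus says that a Laurent monomial equals 1, which
  makes its exponent zero.\<close>

lemma chi_independent: "int_independent C.CG ((\<lambda>i. chi (k i)) ` {..<s})"
  unfolding int_independent_def
proof (intro allI impI)
  fix c :: "('k, 'v, 'u) character \<Rightarrow> int"
  assume prod: "finprod C.CG (\<lambda>\<alpha>. \<alpha> [^]\<^bsub>C.CG\<^esub> c \<alpha>) ((\<lambda>i. chi (k i)) ` {..<s}) = \<one>\<^bsub>C.CG\<^esub>"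
  interpret G: comm_group C.CG by (rule C.character_comm_group)
  let ?g = "tor B S w e s LA (univ_point s)"
  have g: "?g \<in> T LA" using enlarged_le[OF LA_k_algebra] point_closed by blast
  note hom = C.evaluation_hom[OF LA_k_algebra g]
  have val: "chi (k i) LA ?g = univ_point s i" if "i < s" for i
    using chi_enlarged[OF LA_k_algebra point_closed k_R[OF that]] that
    by (simp add: w_k LA.monomial_single)
  \<comment> \<open>Distinct indices give distinct characters, so the product over characters can be
    indexed by \<open>i\<close>.\<close>
  have inj: "inj_on (\<lambda>i. chi (k i)) {..<s}"
  proof (rule inj_onI)
    fix i j assume ij: "i \<in> {..<s}" "j \<in> {..<s}" and "chi (k i) = chi (k j)"
    then have "univ_point s i = univ_point s j" using val[of i] val[of j] by simp
    then have "single (single i (1::int)) (1::'k) = single (single j 1) 1"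
      using ij by (simp add: point_def)
    from single_key_eqD[OF this] have "single i (1::int) = single j 1" by simp
    from single_key_eqD[OF this] show "i = j" by simp
  qed
  have cl: "chi (k i) \<in> carrier C.CG" if "i < s" for i
    using that by (simp add: chi_closed k_R)
  define m where "m = (\<Sum>i<s. single i (c (chi (k i))))"
  have m: "lookup m i = c (chi (k i))" if "i < s" for i
  proof -
    have "lookup m i = (\<Sum>j<s. if j = i then c (chi (k j)) else 0)"
      unfolding m_def lookup_sum by (intro sum.cong refl) (auto simp: lookup_single when_def)
    then show ?thesis using that by simp
  qed
  have "\<one>\<^bsub>LA\<^esub> = (finprod C.CG (\<lambda>\<alpha>. \<alpha> [^]\<^bsub>C.CG\<^esub> c \<alpha>) ((\<lambda>i. chi (k i)) ` {..<s})) LA ?g"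
    unfolding prod using g LA_k_algebra by (simp del: LA_simps)
  also have "\<dots> = (finprod C.CG (\<lambda>i. chi (k i) [^]\<^bsub>C.CG\<^esub> c (chi (k i))) {..<s}) LA ?g"
    by (subst G.finprod_reindex[OF _ inj]) (auto simp: cl)
  also have "\<dots> = finprod (units_of LA) (\<lambda>i. (chi (k i) [^]\<^bsub>C.CG\<^esub> c (chi (k i))) LA ?g) {..<s}"
    by (rule G.comm_group_hom_finprod[OF LA.U.comm_monoid_axioms hom])
      (use g LA_k_algebra in \<open>auto simp: cl units_of_one\<close>)
  also have "\<dots> = monomial LA s (univ_point s) m"
    unfolding monomial_def
  proof (rule LA.U.finprod_cong'[OF refl])
    fix i assume "i \<in> {..<s}"
    then show "(chi (k i) [^]\<^bsub>C.CG\<^esub> c (chi (k i))) LA ?g =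
        univ_point s i [^]\<^bsub>units_of LA\<^esub> lookup m i"
      using hom_int_pow[OF hom cl G.group_axioms LA.U.group_axioms] by (simp add: val m)
  qed (use LA.Gm_powerD[OF point_closed] in auto)
  also have "\<dots> = \<phi> (single (univ_expo s m) 1)"
    by (rule monomial_point)
  finally have "single (univ_expo s m) (1::'k) = single 0 1" by simp
  from single_key_eqD[OF this] have "univ_expo s m = 0" by simp
  then have "c (chi (k i)) = 0" if "i < s" for i
    using lookup_expo_single[of id s m i] that m[OF that] by (simp add: id_def)
  then show "\<forall>\<alpha>\<in>(\<lambda>i. chi (k i)) ` {..<s}. c \<alpha> = 0" by simp
qed

lemma type_PL_T: "type_PL scale B T"
  unfolding type_PL_def almost_free_def
proof (intro conjI exI[of _ "(\<lambda>i. chi (k i)) ` {..<s}"])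
  show "weights scale B T \<subseteq> carrier C.CG" by (auto simp: weights_eq chi_closed)
  show "finite (weights scale B T)" by (simp add: weights_eq)
  show "(\<lambda>i. chi (k i)) ` {..<s} \<subseteq> weights scale B T" by (auto simp: weights_eq k_R)
  show "int_independent C.CG ((\<lambda>i. chi (k i)) ` {..<s})" by (rule chi_independent)
  show "weights scale B T \<subseteq> {\<one>\<^bsub>C.CG\<^esub>} \<union> (\<lambda>i. chi (k i)) ` {..<s} \<union>
      m_inv C.CG ` (\<lambda>i. chi (k i)) ` {..<s}"
  proof
    fix \<chi> assume "\<chi> \<in> weights scale B T"
    then obtain m where m: "m \<in> R" "\<chi> = chi m" by (auto simp: weights_eq)
    from R_cases[OF m(1)] show "\<chi> \<in> {\<one>\<^bsub>C.CG\<^esub>} \<union> (\<lambda>i. chi (k i)) ` {..<s} \<union>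
      m_inv C.CG ` (\<lambda>i. chi (k i)) ` {..<s}"
    proof (elim disjE exE conjE)
      assume "m = 0" then show ?thesis using chi_zero m by simp
    next
      fix i assume "i < s" "m = k i" then show ?thesis using m by simp
    next
      fix i assume "i < s" "m = - k i"
      then show ?thesis using m chi_uminus[of "k i"] k_R[of i] by simp
    qed
  qed
qed

end

text \<open>If all algebras of the universe are zero, characters take only the value 1, so every
  weight is neutral and the empty independent family suffices.\<close>

lemma type_PL_zero_algebras:
  fixes T :: "('k::field, 'v::ab_group_add, 'u) subfunctor"
  assumes "\<And>A :: ('k, 'u) module. A \<in> k_algebras \<Longrightarrow> \<one>\<^bsub>A\<^esub> = \<zero>\<^bsub>A\<^esub>"
  shows "type_PL scale B T"
proof -
  have "\<chi> = \<one>\<^bsub>character_group B T\<^esub>" if "\<chi> \<in> weights scale B T" for \<chi>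
  proof -
    have \<chi>: "\<chi> \<in> extensional k_algebras" and
      hom: "\<And>A. A \<in> k_algebras \<Longrightarrow> \<chi> A \<in> hom (points B T A) (units_of A) \<inter> extensional (T A)"
      using that by (auto simp: weights_def character_group_def)
    have "\<chi> A = (\<lambda>g\<in>T A. \<one>\<^bsub>A\<^esub>)" if A: "A \<in> k_algebras" for A
    proof (rule extensionalityI[of _ "T A"])
      fix g assume g: "g \<in> T A"
      interpret k_algebra A using A by (simp add: k_algebra_iff)
      have "\<chi> A g \<in> carrier A"
        using hom[OF A] g by (auto simp: hom_def points_def units_of_carrier Pi_iff)
      then have "\<chi> A g = \<one>\<^bsub>A\<^esub>"
        using l_one[of "\<chi> A g"] l_null[of "\<chi> A g"] unfolding assms[OF A] by simp
      then show "\<chi> A g = (\<lambda>g\<in>T A. \<one>\<^bsub>A\<^esub>) g" using g by simp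
    qed (use hom[OF A] in auto)
    then have "\<chi> = (\<lambda>A\<in>k_algebras. \<lambda>g\<in>T A. \<one>\<^bsub>A\<^esub>)"
      by (intro extensionalityI[OF \<chi>]) auto
    then show ?thesis by (simp add: character_group_def)
  qed
  then have "weights scale B T \<subseteq> {\<one>\<^bsub>character_group B T\<^esub>}" by blast
  then show ?thesis
    unfolding type_PL_def almost_free_def
    by (auto intro!: exI[of _ "{}"] finite_subset[of _ "{\<one>\<^bsub>character_group B T\<^esub>}"]
      simp: int_independent_def weights_def)
qed

theorem proposition1p4p9:
  fixes scale :: "'k::alg_closed_field \<Rightarrow> 'v::ab_group_add \<Rightarrow> 'v"
    and B :: "'v set"
    and I :: "'i set"
    and \<theta> :: "'i \<Rightarrow> ('k, 'v) fixed_object"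
    and T :: "('k, 'v, 'u) subfunctor"
  assumes "finite_dimensional_vector_space scale B"
    and "\<And>i. i \<in> I \<Longrightarrow> wf_object scale (\<theta> i)"
    and "maximal_torus B (fixer scale B I \<theta>) T"
  shows "type_PL scale B T"
proof (cases "\<exists>A \<in> (k_algebras :: ('k, 'u) module set). \<one>\<^bsub>A\<^esub> \<noteq> \<zero>\<^bsub>A\<^esub>")
  case False
  then show ?thesis by (intro type_PL_zero_algebras) blast
next
  case True
  then obtain A0 :: "('k, 'u) module" where A0: "A0 \<in> k_algebras" "\<one>\<^bsub>A0\<^esub> \<noteq> \<zero>\<^bsub>A0\<^esub>" by blast
  interpret A0: k_algebra A0 using A0(1) by (simp only: k_algebra_iff)
  \<comment> \<open>A nonzero algebra contains the field, which gives the universe room for the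
    Laurent ring.\<close>
  have "inj (structure_map A0)"
    by (rule injI) (simp add: A0.sm_inj[OF A0(2)])
  from inj_laurent[OF this] obtain \<phi> :: "'k laurent \<Rightarrow> 'u" where "inj \<phi>" ..
  then interpret laurent_copy \<phi>
    by unfold_locales
  interpret V: coordinates scale B using assms(1) by (simp add: coordinates_def)
  have subtorus: "subtorus B T" and T_le: "sub_le T (fixer scale B I \<theta>)"
    and max: "\<And>T'. subtorus B T' \<Longrightarrow> sub_le T' (fixer scale B I \<theta>) \<Longrightarrow> sub_le T T' \<Longrightarrow> sub_le T' T"
    using assms(3) unfolding maximal_torus_def by blast+
  have subgroup: "subgroup (T A) (GL B A)" if "A \<in> k_algebras" for A
    using subtorus that unfolding subtorus_def closed_subgroup_scheme_def by blast
  obtain r \<psi> where iso: "\<And>A. A \<in> k_algebras \<Longrightarrow> \<psi> A \<in> iso (Gm_power r A) (points B T A)"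
    and nat: "\<And>A A' h x. A \<in> k_algebras \<Longrightarrow> A' \<in> k_algebras \<Longrightarrow> h \<in> algebra_hom A A' \<Longrightarrow>
        x \<in> carrier (Gm_power r A) \<Longrightarrow> \<psi> A' (\<lambda>i\<in>{..<r}. h (x i)) = base_change B A A' h (\<psi> A x)"
    using subtorus unfolding subtorus_def by blast
  have T_eq: "T A = \<psi> A ` carrier (Gm_power r A)" if "A \<in> k_algebras" for A
    using iso[OF that] by (simp add: iso_def bij_betw_def points_def)
  have hom: "\<psi> A \<in> hom (Gm_power r A) (GL B A)" if "A \<in> k_algebras" for A
    using iso[OF that] subgroup.subset[OF subgroup[OF that]]
    by (auto simp: iso_def hom_def points_def)
  have "\<exists>S e. idempotents B S e \<and> (\<forall>m\<in>S. - m \<in> S) \<and> (\<forall>m\<in>S. univ_expo r m = m) \<and>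
      (\<forall>A\<in>k_algebras. \<forall>x\<in>carrier (Gm_power r A). \<psi> A x = tor B S id e r A x)"
  proof (rule diagonalization)
    show "finite B" by (rule V.finite_basis)
    show "\<psi> A \<in> hom (Gm_power r A) (GL B A)" if "A \<in> k_algebras" for A
      using that by (rule hom)
    show "\<psi> A' (\<lambda>i\<in>{..<r}. h (x i)) = base_change B A A' h (\<psi> A x)"
      if "A \<in> k_algebras" "A' \<in> k_algebras" "h \<in> algebra_hom A A'" "x \<in> carrier (Gm_power r A)" for A A' h x
      using that by (rule nat)
  qed blast
  then obtain S e where idem: "idempotents B S e" and sym: "\<And>m. m \<in> S \<Longrightarrow> - m \<in> S"
    and S: "\<And>m. m \<in> S \<Longrightarrow> univ_expo r m = m"
    and \<psi>: "\<And>A x. A \<in> k_algebras \<Longrightarrow> x \<in> carrier (Gm_power r A) \<Longrightarrow> \<psi> A x = tor B S id e r A x"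
    by blast
  have sidem: "symmetric_idempotents B S e"
    using idem sym by (simp add: symmetric_idempotents_def symmetric_idempotents_axioms_def)
  obtain R s k w where enl: "enlarged_torus B S e R s k w" and k_inj: "inj_on k {..<s}"
    using enlarged_torus_exists[OF sidem] .
  interpret enlarged_torus B S e R s k w by (rule enl)
  have T_tor: "T A = tor B S id e r A ` carrier (Gm_power r A)" if "A \<in> k_algebras" for A
    unfolding T_eq[OF that] using \<psi>[OF that] by simp
  have w_odd: "odd_weight S w" using sym w_uminus by (simp add: odd_weight_def)
  define T' :: "('k, 'v, 'u) subfunctor" where "T' A = tor B S w e s A ` carrier (Gm_power s A)" for A
  have T': "T' = (\<lambda>A. tor B S w e s A ` carrier (Gm_power s A))" by (simp add: T'_def fun_eq_iff)
  have "tor B S id e r LA (univ_point r) \<in> T LA"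
    using T_tor[OF LA_k_algebra] point_closed by blast
  \<comment> \<open>That \<open>T\<close> lies in the fixer is applied at the generic point; the
    transfer to the points of the larger torus starts from there.\<close>
  then have univ_fixes: "fixes_object scale B LA (tor B S id e r LA (univ_point r)) (\<theta> i)" if "i \<in> I" for i
    using T_le LA_k_algebra that unfolding sub_le_def fixer_def by blast
  have "sub_le T' (fixer scale B I \<theta>)"
    unfolding sub_le_def
  proof (intro ballI subsetI)
    fix A :: "('k, 'u) module" and g assume A: "A \<in> k_algebras" and "g \<in> T' A"
    then obtain x where x: "x \<in> carrier (Gm_power s A)" and g: "g = tor B S w e s A x"
      by (auto simp: T'_def)
    interpret P: torus_point B S e A using idem A by (rule idempotents_torus_point)
    show "g \<in> fixer scale B I \<theta> A"
      unfolding fixer_def g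
      using P.tor_GL[OF x] fixes_object_transfer[OF assms(1) sidem S w_odd w_zero A x assms(2) univ_fixes]
      by blast
  qed
  moreover have "sub_le T T'"
    unfolding sub_le_def
  proof (intro ballI subsetI)
    fix A :: "('k, 'u) module" and g assume A: "A \<in> k_algebras" and "g \<in> T A"
    then obtain x where x: "x \<in> carrier (Gm_power r A)" and g: "g = tor B S id e r A x"
      by (auto simp: T_tor)
    interpret P: enlarged_torus_point B S e R s k w A using A by (rule point_locale)
    show "g \<in> T' A" unfolding g T'_def by (rule P.tor_id_in_tor[OF x])
  qed
  moreover have "subtorus B T'" unfolding T' by (rule subtorus_tor)
  \<comment> \<open>Maximality: the enlarged torus contains \<open>T\<close> and still fixes all the
    objects, so \<open>T\<close> contains it.\<close>
  ultimately have T'_le: "sub_le T' T" by (intro max)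
  have "maximal_diagonal_torus \<phi> B S e R s k w scale r T"
  proof (intro maximal_diagonal_torus.intro maximal_diagonal_torus_axioms.intro)
    show "laurent_copy \<phi>" "enlarged_torus B S e R s k w" "coordinates scale B" "inj_on k {..<s}"
      by (fact laurent_copy_axioms enl V.coordinates_axioms k_inj)+
    show "T A = tor B S id e r A ` carrier (Gm_power r A)" if "A \<in> k_algebras" for A
      using that by (rule T_tor)
    show "tor B S w e s A ` carrier (Gm_power s A) \<subseteq> T A" if "A \<in> k_algebras" for A
      using T'_le that by (auto simp: sub_le_def T'_def)
    show "subgroup (T A) (GL B A)" if "A \<in> k_algebras" for A
      using that by (rule subgroup)
  qed
  then show ?thesis by (rule maximal_diagonal_torus.type_PL_T)
qed

end
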